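(* Let $n,d\ge 1$ be integers, let $\Delta^n=\{\mathbf{x}\in\mathbb{R}^n: 1-\sum_{i=1}^n x_i\ge 0,\ x_i\ge 0\ (1\le i\le n)\}$ be the $n$-dimensional standard simplex, and let $f\in\mathbb{R}[\mathbf{x}]=\mathbb{R}[x_1,\dots,x_n]$ be a polynomial of degree $d$. Write $f_{\min}=\min_{\mathbf{x}\in\Delta^n}f(\mathbf{x})$ and $f_{\max}=\max_{\mathbf{x}\in\Delta^n}f(\mathbf{x})$. Then for every integer $r\ge 2nd\sqrt{d}$, the Schm\"udgen-type lower bound $\mathrm{lb}(f,\mathcal{T}(\Delta^n))_r$ satisfies $$f_{\min}-\mathrm{lb}(f,\mathcal{T}(\Delta^n))_r\le \frac{C_\Delta(n,d)}{r^2}\,(f_{\max}-f_{\min}),\qquad\text{where } C_\Delta(n,d)=2n^2d^3\,\gamma(\Delta^n)_d .$$ The constant $C_\Delta(n,d)$ depends only on $n$ and $d$; it depends polynomially on $n$ (for fixed $d$) and polynomially on $d$ (for fixed $n$).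
   Context: $\mathbb{R}[\mathbf{x}]_k$ denotes polynomials of degree at most $k$; $\Sigma[\mathbf{x}]$ denotes the set of sums of squares of polynomials in $\mathbb{R}[\mathbf{x}]$. Truncated preordering of the simplex: put $g_i=x_i$ for $1\le i\le n$, $g_{n+1}=1-\sum_{i=1}^n x_i$, and $g_J=\prod_{j\in J}g_j$ for $J\subseteq[n+1]$ ($g_\emptyset=1$). Then $$\mathcal{T}(\Delta^n)_{2r}=\Big\{\sum_{J\subseteq[n+1]}\sigma_J g_J:\ \sigma_J\in\Sigma[\mathbf{x}],\ \deg(\sigma_Jg_J)\le 2r\Big\}.$$ Lower bound: $\mathrm{lb}(f,\mathcal{T}(\Delta^n))_r=\max\{\lambda\in\mathbb{R}: f-\lambda\in\mathcal{T}(\Delta^n)_{2r}\}$ (read as a supremum). The constant $\gamma(\Delta^n)_d$: equip $\Delta^n$ with the probability measure $d\mu_\Delta(\mathbf{x})=c_n\,x_1^{-1/2}\cdots x_n^{-1/2}(1-\sum_i x_i)^{-1/2}d\mathbf{x}$ ($c_n>0$ a normalization constant) and the inner product $\langle p,q\rangle=\int_{\Delta^n}pq\,d\mu_\Delta$. Let $H_k=\{p\in\mathbb{R}[\mathbf{x}]_k:\langle p,q\rangle=0\ \text{for all } q\in\mathbb{R}[\mathbf{x}]_{k-1}\}$ (with $H_0$ the constants). Every $p\in\mathbb{R}[\mathbf{x}]_d$ decomposes uniquely as $p=\sum_{k=0}^d p_k$ with $p_k\in H_k$. With $\|p\|_{\Delta^n}=\max_{\mathbf{x}\in\Delta^n}|p(\mathbf{x})|$,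 set $$\gamma(\Delta^n)_d=\max_{0\ne p\in\mathbb{R}[\mathbf{x}]_d}\ \max_{0\le k\le d}\frac{\|p_k\|_{\Delta^n}}{\|p\|_{\Delta^n}}<\infty .$$ "Depends polynomially on $n$ (for fixed $d$)" means: for each fixed $d$ the quantity is bounded above by a polynomial in $n$; similarly with the roles of $n$ and $d$ exchanged. *)

theory Defs
  imports "HOL-Analysis.Analysis" "HOL-Library.Poly_Mapping"
    "HOL-Computational_Algebra.Polynomial"
begin

text \<open>Real polynomials in the variables \<open>X 1, X 2, \<dots>\<close>: finitely supported maps from exponent
  vectors to coefficients. The ring structure is the convolution product of \<open>Poly_Mapping\<close>;
  \<open>polys n\<close> is the subring of polynomials in \<open>X 1, \<dots>, X n\<close>.\<close>

type_synonym mpoly = "(nat \<Rightarrow>\<^sub>0 nat) \<Rightarrow>\<^sub>0 real"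

definition X :: "nat \<Rightarrow> mpoly" where
  "X i = Poly_Mapping.single (Poly_Mapping.single i 1) 1"

definition const_mpoly :: "real \<Rightarrow> mpoly" where
  "const_mpoly c = Poly_Mapping.single 0 c"

definition mon_deg :: "(nat \<Rightarrow>\<^sub>0 nat) \<Rightarrow> nat" where
  "mon_deg m = (\<Sum>i\<in>Poly_Mapping.keys m. Poly_Mapping.lookup m i)"

text \<open>Total degree; the zero polynomial gets degree 0.\<close>

definition tot_deg :: "mpoly \<Rightarrow> nat" where
  "tot_deg p = Max (insert 0 (mon_deg ` Poly_Mapping.keys p))"

definition eval_mpoly :: "mpoly \<Rightarrow> (nat \<Rightarrow> real) \<Rightarrow> real" where
  "eval_mpoly p x = (\<Sum>m\<in>Poly_Mapping.keys p.
     Poly_Mapping.lookup p m * (\<Prod>i\<in>Poly_Mapping.keys m. x i ^ Poly_Mapping.lookup m i))"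

definition polys :: "nat \<Rightarrow> mpoly set" where
  "polys n = {p. \<forall>m\<in>Poly_Mapping.keys p. Poly_Mapping.keys m \<subseteq> {1..n}}"

definition polys_upto :: "nat \<Rightarrow> nat \<Rightarrow> mpoly set" where
  "polys_upto n k = {p \<in> polys n. tot_deg p \<le> k}"

definition sos :: "nat \<Rightarrow> mpoly set" where
  "sos n = {p. \<exists>qs. set qs \<subseteq> polys n \<and> p = (\<Sum>q\<leftarrow>qs. q ^ 2)}"

text \<open>Points of \<open>\<real>\<^sup>n\<close> are functions on \<open>{1..n}\<close>, extended by \<open>undefined\<close> outside, as in the
  space of the product measure \<open>Pi\<^sub>M {1..n}\<close>.\<close>

definition std_simplex :: "nat \<Rightarrow> (nat \<Rightarrow> real) set" where
  "std_simplex n = {x \<in> {1..n} \<rightarrow>\<^sub>E UNIV. 1 - (\<Sum>i=1..n. x i) \<ge> 0 \<and> (\<forall>i\<in>{1..n}. x i \<ge> 0)}"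

definition simplex_gen :: "nat \<Rightarrow> nat \<Rightarrow> mpoly" where
  "simplex_gen n i = (if i = n + 1 then 1 - (\<Sum>j=1..n. X j) else X i)"

text \<open>The preordering of the simplex truncated at degree \<open>k\<close>; it is used with \<open>k = 2 * r\<close>.\<close>

definition simplex_preorder :: "nat \<Rightarrow> nat \<Rightarrow> mpoly set" where
  "simplex_preorder n k =
     {\<Sum>J\<in>Pow {1..n+1}. \<sigma> J * (\<Prod>j\<in>J. simplex_gen n j) | \<sigma>.
        \<forall>J\<in>Pow {1..n+1}. \<sigma> J \<in> sos n \<and> tot_deg (\<sigma> J * (\<Prod>j\<in>J. simplex_gen n j)) \<le> k}"

definition lb_simplex :: "nat \<Rightarrow> mpoly \<Rightarrow> nat \<Rightarrow> real" where
  "lb_simplex n f r = Sup {l. f - const_mpoly l \<in> simplex_preorder n (2 * r)}"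

definition simplex_weight :: "nat \<Rightarrow> (nat \<Rightarrow> real) \<Rightarrow> real" where
  "simplex_weight n x =
     indicator (std_simplex n) x *
     ((\<Prod>i=1..n. x i powr (- 1 / 2)) * (1 - (\<Sum>i=1..n. x i)) powr (- 1 / 2))"

definition simplex_norm_const :: "nat \<Rightarrow> real" where
  "simplex_norm_const n = 1 / (LINT x|Pi\<^sub>M {1..n} (\<lambda>_. lborel). simplex_weight n x)"

definition simplex_measure :: "nat \<Rightarrow> (nat \<Rightarrow> real) measure" where
  "simplex_measure n =
     density (Pi\<^sub>M {1..n} (\<lambda>_. lborel))
       (\<lambda>x. ennreal (simplex_norm_const n * simplex_weight n x))"

definition simplex_inner :: "nat \<Rightarrow> mpoly \<Rightarrow> mpoly \<Rightarrow> real" where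
  "simplex_inner n p q = (LINT x|simplex_measure n. eval_mpoly p x * eval_mpoly q x)"

definition orth_space :: "nat \<Rightarrow> nat \<Rightarrow> mpoly set" where
  "orth_space n k =
     (if k = 0 then range const_mpoly
      else {p \<in> polys_upto n k. \<forall>q\<in>polys_upto n (k - 1). simplex_inner n p q = 0})"

definition simplex_norm :: "nat \<Rightarrow> mpoly \<Rightarrow> real" where
  "simplex_norm n p = (SUP x\<in>std_simplex n. \<bar>eval_mpoly p x\<bar>)"

text \<open>The family \<open>c\<close> ranges over the decompositions of \<open>p\<close> into orthogonal components; for each
  \<open>p\<close> there is exactly one (up to the irrelevant values \<open>c k\<close> with \<open>k > d\<close>).\<close>

definition gamma_simplex :: "nat \<Rightarrow> nat \<Rightarrow> real" where
  "gamma_simplex n d =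
     Sup {simplex_norm n (c k) / simplex_norm n p | p c k.
            p \<in> polys_upto n d \<and> p \<noteq> 0 \<and>
            (\<forall>j\<le>d. c j \<in> orth_space n j) \<and> p = (\<Sum>j\<le>d. c j) \<and> k \<le> d}"

definition C_simplex :: "nat \<Rightarrow> nat \<Rightarrow> real" where
  "C_simplex n d = 2 * real n ^ 2 * real d ^ 3 * gamma_simplex n d"

definition f_min :: "nat \<Rightarrow> mpoly \<Rightarrow> real" where
  "f_min n f = (INF x\<in>std_simplex n. eval_mpoly f x)"

definition f_max :: "nat \<Rightarrow> mpoly \<Rightarrow> real" where
  "f_max n f = (SUP x\<in>std_simplex n. eval_mpoly f x)"

end

theory Submission
  imports Defs
begin

text \<open>The substitution \<open>x\<^sub>i = z\<^sub>i\<^sup>2\<close> identifies the simplex with the sphere modulo sign changes, and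
  polynomials on the simplex with even polynomials on the sphere. For a univariate polynomial \<open>q\<close>,
  averaging \<open>q ((z \<bullet> w)\<^sup>2)\<close> over the signs of \<open>z\<close> gives a kernel on the simplex; the integral operator with this
  kernel acts on each \<open>H\<^sub>k\<close> as a scalar, the mean of \<open>q\<close> against a Jacobi polynomial. If \<open>q = s\<^sup>2\<close>
  with \<open>deg s \<le> r\<close>, splitting \<open>s ((z \<bullet> w)\<^sup>2)\<close> by the parities of the exponents of \<open>z\<close> shows that the operator
  maps nonnegative functions into the preordering truncated at \<open>2 r\<close>. With \<open>s\<close> concentrated at \<open>1\<close> the scalars
  \<open>\<lambda>\<^sub>k\<close> are within \<open>O (k\<^sup>2 n\<^sup>2 / r\<^sup>2)\<close> of \<open>1\<close>; so dividing the component of \<open>f - f\<^sub>m\<^sub>i\<^sub>n\<close> in \<open>H\<^sub>k\<close> by \<open>\<lambda>\<^sub>k\<close>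
  and adding a small constant leaves a nonnegative function, whose image under the operator is
  \<open>f - f\<^sub>m\<^sub>i\<^sub>n\<close> plus that constant. The operators for \<open>q = v\<^sup>N\<close> are rescaled Bernstein-Durrmeyer operators, so
  no analysis beyond the moments of the Dirichlet measure is needed. The bound on \<open>\<gamma>\<close> comes from the reproducing
  kernel, whose diagonal is at most the dimension of the even polynomials of degree \<open>2 d\<close> on the sphere.\<close>

text \<open>That the kernel acts by scalars is proved without spherical harmonics. Dirichlet moments
  are explicit, so the operator for \<open>v ^ N\<close> is seen to be triangular in the degree,
  with one scalar per degree; symmetry of the kernel then turns "up to lower degree" into exact
  equality on \<open>H_k\<close>. Membership in the preordering must be exact, with finitely many
  squares, although the operator is an integral. No quadrature is used: in each parity class the
  coefficients form a positive semidefinite moment matrix, and factoring it gives the squares. The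
  constants arise as follows. The Rayleigh quotient of the chosen trial sequence is known exactly,
  which gives \<open>1 - \<lambda>_k \<le> (5/4) * k^2 * n^2 / r^2\<close>. The condition on
  \<open>r\<close> makes \<open>k^2 * n^2 / r^2\<close> at most \<open>1/4\<close>, so division by
  \<open>\<lambda>_k\<close> costs little and
  \<open>1 / \<lambda>_k - 1 \<le> 2 * k^2 * n^2 / r^2\<close>. Each component is bounded by gamma
  times the range of \<open>f\<close>, and the sum of \<open>k^2\<close> over
  \<open>k \<le> d\<close> is at most \<open>d^3\<close>.\<close>

abbreviation (input) "lookup \<equiv> Poly_Mapping.lookup"
abbreviation (input) "keys \<equiv> Poly_Mapping.keys"
abbreviation (input) "single \<equiv> Poly_Mapping.single"

section \<open>The Dirichlet integral\<close>

definition simplex_L :: "nat \<Rightarrow> mpoly \<Rightarrow> real" where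
  "simplex_L n p = (LINT x|simplex_measure n. eval_mpoly p x)"

lemma std_simplex_measurable [measurable]:
  "std_simplex n \<in> sets (Pi\<^sub>M {1..n} (\<lambda>_. lborel))"
proof -
  have "std_simplex n = {x \<in> space (Pi\<^sub>M {1..n} (\<lambda>_. lborel :: real measure)).
      0 \<le> 1 - (\<Sum>i=1..n. x i) \<and> (\<forall>i\<in>{1..n}. 0 \<le> x i)}"
    by (auto simp: std_simplex_def space_PiM)
  also have "\<dots> \<in> sets (Pi\<^sub>M {1..n} (\<lambda>_. lborel))"
    by measurable
  finally show ?thesis .
qed

lemma nn_integral_Beta_scaled:
  fixes a b R :: real
  assumes "a > 0" "b > 0" "R \<ge> 0"
  shows "(\<integral>\<^sup>+t. ennreal (indicator {0..R} t * (t powr (a - 1) * (R - t) powr (b - 1))) \<partial>lborel)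
     = ennreal (Beta a b * R powr (a + b - 1))"
proof (cases "R = 0")
  case True
  have "(\<lambda>t::real. ennreal (indicator {0..R} t * (t powr (a - 1) * (R - t) powr (b - 1)))) = (\<lambda>t. 0)"
    using True by (auto simp: fun_eq_iff indicator_def)
  then show ?thesis using True by simp
next
  case False
  with assms have R: "R > 0" by simp
  have "(\<integral>\<^sup>+t. ennreal (indicator {0..R} t * (t powr (a - 1) * (R - t) powr (b - 1))) \<partial>lborel)
     = ennreal \<bar>R\<bar> * (\<integral>\<^sup>+t. ennreal (indicator {0..R} (0 + R * t) *
          ((0 + R * t) powr (a - 1) * (R - (0 + R * t)) powr (b - 1))) \<partial>lborel)"
    using R by (intro nn_integral_real_affine) auto
  also have "(\<lambda>t. ennreal (indicator {0..R} (0 + R * t) *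
          ((0 + R * t) powr (a - 1) * (R - (0 + R * t)) powr (b - 1)))) =
        (\<lambda>t. ennreal (R powr (a + b - 2)) * (indicator {0..1} t * ennreal (t powr (a - 1) * (1 - t) powr (b - 1))))"
  proof
    fix t :: real
    show "ennreal (indicator {0..R} (0 + R * t) * ((0 + R * t) powr (a - 1) * (R - (0 + R * t)) powr (b - 1)))
      = ennreal (R powr (a + b - 2)) * (indicator {0..1} t * ennreal (t powr (a - 1) * (1 - t) powr (b - 1)))"
    proof (cases "t \<in> {0..1}")
      case True
      have "(R - R * t) powr (b - 1) = R powr (b - 1) * (1 - t) powr (b - 1)"
        using True R by (subst powr_mult[symmetric]) (auto simp: algebra_simps)
      moreover have "(R * t) powr (a - 1) = R powr (a - 1) * t powr (a - 1)"
        using True R by (subst powr_mult) auto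
      moreover have "R powr (a + b - 2) = R powr (a - 1) * R powr (b - 1)"
        by (simp add: powr_add[symmetric])
      moreover have "0 \<le> R * t" "R * t \<le> R" using True R by (auto simp: mult_left_le)
      ultimately show ?thesis using True R
        by (simp add: ennreal_mult[symmetric] mult_ac)
    next
      case False
      then have "\<not> (0 \<le> R * t \<and> R * t \<le> R)"
        using R by (auto simp: zero_le_mult_iff mult_le_cancel_left1)
      with False show ?thesis by auto
    qed
  qed
  also have "(\<integral>\<^sup>+t. ennreal (R powr (a + b - 2)) *
        (indicator {0..1} t * ennreal (t powr (a - 1) * (1 - t) powr (b - 1))) \<partial>lborel)
      = ennreal (R powr (a + b - 2)) *
        (\<integral>\<^sup>+t. indicator {0..1} t * ennreal (t powr (a - 1) * (1 - t) powr (b - 1)) \<partial>lborel)"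
    by (intro nn_integral_cmult) measurable
  also have "(\<integral>\<^sup>+t. indicator {0..1} t * ennreal (t powr (a - 1) * (1 - t) powr (b - 1)) \<partial>lborel)
      = ennreal (Beta a b)"
    using nn_integral_has_integral_lebesgue[OF _ has_integral_Beta_real[OF assms(1,2)]]
    by (simp add: indicator_mult_ennreal mult_ac)
  also have "ennreal \<bar>R\<bar> * (ennreal (R powr (a + b - 2)) * ennreal (Beta a b))
      = ennreal (Beta a b * R powr (a + b - 1))"
  proof -
    have "Beta a b \<ge> 0" using assms by (auto simp: Beta_def Gamma_real_nonneg intro!: divide_nonneg_nonneg mult_nonneg_nonneg)
    moreover have "R powr (a + b - 1) = R * R powr (a + b - 2)"
      using R powr_add[of R 1 "a + b - 2"] by simp
    ultimately show ?thesis using R by (simp add: ennreal_mult[symmetric] mult_ac)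
  qed
  finally show ?thesis .
qed

lemma std_simplex_Suc_upd:
  assumes "x \<in> space (Pi\<^sub>M {1..n} (\<lambda>_. lborel :: real measure))"
  shows "x(Suc n := t) \<in> std_simplex (Suc n) \<longleftrightarrow> x \<in> std_simplex n \<and> t \<in> {0..1 - (\<Sum>i=1..n. x i)}"
proof -
  have ext: "x \<in> extensional {1..n}" using assms by (auto simp: space_PiM PiE_def)
  have "(\<Sum>i=1..n. (x(Suc n := t)) i) = (\<Sum>i=1..n. x i)" by (intro sum.cong) auto
  moreover have "x(Suc n := t) \<in> {1..Suc n} \<rightarrow>\<^sub>E UNIV"
    using ext by (auto simp: PiE_def extensional_def)
  moreover have "x \<in> {1..n} \<rightarrow>\<^sub>E UNIV" using ext by (auto simp: PiE_def)
  moreover have "(\<forall>i\<in>{1..Suc n}. 0 \<le> (x(Suc n := t)) i) \<longleftrightarrow> (\<forall>i\<in>{1..n}. 0 \<le> x i) \<and> 0 \<le> t"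
    by (auto simp: le_Suc_eq)
  ultimately show ?thesis by (auto simp: std_simplex_def)
qed

text \<open>Integrating out the last coordinate is a scaled Beta integral over
  \<open>[0, 1 - \<Sum> x]\<close>. It leaves the same integrand in one dimension less, with
  \<open>\<beta>\<close> increased by the last \<open>\<alpha>\<close>; hence the induction for
  arbitrary \<open>\<beta>\<close>.\<close>

lemma Dirichlet_nn_integral:
  fixes \<alpha> :: "nat \<Rightarrow> real"
  assumes "\<And>i. \<alpha> i > 0" "\<beta> > 0"
  shows "(\<integral>\<^sup>+x. ennreal (indicator (std_simplex n) x *
            ((\<Prod>i=1..n. x i powr (\<alpha> i - 1)) * (1 - (\<Sum>i=1..n. x i)) powr (\<beta> - 1)))
            \<partial>Pi\<^sub>M {1..n} (\<lambda>_. lborel))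
      = ennreal ((\<Prod>i=1..n. Gamma (\<alpha> i)) * Gamma \<beta> / Gamma ((\<Sum>i=1..n. \<alpha> i) + \<beta>))"
  using assms(2)
proof (induction n arbitrary: \<beta>)
  case 0
  interpret product_sigma_finite "\<lambda>_::nat. lborel :: real measure" ..
  have "Gamma \<beta> \<noteq> 0" using Gamma_real_pos[OF 0] by simp
  then show ?case
    by (simp add: PiM_empty nn_integral_count_space_finite std_simplex_def)
next
  case (Suc n)
  interpret product_sigma_finite "\<lambda>_::nat. lborel :: real measure" ..
  let ?P = "Pi\<^sub>M {1..n} (\<lambda>_. lborel :: real measure)"
  let ?a = "\<alpha> (Suc n)"
  let ?F = "\<lambda>x. ennreal (indicator (std_simplex (Suc n)) x *
            ((\<Prod>i=1..Suc n. x i powr (\<alpha> i - 1)) * (1 - (\<Sum>i=1..Suc n. x i)) powr (\<beta> - 1)))"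
  have a: "?a > 0" by (rule assms(1))
  have ins: "{1..Suc n} = insert (Suc n) {1..n}" by auto
  have meas: "?F \<in> borel_measurable (Pi\<^sub>M (insert (Suc n) {1..n}) (\<lambda>_. lborel))"
    unfolding ins[symmetric] by measurable
  have "integral\<^sup>N (Pi\<^sub>M {1..Suc n} (\<lambda>_. lborel)) ?F =
      (\<integral>\<^sup>+x. (\<integral>\<^sup>+t. ?F (x(Suc n := t)) \<partial>lborel) \<partial>?P)"
    using product_nn_integral_insert[OF _ _ meas] by (simp only: ins) simp
  also have "\<dots> = (\<integral>\<^sup>+x. ennreal (Beta ?a \<beta>) * ennreal (indicator (std_simplex n) x *
            ((\<Prod>i=1..n. x i powr (\<alpha> i - 1)) * (1 - (\<Sum>i=1..n. x i)) powr (?a + \<beta> - 1))) \<partial>?P)"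
  proof (intro nn_integral_cong)
    fix x assume x: "x \<in> space ?P"
    let ?R = "1 - (\<Sum>i=1..n. x i)"
    let ?p = "\<Prod>i=1..n. x i powr (\<alpha> i - 1)"
    have p: "?p \<ge> 0" by (intro prod_nonneg) auto
    have F: "?F (x(Suc n := t)) = ennreal (indicator (std_simplex n) x * ?p) *
         ennreal (indicator {0..?R} t * (t powr (?a - 1) * (?R - t) powr (\<beta> - 1)))" for t
    proof -
      have "(\<Sum>i=1..n. (x(Suc n := t)) i) = (\<Sum>i=1..n. x i)" by (intro sum.cong) auto
      moreover have "(\<Prod>i=1..n. (x(Suc n := t)) i powr (\<alpha> i - 1)) = ?p" by (intro prod.cong) auto
      moreover have "indicator (std_simplex (Suc n)) (x(Suc n := t)) =
          (indicator (std_simplex n) x * indicator {0..?R} t :: real)"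
        using std_simplex_Suc_upd[OF x, of t] by (simp add: indicator_def)
      ultimately show ?thesis using p
        by (simp add: ennreal_mult[symmetric] mult_ac diff_diff_eq)
    qed
    have "(\<integral>\<^sup>+t. ?F (x(Suc n := t)) \<partial>lborel) = ennreal (indicator (std_simplex n) x * ?p) *
         (\<integral>\<^sup>+t. ennreal (indicator {0..?R} t * (t powr (?a - 1) * (?R - t) powr (\<beta> - 1))) \<partial>lborel)"
      unfolding F by (intro nn_integral_cmult) measurable
    also have "\<dots> = ennreal (indicator (std_simplex n) x * ?p) * ennreal (Beta ?a \<beta> * ?R powr (?a + \<beta> - 1))"
    proof (cases "x \<in> std_simplex n")
      case True
      then have "?R \<ge> 0" by (simp add: std_simplex_def)
      then show ?thesis using nn_integral_Beta_scaled[OF a Suc.prems] by simp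
    qed simp
    finally show "(\<integral>\<^sup>+t. ?F (x(Suc n := t)) \<partial>lborel) = ennreal (Beta ?a \<beta>) *
        ennreal (indicator (std_simplex n) x * (?p * ?R powr (?a + \<beta> - 1)))"
      using p a Suc.prems
      by (simp add: ennreal_mult[symmetric] mult_ac Beta_def Gamma_real_nonneg)
  qed
  also have "\<dots> = ennreal (Beta ?a \<beta>) * (\<integral>\<^sup>+x. ennreal (indicator (std_simplex n) x *
            ((\<Prod>i=1..n. x i powr (\<alpha> i - 1)) * (1 - (\<Sum>i=1..n. x i)) powr (?a + \<beta> - 1))) \<partial>?P)"
    by (intro nn_integral_cmult) measurable
  also have "\<dots> = ennreal (Beta ?a \<beta>) *
      ennreal ((\<Prod>i=1..n. Gamma (\<alpha> i)) * Gamma (?a + \<beta>) / Gamma ((\<Sum>i=1..n. \<alpha> i) + (?a + \<beta>)))"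
    using a Suc.prems by (subst Suc.IH) auto
  also have "\<dots> = ennreal ((\<Prod>i=1..Suc n. Gamma (\<alpha> i)) * Gamma \<beta> / Gamma ((\<Sum>i=1..Suc n. \<alpha> i) + \<beta>))"
  proof -
    have "Gamma (?a + \<beta>) > 0" using a Suc.prems by (intro Gamma_real_pos) auto
    then have "Beta ?a \<beta> * ((\<Prod>i=1..n. Gamma (\<alpha> i)) * Gamma (?a + \<beta>) / Gamma ((\<Sum>i=1..n. \<alpha> i) + (?a + \<beta>)))
       = (\<Prod>i=1..Suc n. Gamma (\<alpha> i)) * Gamma \<beta> / Gamma ((\<Sum>i=1..Suc n. \<alpha> i) + \<beta>)"
      by (simp add: Beta_def add_ac mult_ac)
    moreover have "0 \<le> Beta ?a \<beta>" using a Suc.prems by (simp add: Beta_def Gamma_real_nonneg)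
    ultimately show ?thesis by (metis ennreal_mult')
  qed
  finally show ?case .
qed

section \<open>Jacobi polynomials and the univariate extremal problem\<close>

text \<open>A functional given by its values on the powers of the variable. Staying formal makes the
  Jacobi part pure algebra; positivity enters only with \<open>Lam_nonneg\<close>.\<close>

definition coeff_functional :: "(nat \<Rightarrow> real) \<Rightarrow> real poly \<Rightarrow> real" where
  "coeff_functional c q = (\<Sum>i\<le>degree q. coeff q i * c i)"

lemma coeff_functional_le: "degree q \<le> M \<Longrightarrow> coeff_functional c q = (\<Sum>i\<le>M. coeff q i * c i)"
  unfolding coeff_functional_def by (intro sum.mono_neutral_left) (auto simp: coeff_eq_0)

lemma coeff_functional_0 [simp]: "coeff_functional c 0 = 0"
  by (simp add: coeff_functional_def)

lemma coeff_functional_add: "coeff_functional c (p + q) = coeff_functional c p + coeff_functional c q"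
proof -
  let ?M = "max (degree p) (degree q)"
  have "degree (p + q) \<le> ?M" by (rule degree_add_le_max)
  then show ?thesis
    by (simp add: coeff_functional_le[of _ ?M] sum.distrib distrib_right)
qed

lemma coeff_functional_smult: "coeff_functional c (smult a p) = a * coeff_functional c p"
  using degree_smult_le[of a p] by (simp add: coeff_functional_le[of _ "degree p"] sum_distrib_left mult_ac)

lemma coeff_functional_minus: "coeff_functional c (- p) = - coeff_functional c p"
  using coeff_functional_smult[of c "-1" p] by simp

lemma coeff_functional_diff: "coeff_functional c (p - q) = coeff_functional c p - coeff_functional c q"
  using coeff_functional_add[of c p "- q"] by (simp add: coeff_functional_minus)

lemma coeff_functional_sum: "coeff_functional c (sum f A) = (\<Sum>i\<in>A. coeff_functional c (f i))"
  by (induction A rule: infinite_finite_induct) (auto simp: coeff_functional_add)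

lemma coeff_functional_pCons: "coeff_functional c (pCons a q) = a * c 0 + coeff_functional (\<lambda>i. c (Suc i)) q"
proof -
  have "coeff_functional c (pCons a q) = (\<Sum>i\<le>Suc (degree q). coeff (pCons a q) i * c i)"
    by (rule coeff_functional_le) (simp add: degree_pCons_le)
  also have "\<dots> = a * c 0 + coeff_functional (\<lambda>i. c (Suc i)) q"
    by (subst sum.atMost_Suc_shift) (simp add: coeff_functional_def)
  finally show ?thesis .
qed

text \<open>The scalar by which the kernel with \<open>q = v\<^sup>N\<close> acts on \<open>H\<^sub>k\<close> (see \<open>multinomial_op_eigen\<close>). For \<open>k = 0\<close> these are
  the moments of \<open>v = x\<^sub>1\<close>, so \<open>Lam n 0\<close> is integration against a Beta distribution.\<close>

definition kernel_eigenvalue :: "nat \<Rightarrow> nat \<Rightarrow> nat \<Rightarrow> real" where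
  "kernel_eigenvalue n k N = pochhammer (1/2) N * (\<Prod>i<k. real N - real i) / pochhammer ((real n + 1) / 2) (N + k)"

abbreviation Lam :: "nat \<Rightarrow> nat \<Rightarrow> real poly \<Rightarrow> real" where
  "Lam n k \<equiv> coeff_functional (kernel_eigenvalue n k)"

text \<open>Coefficients of the three-term recurrence of the Jacobi polynomials with parameters
  \<open>n / 2 - 1\<close> and \<open>- 1 / 2\<close> on \<open>[0, 1]\<close>, normalised to be \<open>1\<close> at \<open>1\<close>. The case \<open>k = 0\<close> is separate because
  the general formula reads \<open>0 / 0\<close> when \<open>n = 1\<close>.\<close>

definition rec_up :: "nat \<Rightarrow> nat \<Rightarrow> real" where
  "rec_up n k = (if k = 0 then real n / (real n + 1) else
     (2 * real k + real n - 1) * (2 * real k + real n) /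
     ((4 * real k + real n + 1) * (4 * real k + real n - 1)))"

definition rec_down :: "nat \<Rightarrow> nat \<Rightarrow> real" where
  "rec_down n k = 2 * real k * (2 * real k - 1) / ((4 * real k + real n - 3) * (4 * real k + real n - 1))"

lemma rec_up_pos: "n \<ge> 1 \<Longrightarrow> rec_up n k > 0"
  by (auto simp: rec_up_def intro!: divide_pos_pos mult_pos_pos)

lemma rec_down_nonneg: "n \<ge> 1 \<Longrightarrow> rec_down n k \<ge> 0"
  by (cases "k = 0") (auto simp: rec_down_def intro!: divide_nonneg_nonneg mult_nonneg_nonneg)

text \<open>This is multiplication by \<open>1 - v\<close> tested on \<open>v ^ N\<close>. Only
  differences occur on the right because the polynomials behind the recurrence all take the value 1
  at 1.\<close>

lemma kernel_eigenvalue_recurrence: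
  assumes n: "n \<ge> 1"
  shows "kernel_eigenvalue n k N - kernel_eigenvalue n k (Suc N) =
     rec_up n k * (kernel_eigenvalue n k N - kernel_eigenvalue n (Suc k) N) + rec_down n k * (kernel_eigenvalue n k N - kernel_eigenvalue n (k - 1) N)"
proof -
  define v where "v = (real n + 1) / 2"
  have v: "v \<ge> 1" using n by (simp add: v_def)
  have n_v: "real n = 2 * v - 1" by (simp add: v_def field_simps)
  have P: "pochhammer v m > 0" for m using v by (intro pochhammer_pos) auto
  have kernel_eigenvalue_v: "kernel_eigenvalue n k N = pochhammer (1/2) N * (\<Prod>i<k. real N - real i) / pochhammer v (N + k)" for k N
    by (simp only: kernel_eigenvalue_def v_def)
  show ?thesis
  proof (cases k)
    case 0
    define c where "c = pochhammer (1/2) N / pochhammer v N"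
    have "kernel_eigenvalue n 0 N = c" "kernel_eigenvalue n 0 (Suc N) = c * ((1/2 + N) / (v + N))" "kernel_eigenvalue n (Suc 0) N = c * (N / (v + N))"
      by (simp_all add: kernel_eigenvalue_v c_def pochhammer_Suc)
    moreover have e: "1 - (1/2 + real N) / (v + N) = (2 * v - 1) / (2 * v) * (1 - N / (v + N))"
      using v by (simp add: divide_simps)
    moreover from e have "c * (1 - (1/2 + real N) / (v + N)) = (2 * v - 1) / (2 * v) * (c * (1 - N / (v + N)))"
      by simp
    ultimately show ?thesis using 0 by (simp add: rec_up_def rec_down_def n_v algebra_simps)
  next
    case (Suc j)
    define F where "F = (\<Prod>i<j. real N - real i)"
    define Q where "Q = pochhammer v (N + j)"
    \<comment> \<open>In terms of \<open>x\<close> and \<open>y\<close> the four eigenvalues are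
      \<open>c\<close> times explicit rational functions, so that after removing \<open>c\<close> a
      single polynomial identity remains.\<close>
    define x where "x = real N - real j"
    define y where "y = v + real N + real j"
    have Q: "Q > 0" unfolding Q_def by (rule P)
    have y: "y > 0" "y + 1 > 0" "y + 2 > 0" using v by (auto simp: y_def)
    have F': "(\<Prod>i<Suc j. real (Suc N) - real i) = (N + 1) * F"
      unfolding F_def by (subst prod.lessThan_Suc_shift) auto
    define c where "c = pochhammer (1/2) N * F / Q"
    have Q1: "pochhammer v (N + Suc j) = Q * y" "pochhammer v (Suc N + Suc j) = Q * y * (y + 1)"
       "pochhammer v (N + Suc (Suc j)) = Q * y * (y + 1)"
      by (simp_all add: Q_def y_def pochhammer_Suc add_ac)
    have a: "kernel_eigenvalue n k N = c * x / y"
      unfolding kernel_eigenvalue_v Suc Q1 c_def x_def by (simp add: F_def)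
    have b: "kernel_eigenvalue n (k - 1) N = c"
      unfolding kernel_eigenvalue_v Suc c_def by (simp add: F_def Q_def)
    have d: "kernel_eigenvalue n (Suc k) N = c * x * (x - 1) / (y * (y + 1))"
      unfolding kernel_eigenvalue_v Suc Q1 c_def x_def by (simp add: F_def algebra_simps)
    have e: "kernel_eigenvalue n k (Suc N) = c * (1/2 + N) * (N + 1) / (y * (y + 1))"
      unfolding kernel_eigenvalue_v Suc Q1 F' c_def by (simp add: pochhammer_Suc mult_ac add_ac)
    have j: "rec_up n k = (j + v) * (j + 1/2 + v) / ((2 * j + 2 + v) * (2 * j + 1 + v))"
       "rec_down n k = (j + 1) * (j + 1/2) / ((2 * j + v) * (2 * j + 1 + v))"
      using v by (auto simp: Suc rec_up_def rec_down_def n_v divide_simps) (simp_all add: algebra_simps)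
    have nz: "2 * j + 2 + v > 0" "2 * j + 1 + v > 0" "2 * j + v > 0" using v by auto
    have N: "real N = x + j" by (simp add: x_def)
    have yx: "y = x + 2 * j + v" by (simp add: x_def y_def)
    have "x / y - (1/2 + N) * (N + 1) / (y * (y + 1)) =
      rec_up n k * (x / y - x * (x - 1) / (y * (y + 1))) + rec_down n k * (x / y - 1)"
    proof -
      have 1: "x / y - x * (x - 1) / (y * (y + 1)) = x * (2 * j + 2 + v) / (y * (y + 1))"
        using y by (simp add: divide_simps) (simp add: yx algebra_simps)
      have 2: "x / y - 1 = - (2 * j + v) / y"
        using y by (simp add: divide_simps) (simp add: yx algebra_simps)
      have 3: "rec_up n k * (x / y - x * (x - 1) / (y * (y + 1))) = (j + v) * (j + 1/2 + v) * x / ((2 * j + 1 + v) * (y * (y + 1)))"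
        unfolding 1 j(1) using nz y by (simp add: divide_simps)
      have 4: "rec_down n k * (x / y - 1) = - ((j + 1) * (j + 1/2)) / ((2 * j + 1 + v) * y)"
        unfolding 2 j(2) using nz y by (simp add: divide_simps) (simp add: algebra_simps)
      have 5: "(x * (y + 1) - (1/2 + N) * (N + 1)) * (2 * j + 1 + v) = (j + v) * (j + 1/2 + v) * x - (j + 1) * (j + 1/2) * (y + 1)"
        unfolding yx by (simp add: field_simps N)
      have "x / y - (1/2 + N) * (N + 1) / (y * (y + 1)) = (x * (y + 1) - (1/2 + N) * (N + 1)) * (2 * j + 1 + v) / ((2 * j + 1 + v) * (y * (y + 1)))"
        using nz y by (simp add: divide_simps)
      also have "\<dots> = rec_up n k * (x / y - x * (x - 1) / (y * (y + 1))) + rec_down n k * (x / y - 1)"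
        unfolding 5 3 4 using nz y by (simp add: divide_simps)
      finally show ?thesis .
    qed
    then have "c * (x / y - (1/2 + N) * (N + 1) / (y * (y + 1))) =
      c * (rec_up n k * (x / y - x * (x - 1) / (y * (y + 1))) + rec_down n k * (x / y - 1))" by simp
    then show ?thesis unfolding a b d e by (simp add: algebra_simps)
  qed
qed

lemma Lam_recurrence:
  assumes n: "n \<ge> 1"
  shows "Lam n k ([:1, -1:] * q) = rec_up n k * (Lam n k q - Lam n (Suc k) q) + rec_down n k * (Lam n k q - Lam n (k - 1) q)"
proof -
  have "[:1, -1:] * q = q - pCons 0 q" by simp
  then have "Lam n k ([:1, -1:] * q) = Lam n k q - coeff_functional (\<lambda>i. kernel_eigenvalue n k (Suc i)) q"
    by (simp only: coeff_functional_diff coeff_functional_pCons)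
  also have "\<dots> = (\<Sum>i\<le>degree q. coeff q i * (kernel_eigenvalue n k i - kernel_eigenvalue n k (Suc i)))"
    by (simp add: coeff_functional_def sum_subtractf algebra_simps)
  also have "\<dots> = rec_up n k * (Lam n k q - Lam n (Suc k) q) + rec_down n k * (Lam n k q - Lam n (k - 1) q)"
    unfolding kernel_eigenvalue_recurrence[OF n]
    by (simp add: coeff_functional_def sum_subtractf sum.distrib sum_distrib_left algebra_simps)
  finally show ?thesis .
qed

fun jac :: "nat \<Rightarrow> nat \<Rightarrow> real poly" where
  "jac n 0 = 1"
| "jac n (Suc 0) = 1 - smult (1 / rec_up n 0) [:1, -1:]"
| "jac n (Suc (Suc k)) = jac n (Suc k) -
     smult (1 / rec_up n (Suc k)) ([:1, -1:] * jac n (Suc k) - smult (rec_down n (Suc k)) (jac n (Suc k) - jac n k))"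

text \<open>Unifies the two recursive clauses: at \<open>k = 0\<close> the truncated index
  \<open>k - 1\<close> is again \<open>0\<close>, and \<open>rec_down n 0 = 0\<close>.\<close>

lemma jac_step:
  assumes n: "n \<ge> 1"
  shows "jac n (Suc k) = jac n k - smult (1 / rec_up n k) ([:1, -1:] * jac n k - smult (rec_down n k) (jac n k - jac n (k - 1)))"
  by (cases k) (simp_all add: rec_down_def)

lemma jac_recurrence:
  assumes n: "n \<ge> 1"
  shows "[:1, -1:] * jac n k = smult (rec_up n k) (jac n k - jac n (Suc k)) + smult (rec_down n k) (jac n k - jac n (k - 1))"
proof -
  have "smult (rec_up n k) (jac n k - jac n (Suc k)) = [:1, -1:] * jac n k - smult (rec_down n k) (jac n k - jac n (k - 1))"
    unfolding jac_step[OF n, of k] using rec_up_pos[OF n, of k] by simp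
  then show ?thesis by simp
qed

lemma degree_jac: "degree (jac n k) \<le> k"
proof (induction k rule: induct_nat_012)
  case 0 then show ?case by simp
next
  case 1 then show ?case by (auto intro!: degree_diff_le)
next
  case (ge2 k)
  have "degree ([:1, -1:] * jac n (Suc k)) \<le> 1 + degree (jac n (Suc k))"
    by (rule order_trans[OF degree_mult_le]) simp
  then show ?case using ge2 unfolding jac.simps
    by (intro degree_diff_le degree_smult_le[THEN order_trans]) auto
qed

text \<open>Both sides obey the same recurrence in \<open>k\<close> and agree at
  \<open>k = 0\<close>. This is the Funk-Hecke formula: the scalar on \<open>H_k\<close> is the
  integral of \<open>q\<close> against a Jacobi polynomial.\<close>

lemma Lam_eq_jac:
  assumes n: "n \<ge> 1"
  shows "Lam n k q = Lam n 0 (jac n k * q)"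
proof (induction k arbitrary: q rule: less_induct)
  case (less k)
  show ?case
  proof (cases k)
    case 0 then show ?thesis by simp
  next
    case (Suc j)
    have A: "rec_up n j \<noteq> 0" using rec_up_pos[OF n, of j] by simp
    have j: "j - 1 < k" "j < k" using Suc by auto
    have "rec_up n j * Lam n k q = rec_up n j * Lam n j q + rec_down n j * (Lam n j q - Lam n (j - 1) q) - Lam n j ([:1, -1:] * q)"
      using Lam_recurrence[OF n, of j q] Suc by (simp add: algebra_simps)
    also have "\<dots> = rec_up n j * Lam n 0 (jac n j * q) + rec_down n j * (Lam n 0 (jac n j * q) - Lam n 0 (jac n (j - 1) * q))
         - Lam n 0 (jac n j * ([:1, -1:] * q))"
      unfolding less.IH[OF j(1)] less.IH[OF j(2)] ..
    also have "\<dots> = Lam n 0 ((smult (rec_up n j) (jac n j) + smult (rec_down n j) (jac n j - jac n (j - 1)) - [:1, -1:] * jac n j) * q)"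
      by (simp only: coeff_functional_diff[symmetric] coeff_functional_add[symmetric] coeff_functional_smult[symmetric] mult_smult_left
           left_diff_distrib distrib_right) (simp only: mult_ac)
    also have "smult (rec_up n j) (jac n j) + smult (rec_down n j) (jac n j - jac n (j - 1)) - [:1, -1:] * jac n j = smult (rec_up n j) (jac n k)"
      unfolding jac_recurrence[OF n] Suc by (simp add: smult_diff_right algebra_simps)
    finally show ?thesis using A by (simp add: coeff_functional_smult)
  qed
qed

lemma Lam_0_1 [simp]: "Lam n 0 1 = 1"
  by (simp add: coeff_functional_def kernel_eigenvalue_def)

lemma Lam_1: "k > 0 \<Longrightarrow> Lam n k 1 = 0"
  by (auto simp: coeff_functional_def kernel_eigenvalue_def)

section \<open>Orthogonality of the Jacobi polynomials\<close>

text \<open>The dimension of the even polynomials of degree at most \<open>2 j\<close> on the \<open>n\<close>-sphere; \<open>even_harm_dim\<close> is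
  that of the spherical harmonics of degree \<open>2 j\<close>.\<close>

definition even_dim :: "nat \<Rightarrow> nat \<Rightarrow> real" where
  "even_dim n j = real ((n + 2 * j) choose n)"

definition even_harm_dim :: "nat \<Rightarrow> nat \<Rightarrow> real" where
  "even_harm_dim n j = (if j = 0 then 1 else even_dim n j - even_dim n (j - 1))"

text \<open>Read \<open>rec_up\<close> and \<open>rec_down\<close> as rates of a birth-death chain:
  \<open>even_harm_dim\<close> is its reversible weight and \<open>rec_weight n j\<close> the
  conductance between \<open>j\<close> and \<open>j + 1\<close>. Detailed balance is
  \<open>even_harm_dim_rec_up\<close> together with \<open>even_harm_dim_rec_down\<close>.\<close>

definition rec_weight :: "nat \<Rightarrow> nat \<Rightarrow> real" where
  "rec_weight n j = real n * even_dim n j / (4 * real j + real n + 1)"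

lemma even_dim_pos: "even_dim n j > 0"
  by (simp add: even_dim_def)

lemma even_dim_0 [simp]: "even_dim n 0 = 1"
  by (simp add: even_dim_def)

lemma even_dim_Suc: "(2 * real j + 2) * (2 * real j + 1) * even_dim n (Suc j) =
    (2 * real j + real n + 2) * (2 * real j + real n + 1) * even_dim n j"
proof -
  have "Suc m * (Suc (n + m) choose n) = Suc (n + m) * ((n + m) choose n)" for m
    using Suc_times_binomial_eq[of "n + m" m] binomial_symmetric[of n "n + m"]
      binomial_symmetric[of n "Suc (n + m)"] by (simp add: Suc_diff_le mult_ac)
  from this[of "2 * j"] this[of "Suc (2 * j)"]
  have 1: "real (Suc (2 * j)) * real (Suc (n + 2 * j) choose n) = real (Suc (n + 2 * j)) * even_dim n j"
   and 2: "real (Suc (Suc (2 * j))) * even_dim n (Suc j) = real (Suc (Suc (n + 2 * j))) * real (Suc (n + 2 * j) choose n)"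
    unfolding even_dim_def of_nat_mult[symmetric] by simp_all
  have "(2 * real j + 2) * (2 * real j + 1) * even_dim n (Suc j) =
     real (Suc (2 * j)) * (real (Suc (Suc (2 * j))) * even_dim n (Suc j))" by (simp add: algebra_simps)
  also have "\<dots> = real (Suc (Suc (n + 2 * j))) * (real (Suc (2 * j)) * real (Suc (n + 2 * j) choose n))"
    unfolding 2 by simp
  also have "\<dots> = (2 * real j + real n + 2) * (2 * real j + real n + 1) * even_dim n j"
    unfolding 1 by (simp add: algebra_simps)
  finally show ?thesis .
qed

lemma even_harm_dim_Suc: "even_harm_dim n (Suc j) * ((2 * real j + 2) * (2 * real j + 1)) = real n * (4 * real j + real n + 3) * even_dim n j"
  using even_dim_Suc[of j n] by (simp add: even_harm_dim_def algebra_simps)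

lemma even_harm_dim_Suc_eq: "even_harm_dim n (Suc j) = real n * (4 * real j + real n + 3) * even_dim n j / ((2 * real j + 2) * (2 * real j + 1))"
proof -
  have "(2 * real j + 2) * (2 * real j + 1) \<noteq> 0" by (simp add: add_nonneg_eq_0_iff)
  with even_harm_dim_Suc[of n j] show ?thesis by (simp add: eq_divide_eq)
qed

lemma even_harm_dim_pos: "n \<ge> 1 \<Longrightarrow> even_harm_dim n j > 0"
proof (cases j)
  case (Suc k)
  assume "n \<ge> 1"
  then show ?thesis unfolding Suc even_harm_dim_Suc_eq
    using even_dim_pos[of n k] by (intro divide_pos_pos mult_pos_pos) auto
qed (simp add: even_harm_dim_def)

lemma even_harm_dim_rec_down:
  assumes n: "n \<ge> 1" shows "even_harm_dim n (Suc j) * rec_down n (Suc j) = rec_weight n j"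
proof -
  have 1: "(2 * real j + 2) * (2 * real j + 1) > 0" "4 * real j + real n + 1 > 0" "4 * real j + real n + 3 > 0"
    by (auto intro!: mult_pos_pos)
  have C: "rec_down n (Suc j) = ((2 * real j + 2) * (2 * real j + 1)) / ((4 * real j + real n + 1) * (4 * real j + real n + 3))"
    by (simp add: rec_down_def algebra_simps)
  show ?thesis unfolding even_harm_dim_Suc_eq C rec_weight_def using 1 by (simp add: divide_simps)
qed

lemma even_harm_dim_rec_up:
  assumes n: "n \<ge> 1" shows "even_harm_dim n j * rec_up n j = rec_weight n j"
proof (cases j)
  case 0 then show ?thesis by (simp add: even_harm_dim_def rec_up_def rec_weight_def add_ac)
next
  case (Suc i)
  have 1: "(2 * real i + 2) * (2 * real i + 1) > 0" "4 * real i + real n + 5 > 0" "4 * real i + real n + 3 > 0"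
    by (auto intro!: mult_pos_pos)
  have A: "rec_up n (Suc i) = (2 * real i + real n + 1) * (2 * real i + real n + 2) / ((4 * real i + real n + 5) * (4 * real i + real n + 3))"
    by (simp add: rec_up_def algebra_simps)
  have B: "even_dim n (Suc i) = (2 * real i + real n + 2) * (2 * real i + real n + 1) * even_dim n i / ((2 * real i + 2) * (2 * real i + 1))"
    using even_dim_Suc[of i n] 1 by (simp add: field_simps)
  have W: "rec_weight n (Suc i) = real n * even_dim n (Suc i) / (4 * real i + real n + 5)"
    by (simp add: rec_weight_def algebra_simps)
  show ?thesis unfolding Suc even_harm_dim_Suc_eq A W B using 1 by (simp add: divide_simps)
qed

lemma sum_even_harm_dim: "(\<Sum>j\<le>d. even_harm_dim n j) = even_dim n d"
  by (induction d) (auto simp: even_harm_dim_def)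

lemma Lam_0_jac: "n \<ge> 1 \<Longrightarrow> Lam n 0 (jac n j) = (if j = 0 then 1 else 0)"
  using Lam_eq_jac[of n j 1] Lam_1[of j n] by auto

text \<open>The factor \<open>1 - v\<close> may be attached to either polynomial, and expanding it
  by the recurrence on both sides yields an equation between neighbouring products. Detailed balance
  says that the claimed values solve it too.\<close>

lemma jac_orthogonal:
  assumes n: "n \<ge> 1"
  shows "Lam n 0 (jac n i * jac n j) = (if i = j then 1 / even_harm_dim n i else 0)"
proof (induction i arbitrary: j rule: less_induct)
  case (less i)
  let ?B = "\<lambda>i j. Lam n 0 (jac n i * jac n j)"
  let ?D = "\<lambda>i j. if i = j then 1 / even_harm_dim n i else 0"
  show ?case
  proof (cases i)
    case 0 then show ?thesis using Lam_0_jac[OF n, of j] by (auto simp: even_harm_dim_def)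
  next
    case (Suc k)
    have A: "rec_up n k > 0" by (rule rec_up_pos[OF n])
    have m: "even_harm_dim n l > 0" for l by (rule even_harm_dim_pos[OF n])
    have IH: "?B k l = ?D k l" "?B (k - 1) l = ?D (k - 1) l" for l
      using less.IH[of k l] less.IH[of "k - 1" l] Suc by simp_all
    have "rec_up n k * (?B k j - ?B (Suc k) j) + rec_down n k * (?B k j - ?B (k - 1) j) = Lam n 0 (([:1, -1:] * jac n k) * jac n j)"
      unfolding jac_recurrence[OF n]
      by (simp only: coeff_functional_diff[symmetric] coeff_functional_add[symmetric] coeff_functional_smult[symmetric] mult_smult_left
           left_diff_distrib distrib_right)
    also have "([:1, -1:] * jac n k) * jac n j = jac n k * ([:1, -1:] * jac n j)" by (simp only: mult_ac)
    also have "Lam n 0 \<dots> = rec_up n j * (?B k j - ?B k (Suc j)) + rec_down n j * (?B k j - ?B k (j - 1))"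
      unfolding jac_recurrence[OF n]
      by (simp only: coeff_functional_diff[symmetric] coeff_functional_add[symmetric] coeff_functional_smult[symmetric] mult_smult_right
           right_diff_distrib distrib_left)
    finally have main: "rec_up n k * (?D k j - ?B (Suc k) j) + rec_down n k * (?D k j - ?D (k - 1) j)
       = rec_up n j * (?D k j - ?D k (Suc j)) + rec_down n j * (?D k j - ?D k (j - 1))"
      unfolding IH .
    have D: "rec_up n k * (?D k j - ?D (Suc k) j) + rec_down n k * (?D k j - ?D (k - 1) j)
       = rec_up n j * (?D k j - ?D k (Suc j)) + rec_down n j * (?D k j - ?D k (j - 1))"
    proof -
      have sym: "rec_up n l / even_harm_dim n (Suc l) = rec_down n (Suc l) / even_harm_dim n l" for l
        using even_harm_dim_rec_up[OF n, of l] even_harm_dim_rec_down[OF n, of l] m[of l] m[of "Suc l"]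
        by (simp add: field_simps)
      have c0: "rec_down n 0 = 0" by (simp add: rec_down_def)
      consider "j = k" | "j = Suc k" | "k = Suc j" | "j \<noteq> k" "j \<noteq> Suc k" "k \<noteq> Suc j" by blast
      then show ?thesis
      proof cases
        case 1 then show ?thesis by (cases k) (auto simp: c0)
      next
        case 2 then show ?thesis using sym[of k] by (auto simp: c0)
      next
        case 3 then show ?thesis using sym[of j] by (auto simp: c0)
      next
        case 4 then show ?thesis by (cases j; cases k) (auto simp: c0)
      qed
    qed
    \<comment> \<open>In \<open>main\<close> the product with index \<open>Suc k\<close> is the only
      one that the induction hypothesis leaves open; its factor \<open>rec_up n k\<close> is
      positive, so it is determined.\<close>
    have cancel: "x = y" if "a > 0" "a * (c - x) + e = a * (c - y) + e" for a c e x y :: real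
      using that by simp
    show ?thesis unfolding Suc by (rule cancel[OF A trans[OF main D[symmetric]]])
  qed
qed

text \<open>The weight \<open>even_harm_dim n j\<close> is the inverse squared norm of
  \<open>jac n j\<close>, so \<open>Lam n j\<close> of this sum reads off \<open>\<phi> j\<close>.
  With \<open>\<phi>\<close> constantly 1 it is the Christoffel-Darboux kernel at 1.\<close>

definition jac_sum :: "nat \<Rightarrow> nat \<Rightarrow> (nat \<Rightarrow> real) \<Rightarrow> real poly" where
  "jac_sum n r \<phi> = (\<Sum>j\<le>r. smult (\<phi> j * even_harm_dim n j) (jac n j))"

lemma degree_jac_sum: "degree (jac_sum n r \<phi>) \<le> r"
  unfolding jac_sum_def
  by (intro degree_sum_le) (auto intro!: order_trans[OF degree_smult_le] order_trans[OF degree_jac])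

lemma Lam_jac_sum:
  assumes n: "n \<ge> 1"
  shows "Lam n 0 (jac n k * jac_sum n r \<phi>) = (if k \<le> r then \<phi> k else 0)"
proof -
  have "Lam n 0 (jac n k * jac_sum n r \<phi>) = (\<Sum>j\<le>r. \<phi> j * even_harm_dim n j * Lam n 0 (jac n k * jac n j))"
    by (simp add: jac_sum_def sum_distrib_left coeff_functional_sum coeff_functional_smult)
  also have "\<dots> = (\<Sum>j\<le>r. if j = k then \<phi> k else 0)"
    using even_harm_dim_pos[OF n, of k] by (intro sum.cong) (auto simp: jac_orthogonal[OF n])
  finally show ?thesis by simp
qed

lemma Lam_jac_sum_sq:
  assumes n: "n \<ge> 1"
  shows "Lam n 0 (jac_sum n r \<phi> ^ 2) = (\<Sum>j\<le>r. even_harm_dim n j * \<phi> j ^ 2)"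
proof -
  have "Lam n 0 (jac_sum n r \<phi> ^ 2) = Lam n 0 (\<Sum>j\<le>r. smult (\<phi> j * even_harm_dim n j) (jac n j * jac_sum n r \<phi>))"
    by (simp add: power2_eq_square jac_sum_def[of n r \<phi>, THEN arg_cong, of "\<lambda>p. p * _"] sum_distrib_right)
  also have "\<dots> = (\<Sum>j\<le>r. even_harm_dim n j * \<phi> j ^ 2)"
    unfolding coeff_functional_sum coeff_functional_smult Lam_jac_sum[OF n] by (intro sum.cong) (auto simp: power2_eq_square)
  finally show ?thesis .
qed

text \<open>Writing the coefficients relative to the ground state \<open>even_harm_dim n j\<close> turns the quadratic form of
  \<open>1 - v\<close> into a Dirichlet form, to be minimised against the norm.\<close>

lemma Lam_jac_sum_sq_energy:
  assumes n: "n \<ge> 1" and \<phi>: "\<phi> (Suc r) = 0"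
  shows "Lam n 0 ([:1, -1:] * jac_sum n r \<phi> ^ 2) = (\<Sum>j\<le>r. rec_weight n j * (\<phi> j - \<phi> (Suc j)) ^ 2)"
proof -
  let ?s = "jac_sum n r \<phi>"
  \<comment> \<open>The index \<open>Suc r\<close> is included because the recurrence at
    \<open>j = r\<close> reaches it; there both sides are zero.\<close>
  have v: "Lam n 0 (jac n k * ?s) = \<phi> k" if "k \<le> Suc r" for k
    using that \<phi> Lam_jac_sum[OF n, of k r \<phi>] by (auto simp: le_Suc_eq)
  have "[:1, -1:] * ?s ^ 2 = (\<Sum>j\<le>r. smult (\<phi> j * even_harm_dim n j) (([:1, -1:] * jac n j) * ?s))"
    by (simp only: power2_eq_square jac_sum_def[of n r \<phi>, THEN arg_cong, of "\<lambda>p. [:1, -1:] * (p * _)"]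
         sum_distrib_right sum_distrib_left mult_smult_left mult_smult_right mult.assoc)
  then have "Lam n 0 ([:1, -1:] * ?s ^ 2) = (\<Sum>j\<le>r. \<phi> j * even_harm_dim n j * Lam n 0 (([:1, -1:] * jac n j) * ?s))"
    by (simp only: coeff_functional_sum coeff_functional_smult)
  also have "\<dots> = (\<Sum>j\<le>r. \<phi> j * even_harm_dim n j * (rec_up n j * (\<phi> j - \<phi> (Suc j)) + rec_down n j * (\<phi> j - \<phi> (j - 1))))"
  proof (intro sum.cong refl)
    fix j assume "j \<in> {..r}"
    then have "Lam n 0 (([:1, -1:] * jac n j) * ?s) = rec_up n j * (\<phi> j - \<phi> (Suc j)) + rec_down n j * (\<phi> j - \<phi> (j - 1))"
      unfolding jac_recurrence[OF n]
      by (simp add: v coeff_functional_diff coeff_functional_add coeff_functional_smult mult_smult_left left_diff_distrib distrib_right)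
    then show "\<phi> j * even_harm_dim n j * Lam n 0 (([:1, -1:] * jac n j) * ?s) =
       \<phi> j * even_harm_dim n j * (rec_up n j * (\<phi> j - \<phi> (Suc j)) + rec_down n j * (\<phi> j - \<phi> (j - 1)))" by simp
  qed
  \<comment> \<open>Summation by parts. The boundary term is kept because \<open>\<phi>\<close>
    vanishes only at the final index, while the induction passes through all smaller ones.\<close>
  also have "\<dots> = (\<Sum>j\<le>r. rec_weight n j * (\<phi> j - \<phi> (Suc j)) ^ 2) + \<phi> (Suc r) * rec_weight n r * (\<phi> r - \<phi> (Suc r))"
  proof (induction r)
    case 0
    show ?case using even_harm_dim_rec_up[OF n, of 0] by (simp add: rec_down_def power2_eq_square algebra_simps)
  next
    case (Suc r)
    have "\<phi> (Suc r) * even_harm_dim n (Suc r) * (rec_up n (Suc r) * (\<phi> (Suc r) - \<phi> (Suc (Suc r))) + rec_down n (Suc r) * (\<phi> (Suc r) - \<phi> r))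
       = \<phi> (Suc r) * (rec_weight n (Suc r) * (\<phi> (Suc r) - \<phi> (Suc (Suc r))) + rec_weight n r * (\<phi> (Suc r) - \<phi> r))"
      unfolding even_harm_dim_rec_up[OF n, symmetric, of "Suc r"] even_harm_dim_rec_down[OF n, symmetric, of r]
      by (simp add: algebra_simps)
    then show ?case using Suc.IH by (simp add: power2_eq_square algebra_simps)
  qed
  finally show ?thesis using \<phi> by simp
qed

text \<open>The eigenvalue \<open>k (2 k + n - 1)\<close> of the Jacobi operator, subtracted from its value at \<open>r + 1\<close>. For this
  trial sequence both sides of the Rayleigh quotient sum in closed form.\<close>

definition jackson_coeff :: "nat \<Rightarrow> nat \<Rightarrow> nat \<Rightarrow> real" where
  "jackson_coeff n r k = (real r + 1) * (2 * real r + real n + 1) - real k * (2 * real k + real n - 1)"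

lemma sum_even_dim_lin:
  "(real n + 2) * (\<Sum>i\<le>r. even_dim n i * (4 * real i + real n + 1)) = (2 * real r + real n + 2) * (2 * real r + real n + 1) * even_dim n r"
proof (induction r)
  case (Suc r)
  let ?T = "\<Sum>i\<le>r. even_dim n i * (4 * real i + real n + 1)"
  have "(real n + 2) * (\<Sum>i\<le>Suc r. even_dim n i * (4 * real i + real n + 1)) =
     (real n + 2) * ?T + (real n + 2) * (even_dim n (Suc r) * (4 * real (Suc r) + real n + 1))"
    by (simp only: sum.atMost_Suc distrib_left[of "real n + 2" ?T])
  also have "(real n + 2) * ?T = (2 * real r + 2) * (2 * real r + 1) * even_dim n (Suc r)"
    unfolding Suc.IH even_dim_Suc ..
  finally show ?case by (simp add: algebra_simps)
qed (simp add: algebra_simps)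

text \<open>An exact Rayleigh quotient. The increments \<open>4 * j + n + 1\<close> of the trial
  sequence cancel the denominator of \<open>rec_weight\<close>, so the energy is
  \<open>n * S\<close>. Since \<open>even_harm_dim\<close> is the increment of
  \<open>even_dim\<close>, Abel summation turns the norm into \<open>2 * P * S - W\<close>, without
  boundary term because the sequence vanishes at \<open>r + 1\<close>.\<close>

lemma sum_even_harm_dim_jackson_coeff:
  "real n * (real n + 4) * (\<Sum>j\<le>r. even_harm_dim n j * jackson_coeff n r j ^ 2) =
   (4 * (real r + 1) * (2 * real r + real n + 1) + real n * (real n + 1)) *
     (\<Sum>j\<le>r. rec_weight n j * (jackson_coeff n r j - jackson_coeff n r (Suc j)) ^ 2)"
proof -
  define S where "S r = (\<Sum>i\<le>r. even_dim n i * (4 * real i + real n + 1))" for r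
  define Q where "Q i = 4 * real i ^ 2 + 2 * (real n + 1) * real i + real n + 1" for i :: nat
  define W where "W r = (\<Sum>i\<le>r. even_dim n i * (4 * real i + real n + 1) * Q i)" for r
  define P where "P r = (real r + 1) * (2 * real r + real n + 1)" for r :: nat
  have d: "jackson_coeff n r j - jackson_coeff n r (Suc j) = 4 * real j + real n + 1" for j
    by (simp add: jackson_coeff_def algebra_simps)
  have e: "jackson_coeff n r j + jackson_coeff n r (Suc j) = 2 * P r - Q j" for j
    by (simp add: jackson_coeff_def P_def Q_def algebra_simps power2_eq_square)
  have num: "(\<Sum>j\<le>r. rec_weight n j * (jackson_coeff n r j - jackson_coeff n r (Suc j)) ^ 2) = real n * S r"
    unfolding S_def sum_distrib_left
  proof (intro sum.cong refl)
    fix j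
    have "4 * real j + real n + 1 > 0" by simp
    then show "rec_weight n j * (jackson_coeff n r j - jackson_coeff n r (Suc j)) ^ 2 = real n * (even_dim n j * (4 * real j + real n + 1))"
      unfolding d rec_weight_def by (simp add: power2_eq_square)
  qed
  have abel: "(\<Sum>j\<le>R. even_harm_dim n j * \<psi> j) = (\<Sum>j\<le>R. even_dim n j * (\<psi> j - \<psi> (Suc j))) + even_dim n R * \<psi> (Suc R)" for \<psi> R
    by (induction R) (auto simp: even_harm_dim_def algebra_simps)
  have p0: "jackson_coeff n r (Suc r) = 0" by (simp add: jackson_coeff_def algebra_simps)
  have "(\<Sum>j\<le>r. even_harm_dim n j * jackson_coeff n r j ^ 2) = (\<Sum>j\<le>r. even_dim n j * (jackson_coeff n r j ^ 2 - jackson_coeff n r (Suc j) ^ 2))"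
    using abel[of "\<lambda>j. jackson_coeff n r j ^ 2" r] p0 by simp
  also have "\<dots> = (\<Sum>j\<le>r. even_dim n j * ((4 * real j + real n + 1) * (2 * P r - Q j)))"
    unfolding d[symmetric] e[symmetric] by (simp add: power2_eq_square algebra_simps)
  also have "\<dots> = 2 * P r * S r - W r"
    unfolding S_def W_def by (simp add: sum_subtractf sum_distrib_left algebra_simps)
  finally have den: "(\<Sum>j\<le>r. even_harm_dim n j * jackson_coeff n r j ^ 2) = 2 * P r * S r - W r" .
  have S: "(real n + 2) * S r = (2 * real r + real n + 2) * (2 * real r + real n + 1) * even_dim n r" for r
    unfolding S_def by (rule sum_even_dim_lin)
  \<comment> \<open>\<open>W\<close> is again a multiple of \<open>S\<close>. The induction step is
    multiplied by \<open>n + 2\<close> so that the closed form of \<open>S\<close> applies on both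
    sides.\<close>
  have W: "(real n + 4) * W r = S r * (2 * (real n + 2) * P r - real n * (real n + 1))" for r
  proof (induction r)
    case 0 show ?case by (simp add: W_def S_def Q_def P_def algebra_simps)
  next
    case (Suc r)
    let ?l = "4 * real (Suc r) + real n + 1"
    have "(real n + 2) * ((real n + 4) * W (Suc r)) = (real n + 2) * ((real n + 4) * W r) + (real n + 2) * (real n + 4) * (even_dim n (Suc r) * ?l * Q (Suc r))"
      by (simp add: W_def algebra_simps)
    also have "(real n + 2) * ((real n + 4) * W r) = (2 * real r + 2) * (2 * real r + 1) * even_dim n (Suc r) * (2 * (real n + 2) * P r - real n * (real n + 1))"
      unfolding Suc.IH even_dim_Suc S[symmetric] by (simp add: algebra_simps)
    also have "\<dots> + (real n + 2) * (real n + 4) * (even_dim n (Suc r) * ?l * Q (Suc r)) =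
      (real n + 2) * S (Suc r) * (2 * (real n + 2) * P (Suc r) - real n * (real n + 1))"
      unfolding S Q_def P_def by (simp add: algebra_simps power2_eq_square)
    finally show ?case by simp
  qed
  have P: "4 * (real r + 1) * (2 * real r + real n + 1) = 4 * P r" by (simp add: P_def)
  have "real n * (real n + 4) * (2 * P r * S r - W r) = real n * (2 * (real n + 4) * P r * S r - (real n + 4) * W r)"
    by (simp add: algebra_simps)
  also have "\<dots> = (4 * P r + real n * (real n + 1)) * (real n * S r)"
    unfolding W by (simp add: algebra_simps)
  finally show ?thesis unfolding num den P .
qed

text \<open>The increments of \<open>k \<mapsto> Lam n 0 q - Lam n k q\<close> obey the recurrence satisfied by those of
  \<open>\<rho>\<close>, the derivative of the Jacobi polynomials at \<open>1\<close>, with \<open>\<le>\<close> in place of equality.\<close>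

lemma growth_bound:
  assumes n: "n \<ge> 1" and low: "\<And>k. Lam n k ([:1, -1:] * q) \<le> Lam n 0 ([:1, -1:] * q)"
  shows "Lam n 0 q - Lam n k q \<le> real k * (2 * real k + real n - 1) / real n * Lam n 0 ([:1, -1:] * q)"
proof -
  define \<rho> where "\<rho> k = real k * (2 * real k + real n - 1) / real n" for k :: nat
  define H where "H = Lam n 0 ([:1, -1:] * q)"
  have rho: "\<rho> (Suc k) - \<rho> k = (4 * real k + real n + 1) / real n" for k
    using n by (simp add: \<rho>_def field_simps)
  have rec: "rec_up n k * (\<rho> (Suc k) - \<rho> k) = rec_down n k * (\<rho> k - \<rho> (k - 1)) + 1" for k
  proof (cases k)
    case 0 then show ?thesis using n by (simp add: rho rec_up_def rec_down_def add_ac)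
  next
    case (Suc j)
    have nz: "4 * real j + real n + 5 > 0" "4 * real j + real n + 3 > 0" "4 * real j + real n + 1 > 0" "real n > 0" using n by auto
    have 1: "\<rho> (Suc k) - \<rho> k = (4 * real j + real n + 5) / real n" "\<rho> k - \<rho> (k - 1) = (4 * real j + real n + 1) / real n"
      unfolding Suc by (simp_all add: rho)
    have 2: "rec_up n k = (2 * real j + real n + 1) * (2 * real j + real n + 2) / ((4 * real j + real n + 5) * (4 * real j + real n + 3))"
      unfolding Suc by (simp add: rec_up_def algebra_simps)
    have 3: "rec_down n k = ((2 * real j + 2) * (2 * real j + 1)) / ((4 * real j + real n + 1) * (4 * real j + real n + 3))"
      unfolding Suc by (simp add: rec_down_def algebra_simps)
    have 4: "rec_up n k * (\<rho> (Suc k) - \<rho> k) = (2 * real j + real n + 1) * (2 * real j + real n + 2) / ((4 * real j + real n + 3) * real n)"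
      unfolding 1 2 using nz by (simp add: divide_simps)
    have 5: "rec_down n k * (\<rho> k - \<rho> (k - 1)) = ((2 * real j + 2) * (2 * real j + 1)) / ((4 * real j + real n + 3) * real n)"
      unfolding 1 3 using nz by (simp add: divide_simps)
    show ?thesis unfolding 4 5 using nz by (simp add: divide_simps) (simp add: algebra_simps)
  qed
  have inc: "Lam n k q - Lam n (Suc k) q \<le> (\<rho> (Suc k) - \<rho> k) * H" for k
  proof (induction k)
    case 0
    have "rec_up n 0 * (Lam n 0 q - Lam n (Suc 0) q) = H"
      using Lam_recurrence[OF n, of 0 q] by (simp add: H_def rec_down_def)
    also have "\<dots> = rec_up n 0 * ((\<rho> (Suc 0) - \<rho> 0) * H)"
      using rec[of 0] by (simp add: rec_down_def flip: mult.assoc)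
    finally show ?case using rec_up_pos[OF n, of 0] by simp
  next
    case (Suc k)
    have "rec_up n (Suc k) * (Lam n (Suc k) q - Lam n (Suc (Suc k)) q) = Lam n (Suc k) ([:1, -1:] * q) + rec_down n (Suc k) * (Lam n k q - Lam n (Suc k) q)"
      using Lam_recurrence[OF n, of "Suc k" q] by (simp add: algebra_simps)
    also have "\<dots> \<le> H + rec_down n (Suc k) * ((\<rho> (Suc k) - \<rho> k) * H)"
      using low[of "Suc k"] Suc.IH rec_down_nonneg[OF n, of "Suc k"] unfolding H_def
      by (intro add_mono mult_left_mono) auto
    also have "\<dots> = (rec_down n (Suc k) * (\<rho> (Suc k) - \<rho> k) + 1) * H" by (simp add: algebra_simps)
    also have "\<dots> = rec_up n (Suc k) * ((\<rho> (Suc (Suc k)) - \<rho> (Suc k)) * H)"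
      using rec[of "Suc k"] by (simp flip: mult.assoc)
    finally show ?case using rec_up_pos[OF n, of "Suc k"] by (simp add: mult_le_cancel_left)
  qed
  have "Lam n 0 q - Lam n k q \<le> \<rho> k * H"
  proof (induction k)
    case (Suc k) then show ?case using inc[of k] by (simp add: algebra_simps)
  qed (simp add: \<rho>_def)
  then show ?thesis by (simp add: \<rho>_def H_def)
qed

section \<open>Multivariate polynomials\<close>

text \<open>Polymorphic so that the same notation serves for values of monomials and for monomials
  in the generators, \<open>mpow (simplex_gen n) a\<close>.\<close>

definition mpow :: "(nat \<Rightarrow> 'a::comm_monoid_mult) \<Rightarrow> (nat \<Rightarrow>\<^sub>0 nat) \<Rightarrow> 'a" where
  "mpow g a = (\<Prod>i\<in>keys a. g i ^ lookup a i)"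

lemma mpow_superset:
  "finite S \<Longrightarrow> keys a \<subseteq> S \<Longrightarrow> mpow g a = (\<Prod>i\<in>S. g i ^ lookup a i)"
  unfolding mpow_def by (intro prod.mono_neutral_left) (auto simp: in_keys_iff)

lemma mpow_cong: "(\<And>i. i \<in> keys a \<Longrightarrow> g i = h i) \<Longrightarrow> mpow g a = mpow h a"
  unfolding mpow_def by (intro prod.cong) auto

lemma mpow_0 [simp]: "mpow g 0 = 1"
  by (simp add: mpow_def)

lemma mpow_add: "mpow g (a + b) = mpow g a * mpow g b"
proof -
  let ?S = "keys a \<union> keys b"
  have "keys (a + b) \<subseteq> ?S" by (rule Poly_Mapping.keys_add)
  then show ?thesis
    by (simp add: mpow_superset[of ?S] lookup_add power_add prod.distrib)
qed

lemma mpow_single [simp]: "mpow g (single i k) = g i ^ k"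
  by (simp add: mpow_def)

lemma mpow_mult: "mpow (\<lambda>i. g i * h i) a = mpow g a * mpow h a"
  by (simp add: mpow_def power_mult_distrib prod.distrib)

lemma mpow_nonneg: "(\<And>i. i \<in> keys a \<Longrightarrow> 0 \<le> g i) \<Longrightarrow> 0 \<le> mpow g a" for g :: "nat \<Rightarrow> real"
  unfolding mpow_def by (intro prod_nonneg) auto

lemma eval_mpoly_mpow:
  "eval_mpoly p x = (\<Sum>m\<in>keys p. lookup p m * mpow x m)"
  by (simp add: eval_mpoly_def mpow_def)

lemma mpoly_sum_monomials: "(\<Sum>m\<in>keys p. single m (lookup p m)) = p"
proof (rule poly_mapping_eqI)
  fix k
  show "lookup (\<Sum>m\<in>keys p. single m (lookup p m)) k = lookup p k"
    by (simp add: lookup_sum lookup_single when_def sum.delta' in_keys_iff)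
qed

lemma mpoly_mult_monomials:
  "p * q = (\<Sum>a\<in>keys p. \<Sum>b\<in>keys q.
     single (a + b) (lookup p a * lookup q b))" for p q :: mpoly
proof -
  have "p * q = (\<Sum>m\<in>keys p. single m (lookup p m)) *
     (\<Sum>m\<in>keys q. single m (lookup q m))"
    by (simp add: mpoly_sum_monomials)
  then show ?thesis by (simp add: sum_product mult_single)
qed

lemma eval_0 [simp]: "eval_mpoly 0 x = 0"
  by (simp add: eval_mpoly_def)

lemma eval_add [simp]: "eval_mpoly (p + q) x = eval_mpoly p x + eval_mpoly q x"
  unfolding eval_mpoly_mpow
  by (rule setsum_keys_plus_distrib) (simp_all add: distrib_right)

lemma eval_single [simp]: "eval_mpoly (single m c) x = c * mpow x m"
  by (cases "c = 0") (simp_all add: eval_mpoly_mpow)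

lemma eval_sum [simp]: "eval_mpoly (sum f A) x = (\<Sum>i\<in>A. eval_mpoly (f i) x)"
  by (induction A rule: infinite_finite_induct) auto

lemma eval_mult [simp]: "eval_mpoly (p * q) x = eval_mpoly p x * eval_mpoly q x"
  unfolding mpoly_mult_monomials
  by (simp add: eval_mpoly_mpow[of p] eval_mpoly_mpow[of q] sum_product mpow_add mult_ac)

lemma const_mpoly_0 [simp]: "const_mpoly 0 = 0"
  and const_mpoly_1 [simp]: "const_mpoly 1 = 1"
  by (simp_all add: const_mpoly_def)

lemma const_mpoly_add: "const_mpoly (a + b) = const_mpoly a + const_mpoly b"
  by (simp add: const_mpoly_def single_add)

lemma const_mpoly_mult: "const_mpoly (a * b) = const_mpoly a * const_mpoly b"
  by (simp add: const_mpoly_def mult_single)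

lemma const_mpoly_minus: "const_mpoly (- a) = - const_mpoly a"
  by (simp add: const_mpoly_def single_uminus)

lemma const_mpoly_diff: "const_mpoly (a - b) = const_mpoly a - const_mpoly b"
  using const_mpoly_add[of a "- b"] by (simp add: const_mpoly_minus)

lemma const_mpoly_sum: "const_mpoly (sum f A) = (\<Sum>i\<in>A. const_mpoly (f i))"
  by (induction A rule: infinite_finite_induct) (auto simp: const_mpoly_add)

lemma eval_const [simp]: "eval_mpoly (const_mpoly c) x = c"
  by (simp add: const_mpoly_def)

lemma eval_1 [simp]: "eval_mpoly 1 x = 1"
  using eval_const[of 1 x] by simp

lemma eval_minus [simp]: "eval_mpoly (- p) x = - eval_mpoly p x"
proof -
  have "eval_mpoly (- p) x + eval_mpoly p x = eval_mpoly (- p + p) x" by (simp only: eval_add)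
  then show ?thesis by simp
qed

lemma eval_diff [simp]: "eval_mpoly (p - q) x = eval_mpoly p x - eval_mpoly q x"
  using eval_add[of p "- q" x] by simp

lemma eval_power [simp]: "eval_mpoly (p ^ k) x = eval_mpoly p x ^ k"
  by (induction k) auto

lemma eval_prod [simp]: "eval_mpoly (prod f A) x = (\<Prod>i\<in>A. eval_mpoly (f i) x)"
  by (induction A rule: infinite_finite_induct) auto

lemma eval_X [simp]: "eval_mpoly (X i) x = x i"
  by (simp add: X_def)

lemma eval_mpow [simp]: "eval_mpoly (mpow g a) x = mpow (\<lambda>i. eval_mpoly (g i) x) a"
  by (simp add: mpow_def)

lemma single_eq_mpow_X: "single m c = const_mpoly c * mpow X m"
proof -
  have X_pow: "X i ^ k = single (single i k) 1" for i k
    by (induction k) (simp_all add: X_def mult_single single_add[symmetric])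
  have *: "(\<Prod>i\<in>A. X i ^ lookup m i) =
      single (\<Sum>i\<in>A. single i (lookup m i)) 1" for A
    by (induction A rule: infinite_finite_induct) (simp_all add: X_pow mult_single)
  have "(\<Sum>i\<in>keys m. single i (lookup m i)) = m"
    by (rule poly_mapping_eqI) (simp add: lookup_sum lookup_single when_def sum.delta' in_keys_iff)
  then have "mpow X m = single m 1"
    unfolding mpow_def * by simp
  then show ?thesis by (simp add: const_mpoly_def mult_single)
qed

lemma mpoly_sum_mpow: "p = (\<Sum>m\<in>keys p. const_mpoly (lookup p m) * mpow X m)"
  by (simp add: single_eq_mpow_X[symmetric] mpoly_sum_monomials)

lemma mon_deg_superset:
  "finite S \<Longrightarrow> keys a \<subseteq> S \<Longrightarrow> mon_deg a = (\<Sum>i\<in>S. lookup a i)"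
  unfolding mon_deg_def by (intro sum.mono_neutral_left) (auto simp: in_keys_iff)

lemma mon_deg_0 [simp]: "mon_deg 0 = 0"
  by (simp add: mon_deg_def)

lemma mon_deg_single [simp]: "mon_deg (single i k) = k"
  by (simp add: mon_deg_def)

lemma mon_deg_add: "mon_deg (a + b) = mon_deg a + mon_deg b"
proof -
  let ?S = "keys a \<union> keys b"
  have "keys (a + b) \<subseteq> ?S" by (rule Poly_Mapping.keys_add)
  then show ?thesis
    by (simp add: mon_deg_superset[of ?S] lookup_add sum.distrib)
qed

lemma polys_upto_iff:
  "p \<in> polys_upto n k \<longleftrightarrow> (\<forall>m\<in>keys p. keys m \<subseteq> {1..n} \<and> mon_deg m \<le> k)"
  by (auto simp: polys_upto_def polys_def tot_deg_def)

lemma polys_upto_mono: "p \<in> polys_upto n k \<Longrightarrow> k \<le> l \<Longrightarrow> p \<in> polys_upto n l"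
  by (auto simp: polys_upto_def)

lemma polys_upto_polys: "p \<in> polys_upto n k \<Longrightarrow> p \<in> polys n"
  by (simp add: polys_upto_def)

lemma polys_upto_0 [simp]: "0 \<in> polys_upto n k"
  by (simp add: polys_upto_iff)

lemma polys_upto_const [simp]: "const_mpoly c \<in> polys_upto n k"
  by (simp add: polys_upto_iff const_mpoly_def)

lemma polys_upto_1 [simp]: "1 \<in> polys_upto n k"
  using polys_upto_const[of 1 n k] by simp

lemma polys_upto_add: "p \<in> polys_upto n k \<Longrightarrow> q \<in> polys_upto n k \<Longrightarrow> p + q \<in> polys_upto n k"
  unfolding polys_upto_iff using Poly_Mapping.keys_add[of p q] by blast

lemma polys_upto_mult: "p \<in> polys_upto n k \<Longrightarrow> q \<in> polys_upto n l \<Longrightarrow> p * q \<in> polys_upto n (k + l)"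
proof -
  assume p: "p \<in> polys_upto n k" and q: "q \<in> polys_upto n l"
  show ?thesis unfolding polys_upto_iff
  proof
    fix m assume "m \<in> keys (p * q)"
    then obtain a b where m: "m = a + b" "a \<in> keys p" "b \<in> keys q"
      using keys_mult[of p q] by blast
    have "keys m \<subseteq> keys a \<union> keys b"
      unfolding m by (rule Poly_Mapping.keys_add)
    then show "keys m \<subseteq> {1..n} \<and> mon_deg m \<le> k + l"
      using p q m(2,3) unfolding polys_upto_iff m(1) mon_deg_add by (meson add_mono le_sup_iff order_trans)
  qed
qed

lemma polys_upto_smult: "p \<in> polys_upto n k \<Longrightarrow> const_mpoly c * p \<in> polys_upto n k"
  using polys_upto_mult[OF polys_upto_const[of c n 0], of p k] by simp

lemma polys_upto_minus: "p \<in> polys_upto n k \<Longrightarrow> - p \<in> polys_upto n k"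
  using polys_upto_smult[of p n k "-1"] by (simp add: const_mpoly_minus)

lemma polys_upto_diff: "p \<in> polys_upto n k \<Longrightarrow> q \<in> polys_upto n k \<Longrightarrow> p - q \<in> polys_upto n k"
  using polys_upto_add[of p n k "- q"] polys_upto_minus[of q n k] by simp

lemma polys_upto_sum: "(\<And>i. i \<in> A \<Longrightarrow> f i \<in> polys_upto n k) \<Longrightarrow> sum f A \<in> polys_upto n k"
  by (induction A rule: infinite_finite_induct) (auto intro: polys_upto_add)

lemma polys_upto_prod: "(\<And>i. i \<in> A \<Longrightarrow> f i \<in> polys_upto n (k i)) \<Longrightarrow> prod f A \<in> polys_upto n (sum k A)"
  by (induction A rule: infinite_finite_induct) (auto intro: polys_upto_mult)

lemma polys_upto_power: "p \<in> polys_upto n k \<Longrightarrow> p ^ l \<in> polys_upto n (k * l)"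
proof (induction l)
  case (Suc l)
  then have "p * p ^ l \<in> polys_upto n (k + k * l)" by (intro polys_upto_mult) auto
  then show ?case by simp
qed simp

lemma polys_upto_X: "i \<in> {1..n} \<Longrightarrow> X i \<in> polys_upto n 1"
  by (simp add: X_def polys_upto_iff)

lemma polys_upto_simplex_gen: "i \<in> {1..n+1} \<Longrightarrow> simplex_gen n i \<in> polys_upto n 1"
  using polys_upto_X[of _ n] by (auto simp: simplex_gen_def intro!: polys_upto_diff polys_upto_sum)

lemma polys_upto_mpow:
  assumes "keys a \<subseteq> {1..n+1}"
  shows "mpow (simplex_gen n) a \<in> polys_upto n (mon_deg a)"
  unfolding mpow_def mon_deg_def
proof (rule polys_upto_prod)
  fix i assume "i \<in> keys a"
  with assms have "simplex_gen n i \<in> polys_upto n 1" by (intro polys_upto_simplex_gen) auto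
  from polys_upto_power[OF this]
  show "simplex_gen n i ^ lookup a i \<in> polys_upto n (lookup a i)" by simp
qed

text \<open>The first \<open>n\<close> generators are the variables themselves. Working with
  monomials in all \<open>n + 1\<close> generators, redundant as they are, keeps the formulas
  symmetric in the coordinates of the sphere.\<close>

lemma polys_upto_sum_mpow:
  assumes "p \<in> polys_upto n k"
  shows "p = (\<Sum>m\<in>keys p. const_mpoly (lookup p m) * mpow (simplex_gen n) m)"
proof -
  have "mpow X m = mpow (simplex_gen n) m" if "m \<in> keys p" for m
    using that assms by (intro mpow_cong) (fastforce simp: polys_upto_iff simplex_gen_def)
  then show ?thesis by (subst mpoly_sum_mpow[of p]) (intro sum.cong, auto)
qed

lemma eval_simplex_gen:
  "eval_mpoly (simplex_gen n i) x = (if i = n + 1 then 1 - (\<Sum>j=1..n. x j) else x i)"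
  by (simp add: simplex_gen_def)

lemma eval_simplex_gen_nonneg: "x \<in> std_simplex n \<Longrightarrow> i \<in> {1..n+1} \<Longrightarrow> eval_mpoly (simplex_gen n i) x \<ge> 0"
  by (auto simp: eval_simplex_gen std_simplex_def)

lemma sum_simplex_gen: "(\<Sum>i=1..n+1. simplex_gen n i) = 1"
proof -
  have "(\<Sum>i=1..n. simplex_gen n i) = (\<Sum>i=1..n. X i)"
    by (intro sum.cong) (auto simp: simplex_gen_def)
  then show ?thesis by (simp add: simplex_gen_def)
qed

lemma std_simplex_le_1: "x \<in> std_simplex n \<Longrightarrow> i \<in> {1..n} \<Longrightarrow> x i \<le> 1"
  using member_le_sum[of i "{1..n}" x] by (auto simp: std_simplex_def)

section \<open>Integration against the Dirichlet measure\<close>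

definition dirichlet_const :: "nat \<Rightarrow> real" where
  "dirichlet_const n = Gamma (1/2) ^ (n + 1) / Gamma ((real n + 1) / 2)"

lemma dirichlet_const_pos: "dirichlet_const n > 0"
  unfolding dirichlet_const_def by (intro divide_pos_pos zero_less_power Gamma_real_pos) auto

lemma simplex_weight_nonneg: "simplex_weight n x \<ge> 0"
  by (auto simp: simplex_weight_def intro!: mult_nonneg_nonneg prod_nonneg)

lemma simplex_weight_measurable [measurable]: "simplex_weight n \<in> borel_measurable (Pi\<^sub>M {1..n} (\<lambda>_. lborel))"
proof -
  note [measurable] = std_simplex_measurable[of n]
  show ?thesis unfolding simplex_weight_def[abs_def] by measurable
qed

lemma simplex_density_measurable:
  "(\<lambda>x. ennreal (simplex_norm_const n * simplex_weight n x)) \<in> borel_measurable (Pi\<^sub>M {1..n} (\<lambda>_. lborel))"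
  by measurable

lemma Gamma_add_pochhammer: "z > 0 \<Longrightarrow> Gamma (z + real m) = Gamma z * pochhammer z m" for z :: real
proof -
  assume z: "z > 0"
  then have "z \<notin> \<int>\<^sub>\<le>\<^sub>0" by (auto elim!: nonpos_Ints_cases)
  from pochhammer_Gamma[OF this, of m] Gamma_real_pos[OF z] show ?thesis by simp
qed

text \<open>On the simplex a monomial in the generators only shifts the exponents of the weight,
  which leaves a Dirichlet integral with parameters \<open>lookup a i + 1/2\<close>.\<close>

lemma weight_moment_nn:
  assumes a: "keys a \<subseteq> {1..n+1}"
  shows "(\<integral>\<^sup>+x. ennreal (simplex_weight n x * mpow (\<lambda>i. eval_mpoly (simplex_gen n i) x) a) \<partial>Pi\<^sub>M {1..n} (\<lambda>_. lborel))
     = ennreal (dirichlet_const n * ((\<Prod>i=1..n+1. pochhammer (1/2) (lookup a i)) / pochhammer ((real n + 1) / 2) (mon_deg a)))"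
proof -
  let ?\<alpha> = "\<lambda>i. real (lookup a i) + 1/2"
  \<comment> \<open>At \<open>t = 0\<close> both sides are zero, also for \<open>k = 0\<close>,
    because \<open>0 powr x = 0\<close>.\<close>
  have pw: "t powr (-1/2) * t ^ k = t powr (real k + 1/2 - 1)" if "t \<ge> 0" for t :: real and k :: nat
  proof (cases "t = 0")
    case False
    with that have "t > 0" by simp
    then show ?thesis by (simp add: powr_realpow[symmetric] powr_add[symmetric] add_ac)
  qed simp
  have "simplex_weight n x * mpow (\<lambda>i. eval_mpoly (simplex_gen n i) x) a =
     indicator (std_simplex n) x * ((\<Prod>i=1..n. x i powr (?\<alpha> i - 1)) * (1 - (\<Sum>i=1..n. x i)) powr (?\<alpha> (n + 1) - 1))"
    for x :: "nat \<Rightarrow> real"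
  proof (cases "x \<in> std_simplex n")
    case True
    then have nn: "1 - (\<Sum>i=1..n. x i) \<ge> 0" "\<And>i. i \<in> {1..n} \<Longrightarrow> x i \<ge> 0" by (auto simp: std_simplex_def)
    have "mpow (\<lambda>i. eval_mpoly (simplex_gen n i) x) a = (\<Prod>i=1..n+1. eval_mpoly (simplex_gen n i) x ^ lookup a i)"
      using a by (intro mpow_superset) auto
    also have "\<dots> = (\<Prod>i=1..n. x i ^ lookup a i) * (1 - (\<Sum>i=1..n. x i)) ^ lookup a (n + 1)"
      by (simp add: eval_simplex_gen)
    finally have "simplex_weight n x * mpow (\<lambda>i. eval_mpoly (simplex_gen n i) x) a =
      (\<Prod>i=1..n. x i powr (- 1/2) * x i ^ lookup a i) *
      ((1 - (\<Sum>i=1..n. x i)) powr (- 1/2) * (1 - (\<Sum>i=1..n. x i)) ^ lookup a (n + 1))"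
      using True by (simp add: simplex_weight_def prod.distrib)
    also have "(\<Prod>i=1..n. x i powr (- 1/2) * x i ^ lookup a i) = (\<Prod>i=1..n. x i powr (?\<alpha> i - 1))"
      using nn by (intro prod.cong refl pw) auto
    finally show ?thesis using True pw[OF nn(1)] by simp
  qed (simp add: simplex_weight_def)
  then have "(\<integral>\<^sup>+x. ennreal (simplex_weight n x * mpow (\<lambda>i. eval_mpoly (simplex_gen n i) x) a) \<partial>Pi\<^sub>M {1..n} (\<lambda>_. lborel))
    = ennreal ((\<Prod>i=1..n. Gamma (?\<alpha> i)) * Gamma (?\<alpha> (n + 1)) / Gamma ((\<Sum>i=1..n. ?\<alpha> i) + ?\<alpha> (n + 1)))"
    by (simp only:) (rule Dirichlet_nn_integral, auto)
  also have "(\<Prod>i=1..n. Gamma (?\<alpha> i)) * Gamma (?\<alpha> (n + 1)) = (\<Prod>i=1..n+1. Gamma (?\<alpha> i))"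
    by simp
  also have "\<dots> = Gamma (1/2) ^ (n + 1) * (\<Prod>i=1..n+1. pochhammer (1/2) (lookup a i))"
  proof -
    have "Gamma (?\<alpha> i) = Gamma (1/2) * pochhammer (1/2) (lookup a i)" for i
      using Gamma_add_pochhammer[of "1/2" "lookup a i"] by (simp add: add_ac)
    then have "(\<Prod>i=1..n+1. Gamma (?\<alpha> i)) = (\<Prod>i=1..n+1. Gamma (1/2) * pochhammer (1/2) (lookup a i))"
      by (simp only:)
    then show ?thesis by (simp only: prod.distrib prod_constant) simp
  qed
  also have "(\<Sum>i=1..n. ?\<alpha> i) + ?\<alpha> (n + 1) = (real n + 1) / 2 + real (mon_deg a)"
  proof -
    have "mon_deg a = (\<Sum>i=1..n+1. lookup a i)"
      using a by (intro mon_deg_superset) auto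
    then show ?thesis by (simp add: sum.distrib add_divide_distrib)
  qed
  also have "Gamma ((real n + 1) / 2 + real (mon_deg a)) = Gamma ((real n + 1) / 2) * pochhammer ((real n + 1) / 2) (mon_deg a)"
    by (rule Gamma_add_pochhammer) simp
  finally show ?thesis by (simp add: dirichlet_const_def)
qed

lemma simplex_norm_const_eq: "simplex_norm_const n = 1 / dirichlet_const n"
proof -
  have "(LINT x|Pi\<^sub>M {1..n} (\<lambda>_. lborel). simplex_weight n x) = dirichlet_const n"
    using weight_moment_nn[of 0 n] dirichlet_const_pos[of n] simplex_weight_nonneg
    by (subst integral_eq_nn_integral[OF simplex_weight_measurable]) auto
  then show ?thesis by (simp add: simplex_norm_const_def)
qed

lemma space_simplex_measure: "space (simplex_measure n) = {1..n} \<rightarrow>\<^sub>E UNIV"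
  by (simp add: simplex_measure_def space_PiM)

lemma sets_simplex_measure [simp, measurable_cong]:
  "sets (simplex_measure n) = sets (Pi\<^sub>M {1..n} (\<lambda>_. lborel))"
  by (simp add: simplex_measure_def)

lemma emeasure_simplex_space: "emeasure (simplex_measure n) (space (simplex_measure n)) = 1"
proof -
  have "emeasure (simplex_measure n) (space (simplex_measure n)) =
     (\<integral>\<^sup>+x. ennreal (simplex_norm_const n * simplex_weight n x) \<partial>Pi\<^sub>M {1..n} (\<lambda>_. lborel))"
    unfolding simplex_measure_def space_density
    by (subst emeasure_density[OF simplex_density_measurable]) (auto intro!: nn_integral_cong)
  also have "\<dots> = ennreal (1 / dirichlet_const n) * (\<integral>\<^sup>+x. ennreal (simplex_weight n x) \<partial>Pi\<^sub>M {1..n} (\<lambda>_. lborel))"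
  proof -
    have "(\<lambda>x. ennreal (simplex_norm_const n * simplex_weight n x)) = (\<lambda>x. ennreal (1 / dirichlet_const n) * ennreal (simplex_weight n x))"
      using dirichlet_const_pos[of n] simplex_weight_nonneg[of n]
      by (simp only: simplex_norm_const_eq ennreal_mult[symmetric] zero_le_divide_1_iff less_imp_le)
    moreover have "(\<lambda>x. ennreal (simplex_weight n x)) \<in> borel_measurable (Pi\<^sub>M {1..n} (\<lambda>_. lborel))"
      by measurable
    ultimately show ?thesis by (simp only: nn_integral_cmult)
  qed
  also have "\<dots> = 1"
    using weight_moment_nn[of 0 n] dirichlet_const_pos[of n] by (simp add: ennreal_mult'[symmetric])
  finally show ?thesis .
qed

lemma finite_measure_simplex: "finite_measure (simplex_measure n)"
  by (rule finite_measureI) (simp add: emeasure_simplex_space)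

lemma AE_simplex: "AE x in simplex_measure n. x \<in> std_simplex n"
  unfolding simplex_measure_def
  by (subst AE_density[OF simplex_density_measurable]) (auto simp: simplex_weight_def indicator_def)

lemma measurable_coord [measurable]: "(\<lambda>x. x i) \<in> borel_measurable (simplex_measure n)"
proof (cases "i \<in> {1..n}")
  case True
  then have "(\<lambda>x. x i) \<in> measurable (Pi\<^sub>M {1..n} (\<lambda>_. lborel)) lborel" by (rule measurable_component_singleton)
  then show ?thesis by (simp add: measurable_lborel2 cong: measurable_cong_sets)
next
  case False
  have "(\<lambda>x. undefined :: real) \<in> borel_measurable (simplex_measure n)" by simp
  also have "?this \<longleftrightarrow> ?thesis"
    using False by (intro measurable_cong) (auto simp: space_simplex_measure PiE_def extensional_def)
  finally show ?thesis .
qed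

lemma integrable_eval: "integrable (simplex_measure n) (eval_mpoly p)"
proof -
  interpret finite_measure "simplex_measure n" by (rule finite_measure_simplex)
  \<comment> \<open>A general \<open>p\<close> may contain variables outside \<open>{1..n}\<close>,
    which take the value \<open>undefined\<close> on the simplex. Covering them makes
    \<open>simplex_L\<close> linear on all polynomials without side conditions.\<close>
  define B where "B = max 1 \<bar>undefined :: real\<bar>"
  have "integrable (simplex_measure n) (\<lambda>x. mpow x m)" for m
  proof (rule integrable_const_bound)
    show "(\<lambda>x. mpow x m) \<in> borel_measurable (simplex_measure n)"
      unfolding mpow_def by measurable
    show "AE x in simplex_measure n. norm (mpow x m) \<le> B ^ mon_deg m"
      using AE_simplex[of n]
    proof eventually_elim
      fix x assume x: "x \<in> std_simplex n"
      have B: "\<bar>x i\<bar> \<le> B" for i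
      proof (cases "i \<in> {1..n}")
        case True
        then have "0 \<le> x i" "x i \<le> 1" using x std_simplex_le_1[OF x] by (auto simp: std_simplex_def)
        then show ?thesis by (simp add: B_def)
      next
        case False
        then have "x i = undefined" using x by (auto simp: std_simplex_def PiE_def extensional_def)
        then show ?thesis by (simp add: B_def)
      qed
      have "norm (mpow x m) = (\<Prod>i\<in>keys m. \<bar>x i\<bar> ^ lookup m i)"
        by (simp add: mpow_def abs_prod power_abs)
      also have "\<dots> \<le> (\<Prod>i\<in>keys m. B ^ lookup m i)"
        using B by (intro prod_mono) (auto intro: power_mono)
      also have "\<dots> = B ^ mon_deg m" by (simp add: mon_deg_def power_sum)
      finally show "norm (mpow x m) \<le> B ^ mon_deg m" .
    qed
  qed
  then show ?thesis
    unfolding eval_mpoly_mpow[abs_def] by (intro Bochner_Integration.integrable_sum integrable_mult_right)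
qed

lemma L_add [simp]: "simplex_L n (p + q) = simplex_L n p + simplex_L n q"
  unfolding simplex_L_def eval_add by (intro Bochner_Integration.integral_add integrable_eval)

lemma L_0 [simp]: "simplex_L n 0 = 0"
  by (simp add: simplex_L_def)

lemma L_const_mult [simp]: "simplex_L n (const_mpoly c * p) = c * simplex_L n p"
  by (simp add: simplex_L_def)

lemma L_minus [simp]: "simplex_L n (- p) = - simplex_L n p"
  by (simp add: simplex_L_def)

lemma L_diff [simp]: "simplex_L n (p - q) = simplex_L n p - simplex_L n q"
  using L_add[of n p "- q"] by (simp del: L_add)

lemma L_sum [simp]: "simplex_L n (sum f A) = (\<Sum>i\<in>A. simplex_L n (f i))"
  by (induction A rule: infinite_finite_induct) auto

lemma L_1 [simp]: "simplex_L n 1 = 1"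
  by (simp add: simplex_L_def measure_def emeasure_simplex_space)

lemma L_const [simp]: "simplex_L n (const_mpoly c) = c"
  using L_const_mult[of n c 1] by simp

lemma L_nonneg: "(\<And>x. x \<in> std_simplex n \<Longrightarrow> eval_mpoly p x \<ge> 0) \<Longrightarrow> simplex_L n p \<ge> 0"
  unfolding simplex_L_def using AE_simplex[of n] by (intro integral_nonneg_AE) auto

lemma L_mono: "(\<And>x. x \<in> std_simplex n \<Longrightarrow> eval_mpoly p x \<le> eval_mpoly q x) \<Longrightarrow> simplex_L n p \<le> simplex_L n q"
  using L_nonneg[of n "q - p"] by simp

lemma simplex_inner_eq: "simplex_inner n p q = simplex_L n (p * q)"
  by (simp add: simplex_inner_def simplex_L_def)

text \<open>From here on the measure enters only through these moments, linearity and
  positivity.\<close>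

lemma L_moment:
  assumes a: "keys a \<subseteq> {1..n+1}"
  shows "simplex_L n (mpow (simplex_gen n) a) =
     (\<Prod>i=1..n+1. pochhammer (1/2) (lookup a i)) / pochhammer ((real n + 1) / 2) (mon_deg a)" (is "_ = ?R")
proof -
  let ?g = "\<lambda>x. mpow (\<lambda>i. eval_mpoly (simplex_gen n i) x) a"
  have gm: "?g \<in> borel_measurable (Pi\<^sub>M {1..n} (\<lambda>_. lborel))"
    using borel_measurable_integrable[OF integrable_eval[of n "mpow (simplex_gen n) a"]]
    by (simp add: eval_mpow[abs_def] cong: measurable_cong_sets)
  have R: "?R \<ge> 0" by (intro divide_nonneg_nonneg prod_nonneg pochhammer_nonneg) auto
  have "simplex_L n (mpow (simplex_gen n) a) = (LINT x|Pi\<^sub>M {1..n} (\<lambda>_. lborel). (simplex_norm_const n * simplex_weight n x) *\<^sub>R ?g x)"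
    unfolding simplex_L_def simplex_measure_def eval_mpow
  proof (rule integral_density[OF gm])
    show "(\<lambda>x. simplex_norm_const n * simplex_weight n x) \<in> borel_measurable (Pi\<^sub>M {1..n} (\<lambda>_. lborel))"
      by measurable
    show "AE x in Pi\<^sub>M {1..n} (\<lambda>_. lborel). 0 \<le> simplex_norm_const n * simplex_weight n x"
      using dirichlet_const_pos[of n] simplex_weight_nonneg[of n] by (simp add: simplex_norm_const_eq)
  qed
  also have "\<dots> = 1 / dirichlet_const n * (LINT x|Pi\<^sub>M {1..n} (\<lambda>_. lborel). simplex_weight n x * ?g x)"
    by (simp add: simplex_norm_const_eq mult.assoc)
  also have "(LINT x|Pi\<^sub>M {1..n} (\<lambda>_. lborel). simplex_weight n x * ?g x) = dirichlet_const n * ?R"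
  proof (subst integral_eq_nn_integral)
    show "(\<lambda>x. simplex_weight n x * ?g x) \<in> borel_measurable (Pi\<^sub>M {1..n} (\<lambda>_. lborel))"
      using gm by measurable
    show "AE x in Pi\<^sub>M {1..n} (\<lambda>_. lborel). 0 \<le> simplex_weight n x * ?g x"
    proof (rule AE_I2)
      fix x
      show "0 \<le> simplex_weight n x * ?g x"
      proof (cases "x \<in> std_simplex n")
        case True
        then have "?g x \<ge> 0" using a by (intro mpow_nonneg eval_simplex_gen_nonneg) auto
        then show ?thesis using simplex_weight_nonneg by simp
      qed (simp add: simplex_weight_def)
    qed
    show "enn2real (\<integral>\<^sup>+x. ennreal (simplex_weight n x * ?g x) \<partial>Pi\<^sub>M {1..n} (\<lambda>_. lborel)) = dirichlet_const n * ?R"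
      unfolding weight_moment_nn[OF a] by (rule enn2real_ennreal[OF mult_nonneg_nonneg[OF less_imp_le[OF dirichlet_const_pos] R]])
  qed
  finally show ?thesis using dirichlet_const_pos[of n] by simp
qed

section \<open>The multinomial operators\<close>

definition exponents :: "nat \<Rightarrow> nat \<Rightarrow> (nat \<Rightarrow>\<^sub>0 nat) set" where
  "exponents n N = {a. keys a \<subseteq> {1..n+1} \<and> mon_deg a = N}"

definition multi_fact :: "(nat \<Rightarrow>\<^sub>0 nat) \<Rightarrow> real" where
  "multi_fact a = (\<Prod>i\<in>keys a. fact (lookup a i))"

lemma multi_fact_superset:
  "finite S \<Longrightarrow> keys a \<subseteq> S \<Longrightarrow> multi_fact a = (\<Prod>i\<in>S. fact (lookup a i))"
  unfolding multi_fact_def by (intro prod.mono_neutral_left) (auto simp: in_keys_iff)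

lemma multi_fact_pos: "multi_fact a > 0"
  unfolding multi_fact_def by (intro prod_pos) auto

lemma lookup_le_mon_deg: "lookup a i \<le> mon_deg a"
  by (cases "i \<in> keys a")
     (auto simp: mon_deg_def in_keys_iff intro!: member_le_sum)

lemma finite_exponents [simp]: "finite (exponents n N)"
proof -
  have "finite {f. \<forall>i. (i \<in> {1..n+1} \<longrightarrow> f i \<in> {..N}) \<and> (i \<notin> {1..n+1} \<longrightarrow> f i = 0)}"
    by (intro finite_set_of_finite_funs) auto
  moreover have "lookup ` exponents n N \<subseteq> {f. \<forall>i. (i \<in> {1..n+1} \<longrightarrow> f i \<in> {..N}) \<and> (i \<notin> {1..n+1} \<longrightarrow> f i = 0)}"
    using lookup_le_mon_deg by (auto simp: exponents_def in_keys_iff)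
  ultimately have "finite (lookup ` exponents n N)" by (rule finite_subset[rotated])
  moreover have "inj_on lookup (exponents n N)"
    by (intro inj_onI poly_mapping_eqI) auto
  ultimately show ?thesis by (rule finite_imageD)
qed

lemma keys_add_nat: "keys (a + b) = keys a \<union> keys b"
  for a b :: "nat \<Rightarrow>\<^sub>0 nat"
  by (auto simp: in_keys_iff lookup_add)

lemma exponents_add: "a \<in> exponents n N \<Longrightarrow> b \<in> exponents n M \<Longrightarrow> a + b \<in> exponents n (N + M)"
  by (auto simp: exponents_def keys_add_nat mon_deg_add)

lemma sum_exponents_shift:
  assumes c: "c \<in> exponents n k" and F: "\<And>b. b \<in> exponents n (M + k) \<Longrightarrow> (\<And>a. b \<noteq> a + c) \<Longrightarrow> F b = 0"
  shows "(\<Sum>b\<in>exponents n (M + k). F b) = (\<Sum>a\<in>exponents n M. F (a + c))"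
proof -
  have "(\<Sum>a\<in>exponents n M. F (a + c)) = (\<Sum>b\<in>(\<lambda>a. a + c) ` exponents n M. F b)"
    by (subst sum.reindex) (auto simp: inj_on_def)
  also have "\<dots> = (\<Sum>b\<in>exponents n (M + k). F b)"
  proof (rule sum.mono_neutral_left)
    show "(\<lambda>a. a + c) ` exponents n M \<subseteq> exponents n (M + k)" using c by (auto intro: exponents_add)
    show "\<forall>b\<in>exponents n (M + k) - (\<lambda>a. a + c) ` exponents n M. F b = 0"
    proof
      fix b assume b: "b \<in> exponents n (M + k) - (\<lambda>a. a + c) ` exponents n M"
      show "F b = 0"
      proof (rule F)
        fix a show "b \<noteq> a + c"
        proof
          assume e: "b = a + c"
          then have "a \<in> exponents n M" using b c by (auto simp: exponents_def keys_add_nat mon_deg_add)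
          with b e show False by auto
        qed
      qed (use b in auto)
    qed
  qed simp
  finally show ?thesis by simp
qed

lemma single_exponents: "i \<in> {1..n+1} \<Longrightarrow> single i 1 \<in> exponents n 1"
  by (simp add: exponents_def)

lemma not_add_lookup: "(\<And>a. b \<noteq> a + c) \<Longrightarrow> \<exists>i. lookup b i < lookup c i"
  for b c :: "nat \<Rightarrow>\<^sub>0 nat"
proof (rule ccontr)
  assume *: "\<And>a. b \<noteq> a + c" and "\<not> ?thesis"
  then have "b = (b - c) + c"
    by (intro poly_mapping_eqI) (auto simp: lookup_add lookup_minus not_less)
  with * show False by blast
qed

lemma multi_fact_add_single: "multi_fact (a + single i 1) = (real (lookup a i) + 1) * multi_fact a"
proof -
  let ?S = "insert i (keys a)"
  have S: "finite ?S" "keys (a + single i 1) \<subseteq> ?S" "keys a \<subseteq> ?S"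
    by (auto simp: keys_add_nat)
  have "multi_fact (a + single i 1) = (\<Prod>j\<in>?S. fact (lookup (a + single i 1) j))"
    by (rule multi_fact_superset[OF S(1,2)])
  also have "\<dots> = (\<Prod>j\<in>?S. (if j = i then real (lookup a i) + 1 else 1) * fact (lookup a j))"
    by (intro prod.cong) (auto simp: lookup_add lookup_single when_def add_ac)
  also have "\<dots> = (real (lookup a i) + 1) * multi_fact a"
    by (simp only: prod.distrib prod.delta[OF S(1)] multi_fact_superset[OF S(1,3)]) simp
  finally show ?thesis .
qed

lemma multinomial:
  fixes g :: "nat \<Rightarrow> mpoly"
  shows "(\<Sum>i=1..n+1. g i) ^ N = (\<Sum>a\<in>exponents n N. const_mpoly (fact N / multi_fact a) * mpow g a)"
proof (induction N)
  case 0
  have "mon_deg a = 0 \<Longrightarrow> a = 0" for a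
    by (intro poly_mapping_eqI) (metis lookup_le_mon_deg le_zero_eq lookup_zero)
  then have "exponents n 0 = {0}" by (auto simp: exponents_def)
  then show ?case by (simp add: multi_fact_def)
next
  case (Suc N)
  let ?e = "\<lambda>i. single i (1::nat)"
  \<comment> \<open>The factor \<open>Suc N\<close> of the factorial is distributed as the sum of
    the entries of \<open>b\<close>; the share of \<open>i\<close> then belongs to \<open>b\<close>
    with one unit removed at \<open>i\<close>.\<close>
  have "(\<Sum>b\<in>exponents n (Suc N). const_mpoly (fact (Suc N) / multi_fact b) * mpow g b) =
    (\<Sum>b\<in>exponents n (Suc N). \<Sum>i=1..n+1. const_mpoly (real (lookup b i) * fact N / multi_fact b) * mpow g b)"
  proof (intro sum.cong refl)
    fix b assume "b \<in> exponents n (Suc N)"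
    then have "(\<Sum>i=1..n+1. lookup b i) = Suc N"
      using mon_deg_superset[of "{1..n+1}" b] by (auto simp: exponents_def)
    then have "(\<Sum>i=1..n+1. real (lookup b i)) = real (Suc N)"
      by (simp only: of_nat_sum[symmetric])
    then have "fact (Suc N) / multi_fact b = (\<Sum>i=1..n+1. real (lookup b i) * fact N / multi_fact b)"
      by (simp only: sum_divide_distrib[symmetric] sum_distrib_right[symmetric] fact_Suc)
    then show "const_mpoly (fact (Suc N) / multi_fact b) * mpow g b =
        (\<Sum>i=1..n+1. const_mpoly (real (lookup b i) * fact N / multi_fact b) * mpow g b)"
      by (simp only: const_mpoly_sum sum_distrib_right)
  qed
  also have "\<dots> = (\<Sum>i=1..n+1. \<Sum>b\<in>exponents n (N + 1). const_mpoly (real (lookup b i) * fact N / multi_fact b) * mpow g b)"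
    by (subst sum.swap) simp
  also have "\<dots> = (\<Sum>i=1..n+1. \<Sum>a\<in>exponents n N. const_mpoly (fact N / multi_fact a) * mpow g a * g i)"
  proof (rule sum.cong[OF refl])
    fix i assume i: "i \<in> {1..n+1}"
    have "(\<Sum>b\<in>exponents n (N + 1). const_mpoly (real (lookup b i) * fact N / multi_fact b) * mpow g b) =
      (\<Sum>a\<in>exponents n N. const_mpoly (real (lookup (a + ?e i) i) * fact N / multi_fact (a + ?e i)) * mpow g (a + ?e i))"
    proof (rule sum_exponents_shift[OF single_exponents[OF i]])
      fix b assume "\<And>a. b \<noteq> a + ?e i"
      from not_add_lookup[OF this] have "lookup b i = 0"
        by (auto simp: lookup_single when_def split: if_splits)
      then show "const_mpoly (real (lookup b i) * fact N / multi_fact b) * mpow g b = 0" by simp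
    qed
    also have "\<dots> = (\<Sum>a\<in>exponents n N. const_mpoly (fact N / multi_fact a) * mpow g a * g i)"
    proof (intro sum.cong refl)
      fix a
      have "real (lookup (a + ?e i) i) = real (lookup a i) + 1"
        by (simp add: lookup_add)
      moreover have "real (lookup a i) + 1 > 0" by simp
      ultimately have "real (lookup (a + ?e i) i) * fact N / multi_fact (a + ?e i) = fact N / multi_fact a"
        by (simp only: multi_fact_add_single) simp
      then show "const_mpoly (real (lookup (a + ?e i) i) * fact N / multi_fact (a + ?e i)) * mpow g (a + ?e i) =
          const_mpoly (fact N / multi_fact a) * mpow g a * g i"
        by (simp only: mpow_add mpow_single power_one_right mult.assoc)
    qed
    finally show "(\<Sum>b\<in>exponents n (N + 1). const_mpoly (real (lookup b i) * fact N / multi_fact b) * mpow g b) =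
      (\<Sum>a\<in>exponents n N. const_mpoly (fact N / multi_fact a) * mpow g a * g i)" .
  qed
  also have "\<dots> = (\<Sum>i=1..n+1. g i) ^ Suc N"
    unfolding power_Suc Suc.IH sum_product by (intro sum.cong refl) (simp only: mult_ac)
  finally show ?case ..
qed

section \<open>Bernstein sums of falling and rising products\<close>

definition falling_prod :: "nat \<Rightarrow> (nat \<Rightarrow>\<^sub>0 nat) \<Rightarrow> (nat \<Rightarrow>\<^sub>0 nat) \<Rightarrow> real" where
  "falling_prod n c a = (\<Prod>i=1..n+1. \<Prod>j<lookup c i. real (lookup a i) - real j)"

text \<open>The Bernstein polynomial of degree \<open>N\<close> of a function sampled on the
  exponent vectors.\<close>

definition multinomial_sum :: "nat \<Rightarrow> nat \<Rightarrow> ((nat \<Rightarrow>\<^sub>0 nat) \<Rightarrow> real) \<Rightarrow> mpoly" where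
  "multinomial_sum n N g = (\<Sum>a\<in>exponents n N. const_mpoly (fact N / multi_fact a * g a) * mpow (simplex_gen n) a)"

lemma multinomial_sum_add: "multinomial_sum n N (\<lambda>a. f a + g a) = multinomial_sum n N f + multinomial_sum n N g"
  by (simp add: multinomial_sum_def distrib_left const_mpoly_add distrib_right sum.distrib)

lemma multinomial_sum_scale: "multinomial_sum n N (\<lambda>a. r * f a) = const_mpoly r * multinomial_sum n N f"
  unfolding multinomial_sum_def sum_distrib_left by (intro sum.cong refl) (simp only: const_mpoly_mult mult_ac)

lemma falling_fact: "(\<Prod>j<k. real (m + k) - real j) * fact m = fact (m + k)"
proof (induction k arbitrary: m)
  case (Suc k)
  have "(\<Prod>j<Suc k. real (m + Suc k) - real j) * fact m = (\<Prod>j<k. real (Suc m + k) - real j) * (real (Suc m) * fact m)"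
    by simp
  also have "real (Suc m) * fact m = fact (Suc m)" by simp
  also have "(\<Prod>j<k. real (Suc m + k) - real j) * fact (Suc m) = fact (Suc m + k)" by (rule Suc.IH)
  finally show ?case by simp
qed simp

text \<open>These are the factorial moments of the multinomial distribution:
  \<open>falling_prod n c (a + c)\<close> is the quotient of \<open>multi_fact (a + c)\<close> by
  \<open>multi_fact a\<close>, and what remains after extracting the monomial \<open>c\<close> is a
  power of the sum of the generators, which is 1.\<close>

lemma multinomial_sum_falling_prod:
  assumes c: "c \<in> exponents n k"
  shows "multinomial_sum n N (falling_prod n c) = const_mpoly (\<Prod>j<k. real N - real j) * mpow (simplex_gen n) c"
proof -
  let ?F = "\<lambda>a. const_mpoly (fact N / multi_fact a * falling_prod n c a) * mpow (simplex_gen n) a"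
  have zero: "falling_prod n c b = 0" if b: "\<And>a. b \<noteq> a + c" for b
  proof -
    from not_add_lookup[OF b] obtain i where i: "lookup b i < lookup c i" by blast
    then have "i \<in> {1..n+1}" using c by (auto simp: exponents_def in_keys_iff subset_iff)
    moreover have "(\<Prod>j<lookup c i. real (lookup b i) - real j) = 0"
      using i by (intro prod_zero) auto
    ultimately show ?thesis unfolding falling_prod_def by (intro prod_zero) auto
  qed
  show ?thesis
  proof (cases "k \<le> N")
    case False
    have "falling_prod n c b = 0" if "b \<in> exponents n N" for b
    proof (rule zero)
      fix a show "b \<noteq> a + c" using that c False by (auto simp: exponents_def mon_deg_add)
    qed
    then have "multinomial_sum n N (falling_prod n c) = 0" by (simp add: multinomial_sum_def)
    moreover have "(\<Prod>j<k. real N - real j) = 0" using False by (intro prod_zero) auto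
    ultimately show ?thesis by (simp only: const_mpoly_0 mult_zero_left)
  next
    case True
    then obtain M where N: "N = M + k" by (metis le_add_diff_inverse2)
    have "multinomial_sum n N (falling_prod n c) = (\<Sum>a\<in>exponents n M. ?F (a + c))"
      unfolding multinomial_sum_def N
    proof (rule sum_exponents_shift[OF c])
      fix b assume "\<And>a. b \<noteq> a + c"
      then show "const_mpoly (fact (M + k) / multi_fact b * falling_prod n c b) * mpow (simplex_gen n) b = 0" using zero[of b] by simp
    qed
    also have "\<dots> = (\<Sum>a\<in>exponents n M. const_mpoly (fact N / fact M) * mpow (simplex_gen n) c * (const_mpoly (fact M / multi_fact a) * mpow (simplex_gen n) a))"
    proof (intro sum.cong refl)
      fix a assume a: "a \<in> exponents n M"
      have "falling_prod n c (a + c) * multi_fact a = multi_fact (a + c)"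
      proof -
        have "multi_fact a = (\<Prod>i=1..n+1. fact (lookup a i))"
          using a by (intro multi_fact_superset) (auto simp: exponents_def)
        moreover have "multi_fact (a + c) = (\<Prod>i=1..n+1. fact (lookup (a + c) i))"
          using a c by (intro multi_fact_superset) (auto simp: exponents_def keys_add_nat)
        ultimately show ?thesis
          unfolding falling_prod_def lookup_add by (simp only: prod.distrib[symmetric] falling_fact)
      qed
      then have "fact N / multi_fact (a + c) * falling_prod n c (a + c) = fact N / fact M * (fact M / multi_fact a)"
        using multi_fact_pos[of a] multi_fact_pos[of "a + c"] by (simp add: field_simps)
      then show "?F (a + c) = const_mpoly (fact N / fact M) * mpow (simplex_gen n) c * (const_mpoly (fact M / multi_fact a) * mpow (simplex_gen n) a)"
        by (simp only: const_mpoly_mult mpow_add mult_ac)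
    qed
    also have "\<dots> = const_mpoly (fact N / fact M) * mpow (simplex_gen n) c"
      by (simp only: sum_distrib_left[symmetric] multinomial[symmetric] sum_simplex_gen) simp
    also have "fact N / fact M = (\<Prod>j<k. real N - real j)"
      unfolding N by (subst falling_fact[symmetric]) simp
    finally show ?thesis .
  qed
qed

text \<open>Combinations of falling products of degree at most \<open>k\<close>. Falling products diagonalise \<open>multinomial_sum\<close>,
  while the moments produce rising ones; the two differ by terms of lower degree.\<close>

inductive falling_span :: "nat \<Rightarrow> nat \<Rightarrow> ((nat \<Rightarrow>\<^sub>0 nat) \<Rightarrow> real) \<Rightarrow> bool" for n k where
  zero: "falling_span n k (\<lambda>a. 0)"
| step: "falling_span n k g \<Longrightarrow> c \<in> exponents n l \<Longrightarrow> l \<le> k \<Longrightarrow> falling_span n k (\<lambda>a. r * falling_prod n c a + g a)"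

lemma falling_span_multinomial_sum: "falling_span n k g \<Longrightarrow> multinomial_sum n N g \<in> polys_upto n k"
proof (induction rule: falling_span.induct)
  case zero
  then show ?case by (simp add: multinomial_sum_def)
next
  case (step g c l r)
  have "multinomial_sum n N (\<lambda>a. r * falling_prod n c a + g a) = const_mpoly r * multinomial_sum n N (falling_prod n c) + multinomial_sum n N g"
    by (simp only: multinomial_sum_add multinomial_sum_scale)
  moreover have "mpow (simplex_gen n) c \<in> polys_upto n k"
    using polys_upto_mpow[of c n] step by (auto simp: exponents_def intro: polys_upto_mono)
  ultimately show ?case using step
    by (auto simp: multinomial_sum_falling_prod intro!: polys_upto_add polys_upto_smult)
qed

lemma falling_span_add: "falling_span n k f \<Longrightarrow> falling_span n k g \<Longrightarrow> falling_span n k (\<lambda>a. f a + g a)"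
proof (induction rule: falling_span.induct)
  case (step f c l r)
  then have "falling_span n k (\<lambda>a. r * falling_prod n c a + (f a + g a))" by (intro falling_span.step) auto
  then show ?case by (simp add: add.assoc)
qed simp

lemma falling_span_scale: "falling_span n k f \<Longrightarrow> falling_span n k (\<lambda>a. s * f a)"
proof (induction rule: falling_span.induct)
  case (step f c l r)
  then have "falling_span n k (\<lambda>a. (s * r) * falling_prod n c a + s * f a)" by (intro falling_span.step) auto
  then show ?case by (simp add: algebra_simps)
qed (simp add: falling_span.zero)

lemma falling_span_mono: "falling_span n k f \<Longrightarrow> k \<le> l \<Longrightarrow> falling_span n l f"
  by (induction rule: falling_span.induct) (auto intro: falling_span.intros)

lemma falling_prod_add_single:
  assumes i: "i \<in> {1..n+1}"
  shows "falling_prod n (c + single i 1) a = (real (lookup a i) - real (lookup c i)) * falling_prod n c a"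
proof -
  have "falling_prod n (c + single i 1) a =
    (\<Prod>l=1..n+1. (if l = i then real (lookup a i) - real (lookup c i) else 1) *
       (\<Prod>j<lookup c l. real (lookup a l) - real j))"
    unfolding falling_prod_def by (intro prod.cong) (auto simp: lookup_add lookup_single when_def)
  also have "\<dots> = (real (lookup a i) - real (lookup c i)) * falling_prod n c a"
    using i unfolding falling_prod_def by (simp only: prod.distrib prod.delta[OF finite_atLeastAtMost]) simp
  finally show ?thesis .
qed

text \<open>Split \<open>lookup a i\<close> as
  \<open>(lookup a i - lookup c i) + lookup c i\<close>: the first part extends the falling product
  by one factor, the second is a constant.\<close>

lemma falling_span_times_coord:
  assumes "falling_span n k g" and i: "i \<in> {1..n+1}"
  shows "falling_span n (Suc k) (\<lambda>a. real (lookup a i) * g a)"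
  using assms(1)
proof (induction rule: falling_span.induct)
  case zero
  then show ?case by (simp add: falling_span.zero)
next
  case (step g c l r)
  have "falling_span n (Suc k) (\<lambda>a. r * falling_prod n (c + single i 1) a +
     ((r * real (lookup c i)) * falling_prod n c a + real (lookup a i) * g a))"
    using step exponents_add[OF step.hyps(2) single_exponents[OF i]]
    by (intro falling_span.step[where l = "l + 1"] falling_span.step[where l = l]) auto
  then show ?case by (simp only: falling_prod_add_single[OF i]) (simp add: algebra_simps)
qed

definition rising_prod :: "nat \<Rightarrow> (nat \<Rightarrow>\<^sub>0 nat) \<Rightarrow> (nat \<Rightarrow>\<^sub>0 nat) \<Rightarrow> real" where
  "rising_prod n b a = (\<Prod>i=1..n+1. pochhammer (1/2 + real (lookup a i)) (lookup b i))"

lemma rising_prod_add_single: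
  assumes i: "i \<in> {1..n+1}"
  shows "rising_prod n (c + single i 1) a = (real (lookup a i) + (1/2 + real (lookup c i))) * rising_prod n c a"
proof -
  have "rising_prod n (c + single i 1) a =
    (\<Prod>l=1..n+1. (if l = i then real (lookup a i) + (1/2 + real (lookup c i)) else 1) *
       pochhammer (1/2 + real (lookup a l)) (lookup c l))"
    unfolding rising_prod_def by (intro prod.cong) (auto simp: lookup_add lookup_single when_def pochhammer_Suc algebra_simps)
  also have "\<dots> = (real (lookup a i) + (1/2 + real (lookup c i))) * rising_prod n c a"
    using i unfolding rising_prod_def by (simp only: prod.distrib prod.delta[OF finite_atLeastAtMost]) simp
  finally show ?thesis .
qed

text \<open>The first conjunct covers \<open>k = 0\<close>, where \<open>k - 1\<close> truncates to
  \<open>0\<close> and "lower degree" has to mean zero.\<close>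

lemma rising_prod_falling_prod:
  assumes "b \<in> exponents n k"
  shows "\<exists>g. (k = 0 \<longrightarrow> g = (\<lambda>a. 0)) \<and> falling_span n (k - 1) g \<and> rising_prod n b = (\<lambda>a. falling_prod n b a + g a)"
  using assms
proof (induction k arbitrary: b)
  case 0
  then have "b = 0"
    by (intro poly_mapping_eqI) (metis (mono_tags, lifting) exponents_def lookup_le_mon_deg le_zero_eq lookup_zero mem_Collect_eq)
  then show ?case by (intro exI[of _ "\<lambda>a. 0"]) (auto simp: rising_prod_def falling_prod_def falling_span.zero)
next
  case (Suc k)
  have "b \<noteq> 0" using Suc.prems by (auto simp: exponents_def)
  then obtain i where i: "i \<in> keys b" by (metis keys_eq_empty all_not_in_conv)
  then have iI: "i \<in> {1..n+1}" using Suc.prems by (auto simp: exponents_def)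
  define c where "c = b - single i 1"
  have b: "b = c + single i 1"
    using i unfolding c_def by (intro poly_mapping_eqI) (auto simp: lookup_add lookup_minus lookup_single when_def in_keys_iff)
  have c: "c \<in> exponents n k" using Suc.prems unfolding b by (auto simp: exponents_def keys_add_nat mon_deg_add)
  from Suc.IH[OF c] obtain g where g: "k = 0 \<longrightarrow> g = (\<lambda>a. 0)" "falling_span n (k - 1) g" "rising_prod n c = (\<lambda>a. falling_prod n c a + g a)"
    by blast
  define ci where "ci = real (lookup c i)"
  \<comment> \<open>Obtained by expanding
    \<open>(lookup a i + 1/2 + ci) * (falling_prod n c a + g a)\<close> and splitting off
    \<open>(lookup a i - ci) * falling_prod n c a\<close>.\<close>
  define h where "h a = (1/2 + 2 * ci) * falling_prod n c a + ((1/2 + ci) * g a + real (lookup a i) * g a)" for a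
  have "falling_span n k (\<lambda>a. real (lookup a i) * g a)"
  proof (cases k)
    case 0 then show ?thesis using g(1) by (simp add: falling_span.zero)
  next
    case (Suc j) then show ?thesis using falling_span_times_coord[OF g(2) iI] by simp
  qed
  moreover have "falling_span n k (\<lambda>a. (1/2 + ci) * g a)"
    using g(2) by (intro falling_span_scale) (rule falling_span_mono, auto)
  ultimately have "falling_span n k h" unfolding h_def
    by (intro falling_span.step[OF _ c] falling_span_add) auto
  moreover have "rising_prod n b = (\<lambda>a. falling_prod n b a + h a)"
    unfolding b rising_prod_add_single[OF iI] falling_prod_add_single[OF iI] g(3) h_def ci_def by (simp add: algebra_simps fun_eq_iff)
  ultimately show ?case by auto
qed

text \<open>Integration against the average of \<open>(z \<bullet> w)\<^bsup>2 N\<^esup>\<close> over signs, written in \<open>x\<^sub>i = z\<^sub>i\<^sup>2\<close>.\<close>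

definition multinomial_op :: "nat \<Rightarrow> nat \<Rightarrow> mpoly \<Rightarrow> mpoly" where
  "multinomial_op n N h = (\<Sum>a\<in>exponents n N. const_mpoly (fact (2 * N) / multi_fact (a + a) *
      simplex_L n (mpow (simplex_gen n) a * h)) * mpow (simplex_gen n) a)"

lemma multinomial_op_add: "multinomial_op n N (p + q) = multinomial_op n N p + multinomial_op n N q"
  by (simp add: multinomial_op_def distrib_left const_mpoly_add distrib_right sum.distrib)

lemma L_mult_const_mult [simp]: "simplex_L n (q * (const_mpoly c * p)) = c * simplex_L n (q * p)"
  using L_const_mult[of n c "q * p"] by (simp only: mult_ac)

lemma multinomial_op_smult: "multinomial_op n N (const_mpoly c * p) = const_mpoly c * multinomial_op n N p"
  unfolding multinomial_op_def sum_distrib_left L_mult_const_mult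
  by (intro sum.cong refl) (simp only: const_mpoly_mult mult_ac)

lemma multinomial_op_0 [simp]: "multinomial_op n N 0 = 0"
  by (simp add: multinomial_op_def)

lemma multinomial_op_sum: "multinomial_op n N (sum f A) = (\<Sum>i\<in>A. multinomial_op n N (f i))"
  by (induction A rule: infinite_finite_induct) (auto simp: multinomial_op_add)

text \<open>The kernel is symmetric in its two points.\<close>

lemma multinomial_op_selfadjoint: "simplex_L n (g * multinomial_op n N h) = simplex_L n (h * multinomial_op n N g)"
  unfolding multinomial_op_def sum_distrib_left L_sum L_mult_const_mult
  by (intro sum.cong refl) (simp only: mult_ac)

text \<open>The moment of \<open>a + b\<close> factors into the Pochhammer symbols of
  \<open>a\<close> and those started at \<open>1/2 + lookup a i\<close>. The former cancel against
  \<open>multi_fact (a + a)\<close> by the duplication formula for factorials; the latter form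
  \<open>rising_prod n b a\<close>.\<close>

lemma multinomial_op_mpow:
  assumes b: "b \<in> exponents n k"
  shows "multinomial_op n N (mpow (simplex_gen n) b) =
     const_mpoly (pochhammer (1/2) N / pochhammer ((real n + 1) / 2) (N + k)) * multinomial_sum n N (rising_prod n b)"
  unfolding multinomial_op_def multinomial_sum_def sum_distrib_left
proof (intro sum.cong refl)
  fix a assume a: "a \<in> exponents n N"
  let ?P = "pochhammer ((real n + 1) / 2) (N + k)"
  have ab: "a + b \<in> exponents n (N + k)" and aa: "a + a \<in> exponents n (N + N)" using a b by (auto intro: exponents_add)
  have L: "simplex_L n (mpow (simplex_gen n) a * mpow (simplex_gen n) b) =
     (\<Prod>i=1..n+1. pochhammer (1/2) (lookup (a + b) i)) / ?P"
    using ab by (simp only: mpow_add[symmetric]) (auto simp: exponents_def L_moment)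
  have "(\<Prod>i=1..n+1. pochhammer (1/2) (lookup (a + b) i)) =
     (\<Prod>i=1..n+1. pochhammer (1/2) (lookup a i)) * rising_prod n b a"
    unfolding rising_prod_def by (simp only: lookup_add pochhammer_product' prod.distrib)
  moreover have "multi_fact (a + a) = 4 ^ N * multi_fact a * (\<Prod>i=1..n+1. pochhammer (1/2) (lookup a i))"
  proof -
    have "multi_fact (a + a) = (\<Prod>i=1..n+1. fact (2 * lookup a i))"
      using aa by (subst multi_fact_superset[of "{1..n+1}"]) (auto simp: exponents_def lookup_add mult_2)
    also have "\<dots> = (\<Prod>i=1..n+1. 4 ^ lookup a i * (fact (lookup a i) * pochhammer (1/2) (lookup a i)))"
      by (intro prod.cong refl) (simp add: fact_double power_mult)
    also have "\<dots> = 4 ^ (\<Sum>i=1..n+1. lookup a i) * ((\<Prod>i=1..n+1. fact (lookup a i)) * (\<Prod>i=1..n+1. pochhammer (1/2) (lookup a i)))"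
      by (simp only: prod.distrib power_sum)
    also have "(\<Sum>i=1..n+1. lookup a i) = N"
      using a mon_deg_superset[of "{1..n+1}" a] by (auto simp: exponents_def)
    also have "(\<Prod>i=1..n+1. fact (lookup a i)) = multi_fact a"
      using a by (intro multi_fact_superset[symmetric]) (auto simp: exponents_def)
    finally show ?thesis by simp
  qed
  moreover have "(\<Prod>i=1..n+1. pochhammer (1/2) (lookup a i)) > (0::real)"
    by (intro prod_pos pochhammer_pos) auto
  moreover have "fact (2 * N) = 4 ^ N * pochhammer (1/2) N * (fact N :: real)"
    by (simp add: fact_double power_mult)
  moreover have arith: "u * v * w / (u * m * Q) * (Q * T / R) = v / R * (w / m * T)"
    if "u > 0" "m > 0" "Q > 0" for u v w m Q T R :: real
    using that by simp
  ultimately have "fact (2 * N) / multi_fact (a + a) * simplex_L n (mpow (simplex_gen n) a * mpow (simplex_gen n) b)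
     = pochhammer (1/2) N / ?P * (fact N / multi_fact a * rising_prod n b a)"
    unfolding L using multi_fact_pos[of a] by (simp only: arith zero_less_power zero_less_numeral)
  then show "const_mpoly (fact (2 * N) / multi_fact (a + a) * simplex_L n (mpow (simplex_gen n) a * mpow (simplex_gen n) b)) * mpow (simplex_gen n) a
    = const_mpoly (pochhammer (1/2) N / ?P) * (const_mpoly (fact N / multi_fact a * rising_prod n b a) * mpow (simplex_gen n) a)"
    by (simp only: const_mpoly_mult mult.assoc)
qed

text \<open>The rising product is the falling product up to lower degree, and the falling product
  contributes an exact multiple of the monomial. The scalar depends on \<open>b\<close> only through
  its degree.\<close>

lemma multinomial_op_mpow_lower:
  assumes b: "b \<in> exponents n k"
  shows "multinomial_op n N (mpow (simplex_gen n) b) - const_mpoly (kernel_eigenvalue n k N) * mpow (simplex_gen n) b \<in> polys_upto n (k - 1)"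
    and "k = 0 \<Longrightarrow> multinomial_op n N (mpow (simplex_gen n) b) = const_mpoly (kernel_eigenvalue n k N) * mpow (simplex_gen n) b"
proof -
  from rising_prod_falling_prod[OF b] obtain g where g: "k = 0 \<longrightarrow> g = (\<lambda>a. 0)" "falling_span n (k - 1) g" "rising_prod n b = (\<lambda>a. falling_prod n b a + g a)"
    by blast
  let ?c = "pochhammer (1/2) N / pochhammer ((real n + 1) / 2) (N + k)"
  have "multinomial_sum n N (rising_prod n b) = multinomial_sum n N (falling_prod n b) + multinomial_sum n N g"
    unfolding g(3) by (rule multinomial_sum_add)
  then have *: "multinomial_op n N (mpow (simplex_gen n) b) =
     const_mpoly (kernel_eigenvalue n k N) * mpow (simplex_gen n) b + const_mpoly ?c * multinomial_sum n N g"
    unfolding multinomial_op_mpow[OF b] multinomial_sum_falling_prod[OF b] kernel_eigenvalue_def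
    by (simp add: distrib_left mult.assoc[symmetric] const_mpoly_mult[symmetric])
  show "multinomial_op n N (mpow (simplex_gen n) b) - const_mpoly (kernel_eigenvalue n k N) * mpow (simplex_gen n) b \<in> polys_upto n (k - 1)"
    unfolding * using falling_span_multinomial_sum[OF g(2)] by (simp add: polys_upto_smult)
  show "k = 0 \<Longrightarrow> multinomial_op n N (mpow (simplex_gen n) b) = const_mpoly (kernel_eigenvalue n k N) * mpow (simplex_gen n) b"
    unfolding * using g(1) by (simp add: multinomial_sum_def)
qed

lemma multinomial_op_mpow_polys_upto: "b \<in> exponents n k \<Longrightarrow> multinomial_op n N (mpow (simplex_gen n) b) \<in> polys_upto n k"
proof -
  assume b: "b \<in> exponents n k"
  have "mpow (simplex_gen n) b \<in> polys_upto n k"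
    using b polys_upto_mpow[of b n] by (auto simp: exponents_def)
  then have "(multinomial_op n N (mpow (simplex_gen n) b) - const_mpoly (kernel_eigenvalue n k N) * mpow (simplex_gen n) b) + const_mpoly (kernel_eigenvalue n k N) * mpow (simplex_gen n) b \<in> polys_upto n k"
    using multinomial_op_mpow_lower(1)[OF b, of N] by (intro polys_upto_add polys_upto_smult) (auto intro: polys_upto_mono)
  then show ?thesis by simp
qed

lemma multinomial_op_lower:
  assumes p: "p \<in> polys_upto n k"
  shows "multinomial_op n N p - const_mpoly (kernel_eigenvalue n k N) * p \<in> polys_upto n (k - 1)"
    and "k = 0 \<Longrightarrow> multinomial_op n N p = const_mpoly (kernel_eigenvalue n k N) * p"
proof -
  let ?c = "\<lambda>m. const_mpoly (lookup p m)" and ?G = "mpow (simplex_gen n)"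
  have mE: "m \<in> exponents n (mon_deg m)" "mon_deg m \<le> k" if "m \<in> keys p" for m
    using that p by (fastforce simp: polys_upto_iff exponents_def)+
  have e: "multinomial_op n N p - const_mpoly (kernel_eigenvalue n k N) * p = (\<Sum>m\<in>keys p. ?c m * (multinomial_op n N (?G m) - const_mpoly (kernel_eigenvalue n k N) * ?G m))"
  proof -
    have "multinomial_op n N p = (\<Sum>m\<in>keys p. ?c m * multinomial_op n N (?G m))"
      by (subst polys_upto_sum_mpow[OF p]) (simp add: multinomial_op_sum multinomial_op_smult)
    moreover have "const_mpoly (kernel_eigenvalue n k N) * p = (\<Sum>m\<in>keys p. ?c m * (const_mpoly (kernel_eigenvalue n k N) * ?G m))"
      by (subst polys_upto_sum_mpow[OF p]) (simp add: sum_distrib_left mult_ac)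
    ultimately show ?thesis by (simp add: sum_subtractf right_diff_distrib)
  qed
  show "multinomial_op n N p - const_mpoly (kernel_eigenvalue n k N) * p \<in> polys_upto n (k - 1)"
    unfolding e
  proof (intro polys_upto_sum polys_upto_smult)
    fix m assume m: "m \<in> keys p"
    show "multinomial_op n N (?G m) - const_mpoly (kernel_eigenvalue n k N) * ?G m \<in> polys_upto n (k - 1)"
    proof (cases "mon_deg m = k")
      case True then show ?thesis using multinomial_op_mpow_lower(1)[OF mE(1)[OF m]] by simp
    next
      case False
      \<comment> \<open>A monomial of smaller degree and its image both stay below degree
        \<open>k\<close>, whatever scalar multiplies it.\<close>
      then have "mon_deg m \<le> k - 1" using mE(2)[OF m] by simp
      moreover have "?G m \<in> polys_upto n (mon_deg m)" using mE(1)[OF m] by (intro polys_upto_mpow) (auto simp: exponents_def)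
      ultimately show ?thesis using multinomial_op_mpow_polys_upto[OF mE(1)[OF m], of N]
        by (intro polys_upto_diff polys_upto_smult) (auto intro: polys_upto_mono)
    qed
  qed
  assume k: "k = 0"
  have "(\<Sum>m\<in>keys p. ?c m * (multinomial_op n N (?G m) - const_mpoly (kernel_eigenvalue n k N) * ?G m)) = 0"
  proof (intro sum.neutral ballI)
    fix m assume m: "m \<in> keys p"
    then have "mon_deg m = 0" using mE(2) k by auto
    then show "?c m * (multinomial_op n N (?G m) - const_mpoly (kernel_eigenvalue n k N) * ?G m) = 0"
      using multinomial_op_mpow_lower(2)[OF mE(1)[OF m]] k by simp
  qed
  then show "multinomial_op n N p = const_mpoly (kernel_eigenvalue n k N) * p" using e by simp
qed

lemma multinomial_op_polys_upto:
  assumes p: "p \<in> polys_upto n k"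
  shows "multinomial_op n N p \<in> polys_upto n k"
proof -
  have "(multinomial_op n N p - const_mpoly (kernel_eigenvalue n k N) * p) + const_mpoly (kernel_eigenvalue n k N) * p \<in> polys_upto n k"
    using multinomial_op_lower(1)[OF p, of N] p by (intro polys_upto_add polys_upto_smult) (auto intro: polys_upto_mono)
  then show ?thesis by simp
qed

section \<open>Kernel operators and the reproducing kernel\<close>

lemma L_Cauchy_Schwarz: "(simplex_L n (p * q))\<^sup>2 \<le> simplex_L n (p * p) * simplex_L n (q * q)"
proof -
  define A B C where "A = simplex_L n (p * p)" "B = simplex_L n (p * q)" "C = simplex_L n (q * q)"
  have quad: "A + 2 * t * B + t\<^sup>2 * C \<ge> 0" for t
  proof -
    have "simplex_L n ((p + const_mpoly t * q) * (p + const_mpoly t * q)) \<ge> 0"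
      by (rule L_nonneg) simp
    also have "(p + const_mpoly t * q) * (p + const_mpoly t * q) =
       p * p + (const_mpoly (t + t) * (p * q) + const_mpoly (t * t) * (q * q))"
      by (simp only: const_mpoly_add const_mpoly_mult) (simp add: algebra_simps)
    finally show ?thesis unfolding L_add L_const_mult by (simp add: A_B_C_def power2_eq_square algebra_simps)
  qed
  have A: "A \<ge> 0" and C: "C \<ge> 0" unfolding A_B_C_def by (rule L_nonneg; simp)+
  have "B\<^sup>2 \<le> A * C"
  proof (cases "C = 0")
    case True
    have "B = 0"
    proof (rule ccontr)
      assume "B \<noteq> 0"
      then show False using quad[of "- (A + 1) / (2 * B)"] True by (simp add: field_simps)
    qed
    then show ?thesis using True by simp
  next
    case False
    then show ?thesis using quad[of "- B / C"] C by (simp add: field_simps power2_eq_square)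
  qed
  then show ?thesis by (simp add: A_B_C_def)
qed

lemma L_mult_eq_0: "simplex_L n (p * p) = 0 \<Longrightarrow> simplex_L n (p * q) = 0"
  using L_Cauchy_Schwarz[of n p q] by simp

lemma polys_upto_smult_iff: "c \<noteq> 0 \<Longrightarrow> const_mpoly c * p \<in> polys_upto n k \<longleftrightarrow> p \<in> polys_upto n k"
  using polys_upto_smult[of "const_mpoly c * p" n k "1 / c"] polys_upto_smult[of p n k c]
  by (auto simp: mult.assoc[symmetric] const_mpoly_mult[symmetric])

text \<open>All \<open>multinomial_op n N p\<close> vanish, but they are nonzero multiples of \<open>p\<close> modulo lower degree; so the degree
  of \<open>p\<close> can be lowered until nothing is left.\<close>

lemma L_square_eq_0:
  assumes "p \<in> polys_upto n k" and p0: "simplex_L n (p * p) = 0"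
  shows "p = 0"
proof -
  have L_zero: "simplex_L n (q * p) = 0" for q
    using L_mult_eq_0[OF p0, of q] by (simp add: mult.commute)
  then have multinomial_op: "multinomial_op n N p = 0" for N by (simp add: multinomial_op_def)
  have "p \<in> polys_upto n 0"
    using assms(1)
  proof (induction k)
    case (Suc k)
    have "- (const_mpoly (kernel_eigenvalue n (Suc k) (Suc k)) * p) \<in> polys_upto n k"
      using multinomial_op_lower(1)[OF Suc.prems, of "Suc k"] by (simp add: multinomial_op)
    \<comment> \<open>The exponent \<open>N = Suc k\<close> is large enough for the falling factor
      to have no zero.\<close>
    moreover have "kernel_eigenvalue n (Suc k) (Suc k) \<noteq> 0"
    proof -
      have "(\<Prod>i<Suc k. real (Suc k) - real i) > 0" by (intro prod_pos) auto
      moreover have "pochhammer ((real n + 1) / 2) (Suc k + Suc k) > 0" by (intro pochhammer_pos) auto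
      moreover have "pochhammer (1/2 :: real) (Suc k) > 0" by (intro pochhammer_pos) auto
      ultimately show ?thesis unfolding kernel_eigenvalue_def by (simp only: divide_eq_0_iff mult_eq_0_iff) auto
    qed
    ultimately have "p \<in> polys_upto n k"
      using polys_upto_minus[of "- (const_mpoly (kernel_eigenvalue n (Suc k) (Suc k)) * p)" n k]
      by (simp add: polys_upto_smult_iff)
    then show ?case by (rule Suc.IH)
  qed
  from multinomial_op_lower(2)[OF this, of 0] show ?thesis by (simp add: multinomial_op kernel_eigenvalue_def)
qed

lemma polys_upto_0_const: "p \<in> polys_upto n 0 \<Longrightarrow> p \<in> range const_mpoly"
proof -
  assume p: "p \<in> polys_upto n 0"
  have m0: "mon_deg m = 0 \<Longrightarrow> m = 0" for m
    by (intro poly_mapping_eqI) (metis lookup_le_mon_deg le_zero_eq lookup_zero)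
  have "p = const_mpoly (lookup p 0)"
  proof (rule poly_mapping_eqI)
    fix m show "lookup p m = lookup (const_mpoly (lookup p 0)) m"
    proof (cases "m = 0")
      case False
      then have "m \<notin> keys p" using p m0[of m] by (auto simp: polys_upto_iff)
      then show ?thesis using False by (simp add: const_mpoly_def lookup_single in_keys_iff)
    qed (simp add: const_mpoly_def)
  qed
  then show ?thesis by blast
qed

lemma orth_space_polys_upto: "p \<in> orth_space n k \<Longrightarrow> p \<in> polys_upto n k"
  by (auto simp: orth_space_def split: if_splits)

lemma orth_space_orth: "p \<in> orth_space n k \<Longrightarrow> k > 0 \<Longrightarrow> q \<in> polys_upto n (k - 1) \<Longrightarrow> simplex_L n (p * q) = 0"
  by (auto simp: orth_space_def simplex_inner_eq)

text \<open>The defect \<open>g\<close> has lower degree, hence is orthogonal to \<open>p\<close>.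
  So is its image, since the operator does not raise degrees. By self-adjointness \<open>g\<close>
  is then orthogonal to itself.\<close>

lemma multinomial_op_eigen:
  assumes p: "p \<in> orth_space n k"
  shows "multinomial_op n N p = const_mpoly (kernel_eigenvalue n k N) * p"
proof (cases "k = 0")
  case True
  then show ?thesis using multinomial_op_lower(2)[OF orth_space_polys_upto[OF p]] by simp
next
  case False
  define g where "g = multinomial_op n N p - const_mpoly (kernel_eigenvalue n k N) * p"
  have g: "g \<in> polys_upto n (k - 1)"
    unfolding g_def by (rule multinomial_op_lower(1)[OF orth_space_polys_upto[OF p]])
  have 1: "simplex_L n (p * g) = 0" using orth_space_orth[OF p _ g] False by simp
  have 2: "simplex_L n (p * multinomial_op n N g) = 0" using orth_space_orth[OF p _ multinomial_op_polys_upto[OF g]] False by simp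
  have "simplex_L n (g * g) = simplex_L n (g * multinomial_op n N p) - kernel_eigenvalue n k N * simplex_L n (p * g)"
    by (subst (2) g_def) (simp only: right_diff_distrib L_diff L_mult_const_mult mult.commute[of p g])
  also have "\<dots> = 0" using 1 2 by (simp add: multinomial_op_selfadjoint[of n g N p])
  finally have "g = 0" by (rule L_square_eq_0[OF g])
  then show ?thesis by (simp add: g_def)
qed

section \<open>Orthogonal projection and decomposition into components\<close>

inductive_set real_span :: "mpoly set \<Rightarrow> mpoly set" for B where
  zero: "0 \<in> real_span B"
| step: "u \<in> real_span B \<Longrightarrow> b \<in> B \<Longrightarrow> const_mpoly c * b + u \<in> real_span B"

lemma real_span_add: "u \<in> real_span B \<Longrightarrow> v \<in> real_span B \<Longrightarrow> u + v \<in> real_span B"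
  by (induction rule: real_span.induct) (auto simp: add.assoc intro: real_span.step)

lemma real_span_smult: "u \<in> real_span B \<Longrightarrow> const_mpoly c * u \<in> real_span B"
proof (induction rule: real_span.induct)
  case (step u b d)
  then show ?case using real_span.step[of "const_mpoly c * u" B b "c * d"]
    by (simp add: distrib_left const_mpoly_mult mult.assoc)
qed (simp add: real_span.zero)

lemma real_span_diff: "u \<in> real_span B \<Longrightarrow> v \<in> real_span B \<Longrightarrow> u - v \<in> real_span B"
  using real_span_add[of u B "- v"] real_span_smult[of v B "-1"] by (simp add: const_mpoly_minus)

lemma real_span_base: "b \<in> B \<Longrightarrow> b \<in> real_span B"
  using real_span.step[OF real_span.zero, of b B 1] by simp

lemma real_span_mono: "u \<in> real_span B \<Longrightarrow> B \<subseteq> C \<Longrightarrow> u \<in> real_span C"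
  by (induction rule: real_span.induct) (auto intro: real_span.intros)

lemma real_span_sum: "(\<And>i. i \<in> A \<Longrightarrow> f i \<in> real_span B) \<Longrightarrow> sum f A \<in> real_span B"
  by (induction A rule: infinite_finite_induct) (auto intro: real_span_add real_span.zero)

lemma real_span_orth: "u \<in> real_span B \<Longrightarrow> (\<And>b. b \<in> B \<Longrightarrow> simplex_L n (w * b) = 0) \<Longrightarrow> simplex_L n (w * u) = 0"
  by (induction rule: real_span.induct) (auto simp: distrib_left)

lemma real_span_polys_upto: "u \<in> real_span B \<Longrightarrow> B \<subseteq> polys_upto n k \<Longrightarrow> u \<in> polys_upto n k"
proof (induction rule: real_span.induct)
  case (step u b c)
  then have "b \<in> polys_upto n k" "u \<in> polys_upto n k" by auto
  then show ?case by (intro polys_upto_add polys_upto_smult)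
qed simp

text \<open>One Gram-Schmidt step per element of \<open>B\<close>. Independence is not assumed: if
  the new direction \<open>e\<close> has norm zero, it is orthogonal to everything by
  Cauchy-Schwarz.\<close>

lemma orth_projection:
  assumes "finite B"
  shows "\<exists>u\<in>real_span B. \<forall>b\<in>B. simplex_L n ((p - u) * b) = 0"
  using assms
proof (induction B arbitrary: p rule: finite_induct)
  case empty
  then show ?case by (intro bexI[of _ 0]) (auto intro: real_span.zero)
next
  case (insert b B)
  from insert.IH[of b] obtain v where v: "v \<in> real_span B" "\<And>c. c \<in> B \<Longrightarrow> simplex_L n ((b - v) * c) = 0" by blast
  from insert.IH[of p] obtain u where u: "u \<in> real_span B" "\<And>c. c \<in> B \<Longrightarrow> simplex_L n ((p - u) * c) = 0" by blast
  define e q where "e = b - v" and "q = p - u"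
  have b_eq: "b = e + v" by (simp add: e_def)
  have mono: "w \<in> real_span B \<Longrightarrow> w \<in> real_span (insert b B)" for w by (rule real_span_mono) auto
  have ev: "simplex_L n (e * v) = 0" unfolding e_def by (rule real_span_orth[OF v])
  have qv: "simplex_L n (q * v) = 0" unfolding q_def by (rule real_span_orth[OF v(1) u(2)])
  define t where "t = simplex_L n (q * e) / simplex_L n (e * e)"
  have qb: "simplex_L n (q * b) = t * simplex_L n (e * b)"
  proof (cases "simplex_L n (e * e) = 0")
    case True
    then have "simplex_L n (q * e) = 0" using L_mult_eq_0[of n e q] by (simp add: mult.commute)
    then show ?thesis unfolding b_eq distrib_left L_add ev qv True by (simp only: mult_zero_right add_0_right)
  next
    case False
    then show ?thesis unfolding b_eq distrib_left L_add ev qv t_def by simp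
  qed
  show ?case
  proof (intro bexI ballI)
    have "e \<in> real_span (insert b B)" unfolding e_def by (rule real_span_diff[OF real_span_base mono[OF v(1)]]) simp
    then show "u + const_mpoly t * e \<in> real_span (insert b B)" by (rule real_span_add[OF mono[OF u(1)] real_span_smult])
    fix c assume "c \<in> insert b B"
    then have "simplex_L n (q * c) = t * simplex_L n (e * c)"
    proof
      assume "c \<in> B"
      from u(2)[OF this] v(2)[OF this] show ?thesis unfolding q_def e_def by (simp only: mult_zero_right)
    qed (simp only: qb)
    moreover have "(p - (u + const_mpoly t * e)) * c = q * c - const_mpoly t * (e * c)"
      by (simp only: q_def left_diff_distrib distrib_right mult.assoc diff_diff_eq)
    ultimately show "simplex_L n ((p - (u + const_mpoly t * e)) * c) = 0"
      by (simp only: L_diff L_const_mult diff_self)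
  qed
qed

lemma orth_component:
  assumes p: "p \<in> polys_upto n (Suc k)"
  shows "\<exists>u\<in>polys_upto n k. p - u \<in> orth_space n (Suc k)"
proof -
  define B where "B = mpow (simplex_gen n) ` (\<Union>l\<le>k. exponents n l)"
  have "finite B" by (simp add: B_def)
  from orth_projection[OF this, of n p] obtain u where u: "u \<in> real_span B" "\<And>b. b \<in> B \<Longrightarrow> simplex_L n ((p - u) * b) = 0" by blast
  have B: "B \<subseteq> polys_upto n k"
  proof
    fix b assume "b \<in> B"
    then obtain a where a: "b = mpow (simplex_gen n) a" "keys a \<subseteq> {1..n+1}" "mon_deg a \<le> k"
      by (auto simp: B_def exponents_def)
    show "b \<in> polys_upto n k" unfolding a(1) by (rule polys_upto_mono[OF polys_upto_mpow[OF a(2)] a(3)])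
  qed
  have uk: "u \<in> polys_upto n k" using real_span_polys_upto[OF u(1) B] .
  have "simplex_L n ((p - u) * q) = 0" if q: "q \<in> polys_upto n k" for q
  proof (rule real_span_orth[OF _ u(2)])
    have "m \<in> exponents n (mon_deg m)" "mon_deg m \<le> k" if "m \<in> keys q" for m
      using that q by (fastforce simp: polys_upto_iff exponents_def)+
    then have m: "mpow (simplex_gen n) m \<in> B" if "m \<in> keys q" for m
      using that unfolding B_def by blast
    have "(\<Sum>m\<in>keys q. const_mpoly (lookup q m) * mpow (simplex_gen n) m) \<in> real_span B"
      by (intro real_span_sum real_span_smult real_span_base m)
    then show "q \<in> real_span B" by (simp only: polys_upto_sum_mpow[OF q, symmetric])
  qed
  moreover have "p - u \<in> polys_upto n (Suc k)"
    by (rule polys_upto_diff[OF p polys_upto_mono[OF uk]]) simp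
  ultimately have "p - u \<in> orth_space n (Suc k)"
    by (simp add: orth_space_def simplex_inner_eq)
  with uk show ?thesis by blast
qed

lemma orth_decomposition:
  "p \<in> polys_upto n d \<Longrightarrow> \<exists>c. (\<forall>j\<le>d. c j \<in> orth_space n j) \<and> p = (\<Sum>j\<le>d. c j)"
proof (induction d arbitrary: p)
  case 0
  then have "p \<in> orth_space n 0" using polys_upto_0_const by (simp add: orth_space_def)
  then show ?case by (intro exI[of _ "\<lambda>_. p"]) auto
next
  case (Suc d)
  from orth_component[OF Suc.prems] obtain u where u: "u \<in> polys_upto n d" "p - u \<in> orth_space n (Suc d)" by blast
  from Suc.IH[OF u(1)] obtain c where c: "\<forall>j\<le>d. c j \<in> orth_space n j" "u = (\<Sum>j\<le>d. c j)" by blast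
  have "(\<Sum>j\<le>d. (c(Suc d := p - u)) j) = u" unfolding c(2) by (intro sum.cong) auto
  then show ?case using c(1) u(2)
    by (intro exI[of _ "c(Suc d := p - u)"]) (auto simp: le_Suc_eq)
qed

text \<open>The even part of \<open>q ((X\<^sub>1 + \<dots> + X\<^sub>n\<^sub>+\<^sub>1)\<^sup>2)\<close> with \<open>X\<^bsup>2 a\<^esup>\<close> replaced by \<open>\<phi> a\<close>. The operator \<open>kernel_op\<close> and
  the kernel \<open>kernel_at n q x\<close>, as a polynomial in the second variable, are instances.\<close>

definition even_kernel :: "nat \<Rightarrow> ((nat \<Rightarrow>\<^sub>0 nat) \<Rightarrow> mpoly) \<Rightarrow> real poly \<Rightarrow> mpoly" where
  "even_kernel n \<phi> q = (\<Sum>N\<le>degree q. \<Sum>a\<in>exponents n N. const_mpoly (coeff q N * (fact (2 * N) / multi_fact (a + a))) * \<phi> a)"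

definition kernel_op :: "nat \<Rightarrow> real poly \<Rightarrow> mpoly \<Rightarrow> mpoly" where
  "kernel_op n q h = even_kernel n (\<lambda>a. const_mpoly (simplex_L n (mpow (simplex_gen n) a * h)) * mpow (simplex_gen n) a) q"

definition kernel_at :: "nat \<Rightarrow> real poly \<Rightarrow> (nat \<Rightarrow> real) \<Rightarrow> mpoly" where
  "kernel_at n q x = even_kernel n (mpow (\<lambda>i. const_mpoly (eval_mpoly (simplex_gen n i) x) * simplex_gen n i)) q"

lemma kernel_op_multinomial_op: "kernel_op n q h = (\<Sum>N\<le>degree q. const_mpoly (coeff q N) * multinomial_op n N h)"
  unfolding kernel_op_def even_kernel_def multinomial_op_def sum_distrib_left
  by (intro sum.cong refl) (simp only: const_mpoly_mult mult.assoc)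

lemma kernel_op_eigen: "p \<in> orth_space n k \<Longrightarrow> kernel_op n q p = const_mpoly (Lam n k q) * p"
  by (simp add: kernel_op_multinomial_op multinomial_op_eigen coeff_functional_def const_mpoly_sum const_mpoly_mult sum_distrib_right mult.assoc)

lemma kernel_op_sum: "kernel_op n q (sum f A) = (\<Sum>i\<in>A. kernel_op n q (f i))"
  unfolding kernel_op_multinomial_op multinomial_op_sum sum_distrib_left by (rule sum.swap)

lemma mpow_const: "mpow (\<lambda>i. const_mpoly (f i)) a = const_mpoly (mpow f a)"
proof -
  have p: "const_mpoly c ^ k = const_mpoly (c ^ k)" for c k
    by (induction k) (simp_all add: const_mpoly_mult)
  have "(\<Prod>i\<in>A. const_mpoly (g i)) = const_mpoly (\<Prod>i\<in>A. g i)" for g A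
    by (induction A rule: infinite_finite_induct) (simp_all add: const_mpoly_mult)
  then show ?thesis by (simp add: mpow_def p)
qed

lemma eval_kernel_op: "eval_mpoly (kernel_op n q h) x = simplex_L n (kernel_at n q x * h)"
  unfolding kernel_op_def kernel_at_def even_kernel_def eval_sum eval_mult eval_const eval_mpow mpow_mult mpow_const
    sum_distrib_right mult.assoc L_sum L_const_mult
  by (intro sum.cong refl) (simp only: mult_ac)

lemma orth_space_1: "1 \<in> orth_space n 0"
  using const_mpoly_1 by (simp only: orth_space_def) (metis rangeI)

lemma L_kernel_at: "simplex_L n (kernel_at n q x) = Lam n 0 q"
  using eval_kernel_op[of n q 1 x] kernel_op_eigen[OF orth_space_1, of n q] by simp

section \<open>Splitting exponents by parity\<close>

definition half_exp :: "(nat \<Rightarrow>\<^sub>0 nat) \<Rightarrow> (nat \<Rightarrow>\<^sub>0 nat)" where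
  "half_exp a = Poly_Mapping.map (\<lambda>k. k div 2) a"

definition odd_exp :: "(nat \<Rightarrow>\<^sub>0 nat) \<Rightarrow> (nat \<Rightarrow>\<^sub>0 nat)" where
  "odd_exp a = Poly_Mapping.map (\<lambda>k. k mod 2) a"

lemma lookup_half_exp [simp]: "lookup (half_exp a) i = lookup a i div 2"
  by (simp add: half_exp_def map.rep_eq when_def)

lemma lookup_odd_exp [simp]: "lookup (odd_exp a) i = lookup a i mod 2"
  by (simp add: odd_exp_def map.rep_eq when_def)

lemma half_exp_double: "half_exp (a + a) = a"
proof (rule poly_mapping_eqI)
  fix i
  have "(k + k) div 2 = k" for k :: nat by presburger
  then show "lookup (half_exp (a + a)) i = lookup a i"
    by (simp only: lookup_add lookup_half_exp)
qed

lemma odd_exp_double: "odd_exp (a + a) = 0"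
proof (rule poly_mapping_eqI)
  fix i
  have "(k + k) mod 2 = 0" for k :: nat by presburger
  then show "lookup (odd_exp (a + a)) i = lookup 0 i"
    by (simp only: lookup_add lookup_odd_exp lookup_zero)
qed

lemma half_exp_odd_exp: "half_exp a + half_exp a + odd_exp a = a"
proof (rule poly_mapping_eqI)
  fix i
  have "k div 2 + k div 2 + k mod 2 = k" for k :: nat by presburger
  then show "lookup (half_exp a + half_exp a + odd_exp a) i = lookup a i"
    by (simp only: lookup_add lookup_half_exp lookup_odd_exp)
qed

lemma odd_exp_add_eq_0: "odd_exp (a + b) = 0 \<longleftrightarrow> odd_exp a = odd_exp b"
proof -
  have *: "(k + l) mod 2 = 0 \<longleftrightarrow> k mod 2 = l mod 2" for k l :: nat by presburger
  have "odd_exp (a + b) = 0 \<longleftrightarrow> (\<forall>i. lookup (odd_exp (a + b)) i = 0)"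
    by (simp only: poly_mapping_eq_iff fun_eq_iff lookup_zero)
  also have "\<dots> \<longleftrightarrow> odd_exp a = odd_exp b"
    by (simp only: poly_mapping_eq_iff fun_eq_iff lookup_odd_exp lookup_add *)
  finally show ?thesis .
qed

lemma half_exp_add:
  assumes "odd_exp a = odd_exp b"
  shows "half_exp (a + b) = half_exp a + half_exp b + odd_exp a"
proof (rule poly_mapping_eqI)
  fix i
  have *: "(k + l) div 2 = k div 2 + l div 2 + k mod 2" if e: "k mod 2 = l mod 2" for k l :: nat
  proof -
    have arith: "(x * 2 + z) + (y * 2 + z) = 2 * (x + y + z)" for x y z :: nat by simp
    have "k + l = (k div 2 * 2 + k mod 2) + (l div 2 * 2 + l mod 2)" by (simp only: div_mult_mod_eq)
    also have "\<dots> = 2 * (k div 2 + l div 2 + k mod 2)" unfolding e[symmetric] by (rule arith)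
    finally show ?thesis by (simp only: nonzero_mult_div_cancel_left zero_neq_numeral[symmetric] simp_thms)
  qed
  have "lookup (odd_exp a) i = lookup (odd_exp b) i" by (simp only: assms)
  then have "lookup a i mod 2 = lookup b i mod 2" unfolding lookup_odd_exp .
  from *[OF this] show "lookup (half_exp (a + b)) i = lookup (half_exp a + half_exp b + odd_exp a) i"
    unfolding lookup_half_exp lookup_add lookup_odd_exp .
qed

lemma odd_exp_eq_iff: "odd_exp a = odd_exp b \<longleftrightarrow> keys (odd_exp a) = keys (odd_exp b)"
proof -
  have *: "k mod 2 = l mod 2 \<longleftrightarrow> (k mod 2 \<noteq> 0 \<longleftrightarrow> l mod 2 \<noteq> 0)" for k l :: nat by presburger
  have "odd_exp a = odd_exp b \<longleftrightarrow> (\<forall>i. lookup a i mod 2 = lookup b i mod 2)"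
    by (simp only: poly_mapping_eq_iff fun_eq_iff lookup_odd_exp)
  also have "\<dots> \<longleftrightarrow> keys (odd_exp a) = keys (odd_exp b)"
    by (simp only: * set_eq_iff in_keys_iff lookup_odd_exp)
  finally show ?thesis .
qed

definition linear_ext :: "((nat \<Rightarrow>\<^sub>0 nat) \<Rightarrow> mpoly) \<Rightarrow> mpoly \<Rightarrow> mpoly" where
  "linear_ext \<psi> p = (\<Sum>m\<in>keys p. const_mpoly (lookup p m) * \<psi> m)"

lemma linear_ext_add: "linear_ext \<psi> (p + q) = linear_ext \<psi> p + linear_ext \<psi> q"
  unfolding linear_ext_def by (rule setsum_keys_plus_distrib) (simp_all add: distrib_right const_mpoly_add)

lemma linear_ext_0 [simp]: "linear_ext \<psi> 0 = 0"
  by (simp add: linear_ext_def)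

lemma linear_ext_sum: "linear_ext \<psi> (sum f A) = (\<Sum>i\<in>A. linear_ext \<psi> (f i))"
  by (induction A rule: infinite_finite_induct) (auto simp: linear_ext_add)

lemma linear_ext_single: "linear_ext \<psi> (single m c) = const_mpoly c * \<psi> m"
  by (cases "c = 0") (simp_all add: linear_ext_def)

definition evenpart :: "((nat \<Rightarrow>\<^sub>0 nat) \<Rightarrow> mpoly) \<Rightarrow> (nat \<Rightarrow>\<^sub>0 nat) \<Rightarrow> mpoly" where
  "evenpart \<phi> m = (if odd_exp m = 0 then \<phi> (half_exp m) else 0)"

text \<open>A polynomial in the \<open>n + 1\<close> coordinates of the sphere; the second point is
  supplied later through \<open>\<phi>\<close>. Unlike \<open>even_kernel\<close> it is
  multiplicative in \<open>q\<close>, which gives access to squares.\<close>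

definition subst_sum_sq :: "nat \<Rightarrow> real poly \<Rightarrow> mpoly" where
  "subst_sum_sq n q = (\<Sum>N\<le>degree q. const_mpoly (coeff q N) * (\<Sum>i=1..n+1. X i) ^ (2 * N))"

lemma subst_sum_sq_poly: "subst_sum_sq n q = poly (map_poly const_mpoly q) ((\<Sum>i=1..n+1. X i) ^ 2)"
proof -
  have "const_mpoly c = 0 \<Longrightarrow> c = 0" for c
    by (metis eval_const eval_0)
  then have "degree (map_poly const_mpoly q) = degree q"
    by (intro degree_map_poly) auto
  then show ?thesis by (simp add: subst_sum_sq_def poly_altdef coeff_map_poly power_mult)
qed

lemma subst_sum_sq_mult: "subst_sum_sq n (p * q) = subst_sum_sq n p * subst_sum_sq n q"
proof -
  have "map_poly const_mpoly (p * q) = map_poly const_mpoly p * map_poly const_mpoly q"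
    by (rule poly_eqI) (simp add: coeff_map_poly coeff_mult const_mpoly_sum const_mpoly_mult)
  then show ?thesis by (simp add: subst_sum_sq_poly)
qed

lemma power_sum_X: "(\<Sum>i=1..n+1. X i) ^ N = (\<Sum>a\<in>exponents n N. single a (fact N / multi_fact a))"
  unfolding multinomial by (simp add: single_eq_mpow_X)

lemma subst_sum_sq_singles: "subst_sum_sq n q = (\<Sum>N\<le>degree q. \<Sum>a\<in>exponents n (2 * N). single a (coeff q N * (fact (2 * N) / multi_fact a)))"
  unfolding subst_sum_sq_def power_sum_X sum_distrib_left
  by (simp add: const_mpoly_def mult_single)

lemma keys_subst_sum_sq:
  assumes "a \<in> keys (subst_sum_sq n q)"
  shows "\<exists>N\<le>degree q. a \<in> exponents n (2 * N)"
proof (rule ccontr)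
  assume "\<not> ?thesis"
  then have "lookup (subst_sum_sq n q) a = 0"
    by (auto simp: subst_sum_sq_singles lookup_sum lookup_single when_def intro!: sum.neutral)
  with assms show False by (simp add: in_keys_iff)
qed

text \<open>An exponent with zero odd part has the form \<open>a + a\<close>, and all others are
  discarded by \<open>evenpart\<close>.\<close>

lemma even_kernel_linear_ext: "even_kernel n \<phi> q = linear_ext (evenpart \<phi>) (subst_sum_sq n q)"
proof -
  have "linear_ext (evenpart \<phi>) (subst_sum_sq n q) = (\<Sum>N\<le>degree q. \<Sum>m\<in>exponents n (2 * N). const_mpoly (coeff q N * (fact (2 * N) / multi_fact m)) * evenpart \<phi> m)"
    by (simp add: subst_sum_sq_singles linear_ext_sum linear_ext_single)
  also have "\<dots> = even_kernel n \<phi> q"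
    unfolding even_kernel_def
  proof (intro sum.cong[OF refl])
    fix N
    let ?F = "\<lambda>m. const_mpoly (coeff q N * (fact (2 * N) / multi_fact m)) * evenpart \<phi> m"
    have "(\<Sum>m\<in>exponents n (2 * N). ?F m) = (\<Sum>m\<in>(\<lambda>a. a + a) ` exponents n N. ?F m)"
    proof (rule sum.mono_neutral_right)
      show "(\<lambda>a. a + a) ` exponents n N \<subseteq> exponents n (2 * N)" using exponents_add[of _ n N _ N] by (auto simp: mult_2)
      show "\<forall>m\<in>exponents n (2 * N) - (\<lambda>a. a + a) ` exponents n N. ?F m = 0"
      proof
        fix m assume m: "m \<in> exponents n (2 * N) - (\<lambda>a. a + a) ` exponents n N"
        have "odd_exp m \<noteq> 0"
        proof
          assume "odd_exp m = 0"
          then have e: "m = half_exp m + half_exp m" using half_exp_odd_exp[of m] by simp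
          have "m \<in> exponents n (2 * N)" using m by blast
          then have "half_exp m + half_exp m \<in> exponents n (2 * N)" using e by simp
          then have "half_exp m \<in> exponents n N" by (simp add: exponents_def keys_add_nat mon_deg_add)
          with e m show False by auto
        qed
        then show "?F m = 0" by (simp add: evenpart_def)
      qed
    qed simp
    also have "\<dots> = (\<Sum>a\<in>exponents n N. ?F (a + a))"
      by (subst sum.reindex) (auto intro: inj_on_inverseI[of _ half_exp] simp: half_exp_double)
    finally show "(\<Sum>m\<in>exponents n (2 * N). ?F m) = (\<Sum>a\<in>exponents n N. const_mpoly (coeff q N * (fact (2 * N) / multi_fact (a + a))) * \<phi> a)"
      by (simp add: evenpart_def half_exp_double odd_exp_double)
  qed
  finally show ?thesis ..
qed

lemma sum_pairs_partition:
  fixes f :: "'a \<Rightarrow> 'a \<Rightarrow> 'b::comm_monoid_add"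
  assumes "finite K" "finite T" "\<pi> ` K \<subseteq> T"
  shows "(\<Sum>a\<in>K. \<Sum>b\<in>K. if \<pi> a = \<pi> b then f a b else 0) =
    (\<Sum>J\<in>T. \<Sum>a\<in>{a\<in>K. \<pi> a = J}. \<Sum>b\<in>{b\<in>K. \<pi> b = J}. f a b)"
proof -
  have "(\<Sum>a\<in>K. \<Sum>b\<in>K. if \<pi> a = \<pi> b then f a b else 0) = (\<Sum>J\<in>T. \<Sum>a\<in>{a\<in>K. \<pi> a = J}. \<Sum>b\<in>K. if \<pi> a = \<pi> b then f a b else 0)"
    by (rule sum.group[OF assms, symmetric])
  also have "\<dots> = (\<Sum>J\<in>T. \<Sum>a\<in>{a\<in>K. \<pi> a = J}. \<Sum>b\<in>{b\<in>K. \<pi> b = J}. f a b)"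
  proof (rule sum.cong[OF refl], rule sum.cong[OF refl])
    fix J a assume a: "a \<in> {a\<in>K. \<pi> a = J}"
    have "(\<Sum>b\<in>{b\<in>K. \<pi> b = J}. f a b) = (\<Sum>b\<in>K. if \<pi> b = J then f a b else 0)"
      by (rule sum.inter_filter[OF assms(1)])
    also have "\<dots> = (\<Sum>b\<in>K. if \<pi> a = \<pi> b then f a b else 0)" using a by (intro sum.cong) auto
    finally show "(\<Sum>b\<in>K. if \<pi> a = \<pi> b then f a b else 0) = (\<Sum>b\<in>{b\<in>K. \<pi> b = J}. f a b)" ..
  qed
  finally show ?thesis .
qed

definition par_class :: "nat \<Rightarrow> real poly \<Rightarrow> nat set \<Rightarrow> (nat \<Rightarrow>\<^sub>0 nat) set" where
  "par_class n s J = {a \<in> keys (subst_sum_sq n s). keys (odd_exp a) = J}"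

lemma keys_half_exp_odd_exp: "a \<in> keys (subst_sum_sq n s) \<Longrightarrow> keys (half_exp a) \<subseteq> {1..n+1} \<and> keys (odd_exp a) \<subseteq> {1..n+1}"
proof -
  assume "a \<in> keys (subst_sum_sq n s)"
  then have "keys a \<subseteq> {1..n+1}" using keys_subst_sum_sq by (fastforce simp: exponents_def)
  then show ?thesis using keys_add_nat[of "half_exp a + half_exp a" "odd_exp a"] keys_add_nat[of "half_exp a" "half_exp a"] half_exp_odd_exp[of a]
    by auto
qed

text \<open>A product of two monomials is even exactly if both have the same set \<open>J\<close> of
  odd exponents. Half of its exponent is then \<open>half_exp a + half_exp b\<close> plus one unit
  at each element of \<open>J\<close>; this is where the products of generators in the preordering
  come from.\<close>

lemma even_kernel_square:
  "even_kernel n \<phi> (s ^ 2) = (\<Sum>J\<in>Pow {1..n+1}. \<Sum>a\<in>par_class n s J. \<Sum>b\<in>par_class n s J.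
     const_mpoly (lookup (subst_sum_sq n s) a * lookup (subst_sum_sq n s) b) * \<phi> (half_exp a + half_exp b + odd_exp a))"
proof -
  let ?F = "subst_sum_sq n s" and ?K = "keys (subst_sum_sq n s)"
  let ?f = "\<lambda>a b. const_mpoly (lookup ?F a * lookup ?F b) * \<phi> (half_exp a + half_exp b + odd_exp a)"
  have "even_kernel n \<phi> (s ^ 2) = linear_ext (evenpart \<phi>) (?F * ?F)"
    by (simp add: even_kernel_linear_ext power2_eq_square subst_sum_sq_mult)
  also have "\<dots> = (\<Sum>a\<in>?K. \<Sum>b\<in>?K. const_mpoly (lookup ?F a * lookup ?F b) * evenpart \<phi> (a + b))"
    by (subst mpoly_mult_monomials) (simp add: linear_ext_sum linear_ext_single)
  also have "\<dots> = (\<Sum>a\<in>?K. \<Sum>b\<in>?K. if keys (odd_exp a) = keys (odd_exp b) then ?f a b else 0)"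
    by (intro sum.cong refl) (auto simp: evenpart_def odd_exp_add_eq_0 half_exp_add odd_exp_eq_iff[symmetric])
  also have "\<dots> = (\<Sum>J\<in>Pow {1..n+1}. \<Sum>a\<in>par_class n s J. \<Sum>b\<in>par_class n s J. ?f a b)"
    unfolding par_class_def
  proof (rule sum_pairs_partition)
    show "(\<lambda>a. keys (odd_exp a)) ` ?K \<subseteq> Pow {1..n+1}" using keys_half_exp_odd_exp[of _ n s] by blast
  qed simp_all
  finally show ?thesis .
qed

lemma even_kernel_even_class:
  "even_kernel n \<phi> s = (\<Sum>a\<in>par_class n s {}. const_mpoly (lookup (subst_sum_sq n s) a) * \<phi> (half_exp a))"
proof -
  have "even_kernel n \<phi> s = (\<Sum>a\<in>keys (subst_sum_sq n s). if keys (odd_exp a) = {} then const_mpoly (lookup (subst_sum_sq n s) a) * \<phi> (half_exp a) else 0)"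
    unfolding even_kernel_linear_ext linear_ext_def by (intro sum.cong) (auto simp: evenpart_def)
  then show ?thesis by (simp add: par_class_def sum.inter_filter[symmetric])
qed

text \<open>Each parity class contributes a square times a product of nonnegative generator values,
  and the class \<open>J = {}\<close> is the square on the left. In terms of signs: the square of a
  mean is at most the mean of the squares.\<close>

lemma kernel_at_square_ge:
  assumes x: "x \<in> std_simplex n" and y: "y \<in> std_simplex n"
  shows "(eval_mpoly (kernel_at n s x) y)\<^sup>2 \<le> eval_mpoly (kernel_at n (s ^ 2) x) y"
proof -
  let ?c = "\<lambda>i. eval_mpoly (simplex_gen n i) x * eval_mpoly (simplex_gen n i) y"
  let ?F = "lookup (subst_sum_sq n s)"
  define H where "H J = (\<Sum>a\<in>par_class n s J. ?F a * mpow ?c (half_exp a))" for J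
  define P where "P J = (\<Prod>i\<in>J. ?c i)" for J
  have "eval_mpoly (kernel_at n (s ^ 2) x) y = (\<Sum>J\<in>Pow {1..n+1}. P J * (H J)\<^sup>2)"
  proof -
    have "eval_mpoly (kernel_at n (s ^ 2) x) y = (\<Sum>J\<in>Pow {1..n+1}. \<Sum>a\<in>par_class n s J. \<Sum>b\<in>par_class n s J.
        ?F a * ?F b * (mpow ?c (half_exp a) * mpow ?c (half_exp b) * mpow ?c (odd_exp a)))"
      unfolding kernel_at_def even_kernel_square by (simp add: mpow_add)
    also have "\<dots> = (\<Sum>J\<in>Pow {1..n+1}. \<Sum>a\<in>par_class n s J. \<Sum>b\<in>par_class n s J.
        P J * ((?F a * mpow ?c (half_exp a)) * (?F b * mpow ?c (half_exp b))))"
    proof (intro sum.cong refl)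
      fix J a b assume a: "a \<in> par_class n s J"
      have "lookup (odd_exp a) i = 1" if "i \<in> keys (odd_exp a)" for i
        using that by (simp add: in_keys_iff) 
      then have "mpow ?c (odd_exp a) = P J"
        using a unfolding mpow_def P_def par_class_def by (intro prod.cong) auto
      then show "?F a * ?F b * (mpow ?c (half_exp a) * mpow ?c (half_exp b) * mpow ?c (odd_exp a)) =
        P J * ((?F a * mpow ?c (half_exp a)) * (?F b * mpow ?c (half_exp b)))" by simp
    qed
    also have "\<dots> = (\<Sum>J\<in>Pow {1..n+1}. P J * (H J)\<^sup>2)"
    proof (rule sum.cong[OF refl])
      fix J
      have "(H J)\<^sup>2 = (\<Sum>a\<in>par_class n s J. \<Sum>b\<in>par_class n s J. (?F a * mpow ?c (half_exp a)) * (?F b * mpow ?c (half_exp b)))"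
        unfolding H_def power2_eq_square by (rule sum_product)
      then show "(\<Sum>a\<in>par_class n s J. \<Sum>b\<in>par_class n s J.
          P J * ((?F a * mpow ?c (half_exp a)) * (?F b * mpow ?c (half_exp b)))) = P J * (H J)\<^sup>2"
        by (simp only: sum_distrib_left)
    qed
    finally show ?thesis .
  qed
  also have "\<dots> \<ge> (\<Sum>J\<in>{{}}. P J * (H J)\<^sup>2)"
  proof (rule sum_mono2)
    fix J assume "J \<in> Pow {1..n+1} - {{}}"
    then have "P J \<ge> 0" unfolding P_def using x y
      by (intro prod_nonneg) (auto intro!: mult_nonneg_nonneg eval_simplex_gen_nonneg)
    then show "0 \<le> P J * (H J)\<^sup>2" by simp
  qed auto
  also have "(\<Sum>J\<in>{{}}. P J * (H J)\<^sup>2) = (eval_mpoly (kernel_at n s x) y)\<^sup>2"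
    unfolding kernel_at_def even_kernel_even_class by (simp add: P_def H_def)
  finally show ?thesis .
qed

text \<open>The kernel of \<open>s\<close> squared is at most the kernel of \<open>s\<^sup>2\<close>, whose mean is \<open>Lam n 0 (s\<^sup>2)\<close>.\<close>

lemma reproducing_bound:
  assumes rep: "kernel_op n s p = p" and x: "x \<in> std_simplex n"
  shows "(eval_mpoly p x)\<^sup>2 \<le> Lam n 0 (s ^ 2) * simplex_L n (p * p)"
proof -
  have "(eval_mpoly p x)\<^sup>2 = (simplex_L n (kernel_at n s x * p))\<^sup>2"
    using eval_kernel_op[of n s p x] by (simp add: rep)
  also have "\<dots> \<le> simplex_L n (kernel_at n s x * kernel_at n s x) * simplex_L n (p * p)"
    by (rule L_Cauchy_Schwarz)
  also have "\<dots> \<le> Lam n 0 (s ^ 2) * simplex_L n (p * p)"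
  proof (rule mult_right_mono)
    show "simplex_L n (kernel_at n s x * kernel_at n s x) \<le> Lam n 0 (s ^ 2)"
      unfolding L_kernel_at[of n "s ^ 2" x, symmetric] using kernel_at_square_ge[OF x, of _ s]
      by (intro L_mono) (simp add: power2_eq_square)
    show "simplex_L n (p * p) \<ge> 0" by (rule L_nonneg) simp
  qed
  finally show ?thesis .
qed

text \<open>The Christoffel-Darboux polynomial has eigenvalue 1 on every component up to
  \<open>d\<close>, so it reproduces \<open>p\<close>; the mean of its square is the total
  dimension.\<close>

lemma Nikolskii:
  assumes n: "n \<ge> 1" and p: "p \<in> polys_upto n d" and x: "x \<in> std_simplex n"
  shows "(eval_mpoly p x)\<^sup>2 \<le> even_dim n d * simplex_L n (p * p)"
proof -
  define s where "s = jac_sum n d (\<lambda>_. 1)"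
  from orth_decomposition[OF p] obtain c where c: "\<forall>j\<le>d. c j \<in> orth_space n j" "p = (\<Sum>j\<le>d. c j)" by blast
  have "kernel_op n s p = (\<Sum>j\<le>d. c j)"
    unfolding c(2) kernel_op_sum
  proof (intro sum.cong refl)
    fix j assume j: "j \<in> {..d}"
    then have "Lam n j s = 1" using Lam_jac_sum[OF n, of j d "\<lambda>_. 1"] by (simp add: Lam_eq_jac[OF n, of j] s_def)
    then show "kernel_op n s (c j) = c j" using kernel_op_eigen[of "c j" n j s] c(1) j by simp
  qed
  then have "kernel_op n s p = p" by (simp add: c(2))
  moreover have "Lam n 0 (s ^ 2) = even_dim n d"
    unfolding s_def Lam_jac_sum_sq[OF n] by (simp add: sum_even_harm_dim)
  ultimately show ?thesis using reproducing_bound[OF _ x, of s p] by simp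
qed

section \<open>Zonal functions at a vertex and positivity\<close>

definition vertex :: "nat \<Rightarrow> nat \<Rightarrow> real" where
  "vertex n = (\<lambda>i. if i \<in> {1..n} then (if i = 1 then 1 else 0) else undefined)"

lemma vertex_simplex: "n \<ge> 1 \<Longrightarrow> vertex n \<in> std_simplex n"
  by (auto simp: std_simplex_def vertex_def PiE_def extensional_def)

text \<open>All generators except the first vanish at this vertex, so only the exponent concentrated
  at 1 survives, and its coefficient \<open>fact (2 * N) / fact (2 * N)\<close> is 1.\<close>

lemma kernel_at_vertex:
  assumes n: "n \<ge> 1"
  shows "kernel_at n q (vertex n) = (\<Sum>N\<le>degree q. const_mpoly (coeff q N) * X 1 ^ N)"
  unfolding kernel_at_def even_kernel_def
proof (intro sum.cong refl)
  fix N :: nat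
  let ?g = "\<lambda>i. eval_mpoly (simplex_gen n i) (vertex n)"
  let ?e = "single (1::nat) N"
  let ?f = "\<lambda>a. const_mpoly (coeff q N * (fact (2 * N) / multi_fact (a + a))) * mpow (\<lambda>i. const_mpoly (?g i) * simplex_gen n i) a"
  have g: "?g i = (if i = 1 then 1 else 0)" if "i \<in> {1..n+1}" for i
    using that n by (auto simp: eval_simplex_gen vertex_def)
  have e: "?e \<in> exponents n N" using n by (auto simp: exponents_def)
  have "(\<Sum>a\<in>exponents n N. ?f a) = (\<Sum>a\<in>{?e}. ?f a)"
  proof (rule sum.mono_neutral_right)
    show "\<forall>a\<in>exponents n N - {?e}. ?f a = 0"
    proof
      fix a assume a: "a \<in> exponents n N - {?e}"
      have "\<exists>i\<in>keys a. i \<noteq> 1"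
      proof (rule ccontr)
        assume "\<not> ?thesis"
        then have k: "keys a \<subseteq> {1}" by blast
        then have "lookup a 1 = N" using a mon_deg_superset[OF _ k] by (simp add: exponents_def)
        then have "a = ?e" using k by (intro poly_mapping_eqI) (auto simp: lookup_single when_def in_keys_iff)
        with a show False by simp
      qed
      then obtain i where i: "i \<in> keys a" "i \<noteq> 1" by blast
      then have "?g i = 0" using g[of i] a by (auto simp: exponents_def)
      then have "mpow (\<lambda>i. const_mpoly (?g i) * simplex_gen n i) a = 0"
        using i unfolding mpow_def by (intro prod_zero) (auto simp: in_keys_iff intro!: bexI[of _ i])
      then show "?f a = 0" by simp
    qed
  qed (use e in auto)
  also have "\<dots> = const_mpoly (coeff q N) * X 1 ^ N"
  proof -
    have "?e + ?e = single 1 (2 * N)" by (simp only: single_add[symmetric] mult_2)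
    then have "multi_fact (?e + ?e) = fact (2 * N)" by (simp only:) (simp add: multi_fact_def)
    moreover have "?g 1 = 1" using g[of 1] by simp
    moreover have "simplex_gen n 1 = X 1" using n by (simp add: simplex_gen_def)
    ultimately show ?thesis by simp
  qed
  finally show "(\<Sum>a\<in>exponents n N. ?f a) = const_mpoly (coeff q N) * X 1 ^ N" .
qed

lemma eval_kernel_at_vertex: "n \<ge> 1 \<Longrightarrow> eval_mpoly (kernel_at n q (vertex n)) x = poly q (x 1)"
  by (simp add: kernel_at_vertex poly_altdef)

text \<open>\<open>Lam n 0 q\<close> is the mean of \<open>q\<close> in the first coordinate of the
  simplex.\<close>

lemma Lam_nonneg:
  assumes n: "n \<ge> 1" and q: "\<And>t. 0 \<le> t \<Longrightarrow> t \<le> 1 \<Longrightarrow> poly q t \<ge> 0"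
  shows "Lam n 0 q \<ge> 0"
  unfolding L_kernel_at[of n q "vertex n", symmetric]
proof (rule L_nonneg)
  fix x assume x: "x \<in> std_simplex n"
  then have "0 \<le> x 1" "x 1 \<le> 1" using n std_simplex_le_1[OF x, of 1] by (auto simp: std_simplex_def)
  then show "eval_mpoly (kernel_at n q (vertex n)) x \<ge> 0" using q by (simp add: eval_kernel_at_vertex[OF n])
qed

lemma poly_jac_1: "n \<ge> 1 \<Longrightarrow> poly (jac n k) 1 = 1"
proof (induction k rule: less_induct)
  case (less k)
  show ?case
  proof (cases k)
    case (Suc j)
    then have "poly (jac n j) 1 = 1" "poly (jac n (j - 1)) 1 = 1" using less by auto
    then show ?thesis unfolding Suc jac_step[OF less.prems, of j] by simp
  qed simp
qed

text \<open>The zonal function \<open>x \<mapsto> jac n k (x\<^sub>1)\<close> lies in \<open>H\<^sub>k\<close>, since the kernel at the vertex \<open>e\<^sub>1\<close> is a function of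
  \<open>x\<^sub>1\<close> only. The reproducing bound for it is the claim.\<close>

lemma jac_le_1:
  assumes n: "n \<ge> 1" and t: "0 \<le> t" "t \<le> 1"
  shows "poly (jac n k) t \<le> 1"
proof (cases "k = 0")
  case False
  define p where "p = kernel_at n (jac n k) (vertex n)"
  define m where "m = even_harm_dim n k"
  have m: "m > 0" unfolding m_def by (rule even_harm_dim_pos[OF n])
  have pk: "p \<in> polys_upto n k"
    unfolding p_def kernel_at_vertex[OF n]
  proof (intro polys_upto_sum polys_upto_smult)
    fix N assume "N \<in> {..degree (jac n k)}"
    then have "1 * N \<le> k" using degree_jac[of n k] by simp
    moreover have "X 1 ^ N \<in> polys_upto n (1 * N)" using n by (intro polys_upto_power polys_upto_X) auto
    ultimately show "X 1 ^ N \<in> polys_upto n k" by (rule polys_upto_mono[rotated])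
  qed
  have Lp: "simplex_L n (p * g) = Lam n j (jac n k) * eval_mpoly g (vertex n)" if "g \<in> orth_space n j" for g j
    using eval_kernel_op[of n "jac n k" g "vertex n"] kernel_op_eigen[OF that, of "jac n k"] by (simp add: p_def)
  have "simplex_L n (p * g) = 0" if g: "g \<in> polys_upto n (k - 1)" for g
  proof -
    from orth_decomposition[OF g] obtain c where c: "\<forall>j\<le>k-1. c j \<in> orth_space n j" "g = (\<Sum>j\<le>k-1. c j)" by blast
    have "Lam n j (jac n k) = 0" if "j \<le> k - 1" for j
      using that False by (simp add: Lam_eq_jac[OF n, of j] jac_orthogonal[OF n])
    then show ?thesis using c(1) unfolding c(2) sum_distrib_left L_sum by (intro sum.neutral) (auto simp: Lp)
  qed
  then have pH: "p \<in> orth_space n k" using False pk by (simp add: orth_space_def simplex_inner_eq)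
  have Lk: "Lam n k (jac n k) = 1 / m"
    by (simp add: Lam_eq_jac[OF n, of k] jac_orthogonal[OF n] m_def)
  \<comment> \<open>The polynomial reproducing \<open>p\<close> has mean square \<open>m\<close>,
    while \<open>p\<close> has squared norm \<open>1 / m\<close>; the product in
    \<open>reproducing_bound\<close> is exactly 1.\<close>
  have "kernel_op n (smult m (jac n k)) p = p"
    using kernel_op_eigen[OF pH, of "smult m (jac n k)"] m by (simp add: coeff_functional_smult Lk)
  moreover have "Lam n 0 (smult m (jac n k) ^ 2) = m"
    using m by (simp add: power2_eq_square coeff_functional_smult jac_orthogonal[OF n] m_def[symmetric])
  moreover have "simplex_L n (p * p) = 1 / m"
  proof -
    have "vertex n 1 = 1" using n by (simp add: vertex_def)
    then have "eval_mpoly p (vertex n) = 1" unfolding p_def eval_kernel_at_vertex[OF n] by (simp only: poly_jac_1[OF n])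
    then show ?thesis using Lp[OF pH] by (simp add: Lk)
  qed
  moreover have x: "(\<lambda>i. if i \<in> {1..n} then (if i = 1 then t else 0) else undefined) \<in> std_simplex n" (is "?x \<in> _")
    using t by (auto simp: std_simplex_def PiE_def extensional_def)
  ultimately have "(eval_mpoly p ?x)\<^sup>2 \<le> 1" using reproducing_bound[OF _ x, of "smult m (jac n k)" p] m by simp
  then have "(poly (jac n k) t)\<^sup>2 \<le> 1" using n by (simp add: p_def eval_kernel_at_vertex[OF n])
  then show ?thesis by (simp add: abs_square_le_1 abs_le_iff)
qed simp

text \<open>Used for a normalised square, whose eigenvalues are thus at most 1, and for
  \<open>1 - v\<close> times a square, as the hypothesis of \<open>growth_bound\<close>.\<close>

lemma Lam_le_Lam_0:
  assumes n: "n \<ge> 1" and q: "\<And>t. 0 \<le> t \<Longrightarrow> t \<le> 1 \<Longrightarrow> poly q t \<ge> 0"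
  shows "Lam n k q \<le> Lam n 0 q"
proof -
  have "Lam n 0 ((1 - jac n k) * q) \<ge> 0"
    using jac_le_1[OF n, of _ k] q by (intro Lam_nonneg[OF n]) simp
  then show ?thesis by (simp add: Lam_eq_jac[OF n, of k] left_diff_distrib coeff_functional_diff)
qed

section \<open>Membership in the preordering\<close>

text \<open>Cholesky elimination: subtract the rank-one matrix that clears row \<open>x\<close>,
  then recurse on the Schur complement.\<close>

lemma psd_decomposition:
  fixes M :: "'a \<Rightarrow> 'a \<Rightarrow> real"
  assumes "finite A" and sym: "\<And>a b. a \<in> A \<Longrightarrow> b \<in> A \<Longrightarrow> M a b = M b a"
    and psd: "\<And>v. 0 \<le> (\<Sum>a\<in>A. \<Sum>b\<in>A. v a * v b * M a b)"
  shows "\<exists>vs. \<forall>a\<in>A. \<forall>b\<in>A. M a b = (\<Sum>v\<leftarrow>vs. v a * v b)"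
  using assms
proof (induction A arbitrary: M rule: finite_induct)
  case (insert x A)
  have split: "(\<Sum>a\<in>insert x A. \<Sum>b\<in>insert x A. v a * v b * M a b) =
     (v x)\<^sup>2 * M x x + 2 * v x * (\<Sum>a\<in>A. v a * M x a) + (\<Sum>a\<in>A. \<Sum>b\<in>A. v a * v b * M a b)" for v
  proof -
    have "(\<Sum>a\<in>A. v a * v x * M a x) = v x * (\<Sum>a\<in>A. v a * M x a)"
      unfolding sum_distrib_left using insert.prems(1) by (intro sum.cong) auto
    moreover have "(\<Sum>b\<in>A. v x * v b * M x b) = v x * (\<Sum>a\<in>A. v a * M x a)"
      unfolding sum_distrib_left by (intro sum.cong) auto
    ultimately show ?thesis using insert.hyps
      by (simp add: sum.distrib power2_eq_square)
  qed
  have A_eq: "(\<Sum>a\<in>A. \<Sum>b\<in>A. (v(x := t)) a * (v(x := t)) b * M' a b) = (\<Sum>a\<in>A. \<Sum>b\<in>A. v a * v b * M' a b)"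
    and A_eq1: "(\<Sum>a\<in>A. (v(x := t)) a * M x a) = (\<Sum>a\<in>A. v a * M x a)" for v t M'
    using insert.hyps by (auto intro!: sum.cong)
  have psd': "0 \<le> t\<^sup>2 * M x x + 2 * t * (\<Sum>a\<in>A. v a * M x a) + (\<Sum>a\<in>A. \<Sum>b\<in>A. v a * v b * M a b)" for v t
    using insert.prems(2)[of "v(x := t)"] unfolding split A_eq A_eq1 by simp
  have symA: "\<And>a b. a \<in> A \<Longrightarrow> b \<in> A \<Longrightarrow> M a b = M b a" using insert.prems(1) by blast
  \<comment> \<open>If \<open>M x x = 0\<close>, division by zero makes \<open>w\<close> vanish;
    this is consistent because the whole row \<open>x\<close> is then zero, by
    \<open>zero\<close>.\<close>
  define w where "w a = M x a / sqrt (M x x)" for a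
  have Mxx: "M x x \<ge> 0" using psd'[of 1 "\<lambda>_. 0"] by simp
  have w_eq: "w a * w b = M x a * M x b / M x x" for a b
    using Mxx by (simp add: w_def)
  have zero: "M x a = 0" if z: "M x x = 0" and a: "a \<in> A" for a
  proof -
    let ?v = "\<lambda>b. if b = a then 1 else 0 :: real"
    have 1: "(\<Sum>b\<in>A. ?v b * M x b) = M x a"
      using insert.hyps(1) a by (simp add: if_distrib[of "\<lambda>c. c * _"] sum.delta' cong: if_cong)
    define R where "R = (\<Sum>b\<in>A. \<Sum>c\<in>A. ?v b * ?v c * M b c)"
    have 2: "0 \<le> 2 * t * M x a + R" for t
      using psd'[of t ?v] unfolding 1 R_def z by simp
    show ?thesis
    proof (rule ccontr)
      assume "M x a \<noteq> 0"
      \<comment> \<open>At this \<open>t\<close> the right-hand side equals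
        \<open>-1\<close>.\<close>
      then show False using 2[of "- (R + 1) / (2 * M x a)"] by (simp add: field_simps)
    qed
  qed
  have "\<exists>vs. \<forall>a\<in>A. \<forall>b\<in>A. M a b - w a * w b = (\<Sum>v\<leftarrow>vs. v a * v b)"
  proof (rule insert.IH)
    show "M a b - w a * w b = M b a - w b * w a" if "a \<in> A" "b \<in> A" for a b
      using symA[OF that] by simp
    fix v
    let ?S = "\<Sum>a\<in>A. v a * M x a" and ?R = "\<Sum>a\<in>A. \<Sum>b\<in>A. v a * v b * M a b"
    have "(\<Sum>a\<in>A. \<Sum>b\<in>A. v a * v b * (M a b - w a * w b)) = ?R - (\<Sum>a\<in>A. \<Sum>b\<in>A. (v a * M x a) * (v b * M x b) / M x x)"
      unfolding w_eq right_diff_distrib sum_subtractf by (simp add: mult_ac)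
    also have "(\<Sum>a\<in>A. \<Sum>b\<in>A. (v a * M x a) * (v b * M x b) / M x x) = ?S\<^sup>2 / M x x"
      by (simp only: power2_eq_square sum_product sum_divide_distrib)
    also have "?R - ?S\<^sup>2 / M x x \<ge> 0"
    proof (cases "M x x = 0")
      case True
      then show ?thesis using psd'[of 0 v] by simp
    next
      case False
      \<comment> \<open>The chosen \<open>t\<close> minimises the quadratic.\<close>
      then show ?thesis using psd'[of "- ?S / M x x" v]
        by (simp add: power2_eq_square field_simps)
    qed
    finally show "0 \<le> (\<Sum>a\<in>A. \<Sum>b\<in>A. v a * v b * (M a b - w a * w b))" .
  qed
  then obtain vs where vs: "\<And>a b. a \<in> A \<Longrightarrow> b \<in> A \<Longrightarrow> M a b - w a * w b = (\<Sum>v\<leftarrow>vs. v a * v b)" by blast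
  have wx: "w x * w b = M x b" if "b \<in> insert x A" for b
    using that zero Mxx by (cases "M x x = 0") (auto simp: w_eq)
  show ?case
  proof (intro exI[of _ "w # map (\<lambda>v. v(x := 0)) vs"] ballI)
    fix a b assume ab: "a \<in> insert x A" "b \<in> insert x A"
    have z: "(\<Sum>v\<leftarrow>map (\<lambda>v. v(x := 0)) vs. v a * v b) = (if a = x \<or> b = x then 0 else (\<Sum>v\<leftarrow>vs. v a * v b))"
      by (induction vs) auto
    show "M a b = (\<Sum>v\<leftarrow>w # map (\<lambda>v. v(x := 0)) vs. v a * v b)"
    proof (cases "a = x \<or> b = x")
      case True
      then have "w a * w b = M a b"
        using wx ab insert.prems(1)[OF ab] by (metis mult.commute)
      then show ?thesis using True z by simp
    next
      case False
      then have "a \<in> A" "b \<in> A" using ab by auto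
      then show ?thesis using False z vs by (simp add: algebra_simps)
    qed
  qed
qed simp

lemma sum_list_sum: "(\<Sum>v\<leftarrow>vs. \<Sum>a\<in>A. f v a) = (\<Sum>a\<in>A. \<Sum>v\<leftarrow>vs. f v a :: 'b::comm_monoid_add)"
  by (induction vs) (simp_all add: sum.distrib)

lemma const_mpoly_sum_list: "const_mpoly (\<Sum>v\<leftarrow>vs. f v) = (\<Sum>v\<leftarrow>vs. const_mpoly (f v))"
  by (induction vs) (simp_all add: const_mpoly_add)

lemma mpow_odd_exp:
  "mpow g (odd_exp a) = (\<Prod>i\<in>keys (odd_exp a). g i)"
  unfolding mpow_def
proof (rule prod.cong[OF refl])
  fix i assume "i \<in> keys (odd_exp a)"
  then have "lookup a i mod 2 = 1" by (simp add: in_keys_iff)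
  then show "g i ^ lookup (odd_exp a) i = g i" by (simp only: lookup_odd_exp power_one_right)
qed

text \<open>The matrix \<open>M\<close> is positive semidefinite because its quadratic form is the
  mean of the product of the generators in \<open>J\<close>, a square and \<open>h\<close>. A Gram
  decomposition of \<open>M\<close> turns the double sum into squares times that product. Degrees
  fit since \<open>2 * mon_deg (half_exp a) + card J\<close> is the degree of
  \<open>a\<close>.\<close>

lemma par_class_term:
  assumes s: "degree s \<le> r" and h: "\<And>x. x \<in> std_simplex n \<Longrightarrow> eval_mpoly h x \<ge> 0" and J: "J \<subseteq> {1..n+1}"
  shows "\<exists>\<sigma>\<in>sos n. tot_deg (\<sigma> * (\<Prod>j\<in>J. simplex_gen n j)) \<le> 2 * r \<and>
    (\<Sum>a\<in>par_class n s J. \<Sum>b\<in>par_class n s J. const_mpoly (lookup (subst_sum_sq n s) a * lookup (subst_sum_sq n s) b) *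
      (const_mpoly (simplex_L n (mpow (simplex_gen n) (half_exp a + half_exp b + odd_exp a) * h)) *
         mpow (simplex_gen n) (half_exp a + half_exp b + odd_exp a))) = \<sigma> * (\<Prod>j\<in>J. simplex_gen n j)"
proof (cases "par_class n s J = {}")
  case True
  have "0 \<in> sos n" by (auto simp: sos_def intro!: exI[of _ "[]"])
  moreover have "tot_deg 0 = 0" by (simp add: tot_deg_def)
  ultimately show ?thesis using True by (intro bexI[of _ 0]) auto
next
  case False
  let ?F = "lookup (subst_sum_sq n s)" and ?G = "mpow (simplex_gen n)" and ?B = "par_class n s J"
  define PJ where "PJ = (\<Prod>j\<in>J. simplex_gen n j)"
  define M where "M a b = ?F a * ?F b * simplex_L n (PJ * ?G (half_exp a) * ?G (half_exp b) * h)" for a b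
  have fin: "finite ?B" by (simp add: par_class_def)
  have G: "?G (half_exp a + half_exp b + odd_exp a) = PJ * ?G (half_exp a) * ?G (half_exp b)" if "a \<in> ?B" for a b
    using that by (simp add: mpow_add mpow_odd_exp par_class_def PJ_def mult_ac)
  have "\<exists>vs. \<forall>a\<in>?B. \<forall>b\<in>?B. M a b = (\<Sum>v\<leftarrow>vs. v a * v b)"
  proof (rule psd_decomposition[OF fin])
    show "M a b = M b a" for a b unfolding M_def by (simp add: mult_ac)
    fix v
    let ?u = "\<Sum>a\<in>?B. const_mpoly (v a * ?F a) * ?G (half_exp a)"
    have "0 \<le> simplex_L n (PJ * ?u * ?u * h)"
    proof (rule L_nonneg)
      fix x assume x: "x \<in> std_simplex n"
      have "eval_mpoly PJ x \<ge> 0" unfolding PJ_def eval_prod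
        using J by (intro prod_nonneg eval_simplex_gen_nonneg[OF x]) auto
      then have "0 \<le> eval_mpoly PJ x * (eval_mpoly ?u x)\<^sup>2 * eval_mpoly h x" using h[OF x] by simp
      then show "0 \<le> eval_mpoly (PJ * ?u * ?u * h) x" by (simp only: eval_mult power2_eq_square mult.assoc)
    qed
    also have "PJ * ?u * ?u * h = (\<Sum>a\<in>?B. \<Sum>b\<in>?B. const_mpoly (v a * v b * (?F a * ?F b)) * (PJ * ?G (half_exp a) * ?G (half_exp b) * h))"
    proof -
      have "PJ * ?u * ?u * h = PJ * h * (?u * ?u)" by (simp only: mult_ac)
      also have "\<dots> = (\<Sum>a\<in>?B. \<Sum>b\<in>?B. PJ * h * ((const_mpoly (v a * ?F a) * ?G (half_exp a)) * (const_mpoly (v b * ?F b) * ?G (half_exp b))))"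
        by (simp only: sum_product) (simp only: sum_distrib_left)
      also have "\<dots> = (\<Sum>a\<in>?B. \<Sum>b\<in>?B. const_mpoly (v a * v b * (?F a * ?F b)) * (PJ * ?G (half_exp a) * ?G (half_exp b) * h))"
        by (intro sum.cong refl) (simp only: const_mpoly_mult mult_ac)
      finally show ?thesis .
    qed
    also have "simplex_L n \<dots> = (\<Sum>a\<in>?B. \<Sum>b\<in>?B. v a * v b * M a b)"
      unfolding L_sum L_const_mult M_def by (simp only: mult.assoc)
    finally show "0 \<le> (\<Sum>a\<in>?B. \<Sum>b\<in>?B. v a * v b * M a b)" .
  qed
  then obtain vs where vs: "\<And>a b. a \<in> ?B \<Longrightarrow> b \<in> ?B \<Longrightarrow> M a b = (\<Sum>v\<leftarrow>vs. v a * v b)" by blast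
  define q where "q v = (\<Sum>a\<in>?B. const_mpoly (v a) * ?G (half_exp a))" for v
  define \<sigma> where "\<sigma> = (\<Sum>p\<leftarrow>map q vs. p ^ 2)"
  have "(\<Sum>a\<in>?B. \<Sum>b\<in>?B. const_mpoly (?F a * ?F b) * (const_mpoly (simplex_L n (?G (half_exp a + half_exp b + odd_exp a) * h)) * ?G (half_exp a + half_exp b + odd_exp a)))
     = (\<Sum>a\<in>?B. \<Sum>b\<in>?B. const_mpoly (M a b) * (PJ * ?G (half_exp a) * ?G (half_exp b)))"
    by (intro sum.cong refl) (simp only: G M_def const_mpoly_mult mult.assoc)
  also have "\<dots> = (\<Sum>a\<in>?B. \<Sum>b\<in>?B. \<Sum>v\<leftarrow>vs. (const_mpoly (v a) * ?G (half_exp a)) * (const_mpoly (v b) * ?G (half_exp b)) * PJ)"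
  proof (intro sum.cong refl)
    fix a b assume "a \<in> ?B" "b \<in> ?B"
    then have "M a b = (\<Sum>v\<leftarrow>vs. v a * v b)" by (rule vs)
    then have "const_mpoly (M a b) * (PJ * ?G (half_exp a) * ?G (half_exp b)) =
      (\<Sum>v\<leftarrow>vs. const_mpoly (v a * v b) * (PJ * ?G (half_exp a) * ?G (half_exp b)))"
      by (simp only: const_mpoly_sum_list sum_list_mult_const[symmetric])
    also have "\<dots> = (\<Sum>v\<leftarrow>vs. (const_mpoly (v a) * ?G (half_exp a)) * (const_mpoly (v b) * ?G (half_exp b)) * PJ)"
      by (intro arg_cong[where f = sum_list] map_cong refl) (simp only: const_mpoly_mult mult_ac)
    finally show "const_mpoly (M a b) * (PJ * ?G (half_exp a) * ?G (half_exp b)) =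
      (\<Sum>v\<leftarrow>vs. (const_mpoly (v a) * ?G (half_exp a)) * (const_mpoly (v b) * ?G (half_exp b)) * PJ)" .
  qed
  also have "\<dots> = (\<Sum>v\<leftarrow>vs. q v ^ 2 * PJ)"
  proof -
    have "q v ^ 2 * PJ = (\<Sum>a\<in>?B. \<Sum>b\<in>?B. (const_mpoly (v a) * ?G (half_exp a)) * (const_mpoly (v b) * ?G (half_exp b)) * PJ)" for v
      unfolding q_def power2_eq_square sum_product by (simp only: sum_distrib_right)
    then show ?thesis by (simp only: sum_list_sum)
  qed
  also have "\<dots> = \<sigma> * PJ"
    unfolding \<sigma>_def by (simp add: sum_list_mult_const o_def)
  finally have eq: "(\<Sum>a\<in>?B. \<Sum>b\<in>?B. const_mpoly (?F a * ?F b) * (const_mpoly (simplex_L n (?G (half_exp a + half_exp b + odd_exp a) * h)) * ?G (half_exp a + half_exp b + odd_exp a)))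
     = \<sigma> * PJ" .
  have deg: "2 * mon_deg (half_exp a) + card J \<le> 2 * r \<and> keys (half_exp a) \<subseteq> {1..n+1}" if a: "a \<in> ?B" for a
  proof -
    have aK: "a \<in> keys (subst_sum_sq n s)" using a by (simp add: par_class_def)
    then obtain N where "N \<le> degree s" "a \<in> exponents n (2 * N)" using keys_subst_sum_sq by blast
    then have "mon_deg a \<le> 2 * r" using s by (simp add: exponents_def)
    moreover have "mon_deg a = mon_deg (half_exp a) + mon_deg (half_exp a) + mon_deg (odd_exp a)"
      by (simp only: mon_deg_add[symmetric] half_exp_odd_exp)
    moreover have "mon_deg (odd_exp a) = card J"
    proof -
      have "mon_deg (odd_exp a) = (\<Sum>i\<in>keys (odd_exp a). 1)"
        unfolding mon_deg_def
      proof (rule sum.cong[OF refl])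
        fix i assume "i \<in> keys (odd_exp a)"
        then show "lookup (odd_exp a) i = 1" by (simp add: in_keys_iff)
      qed
      then show ?thesis using a by (simp add: par_class_def)
    qed
    ultimately show ?thesis using keys_half_exp_odd_exp[OF aK] by simp
  qed
  \<comment> \<open>The degree left for each square. As the class is nonempty,
    \<open>card J \<le> 2 * r\<close>, so the subtraction does not truncate.\<close>
  define l where "l = (2 * r - card J) div 2"
  have l: "2 * l + card J \<le> 2 * r" using deg False by (fastforce simp: l_def)
  have ql: "q v \<in> polys_upto n l" for v
    unfolding q_def
  proof (intro polys_upto_sum polys_upto_smult)
    fix a assume "a \<in> ?B"
    from deg[OF this] have "mon_deg (half_exp a) \<le> l" "keys (half_exp a) \<subseteq> {1..n+1}" by (auto simp: l_def)
    then show "?G (half_exp a) \<in> polys_upto n l" using polys_upto_mpow polys_upto_mono by blast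
  qed
  have "\<sigma> \<in> polys_upto n (2 * l)"
    unfolding \<sigma>_def
  proof (induction vs)
    case (Cons v vs)
    have "q v ^ 2 \<in> polys_upto n (2 * l)" using polys_upto_power[OF ql, of v 2] by (simp add: mult.commute)
    then show ?case using Cons by (simp add: polys_upto_add)
  qed simp
  moreover have "PJ \<in> polys_upto n (card J)"
  proof -
    have "PJ \<in> polys_upto n (\<Sum>j\<in>J. 1)" unfolding PJ_def
      using J by (intro polys_upto_prod polys_upto_simplex_gen) auto
    then show ?thesis by simp
  qed
  ultimately have "\<sigma> * PJ \<in> polys_upto n (2 * r)"
    using l polys_upto_mult polys_upto_mono by blast
  moreover have "\<sigma> \<in> sos n"
    unfolding sos_def using polys_upto_polys[OF ql] by (auto simp: \<sigma>_def intro!: exI[of _ "map q vs"])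
  ultimately show ?thesis using eq by (intro bexI[of _ \<sigma>]) (auto simp: PJ_def polys_upto_def)
qed

lemma kernel_op_square_preorder:
  assumes "degree s \<le> r" "\<And>x. x \<in> std_simplex n \<Longrightarrow> eval_mpoly h x \<ge> 0"
  shows "kernel_op n (s ^ 2) h \<in> simplex_preorder n (2 * r)"
proof -
  from par_class_term[OF assms]
  have "\<forall>J\<in>Pow {1..n+1}. \<exists>\<sigma>. \<sigma> \<in> sos n \<and> tot_deg (\<sigma> * (\<Prod>j\<in>J. simplex_gen n j)) \<le> 2 * r \<and>
    (\<Sum>a\<in>par_class n s J. \<Sum>b\<in>par_class n s J. const_mpoly (lookup (subst_sum_sq n s) a * lookup (subst_sum_sq n s) b) *
      (const_mpoly (simplex_L n (mpow (simplex_gen n) (half_exp a + half_exp b + odd_exp a) * h)) *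
         mpow (simplex_gen n) (half_exp a + half_exp b + odd_exp a))) = \<sigma> * (\<Prod>j\<in>J. simplex_gen n j)"
    by blast
  from bchoice[OF this] obtain \<sigma> where \<sigma>: "\<forall>J\<in>Pow {1..n+1}. \<sigma> J \<in> sos n \<and> tot_deg (\<sigma> J * (\<Prod>j\<in>J. simplex_gen n j)) \<le> 2 * r \<and>
    (\<Sum>a\<in>par_class n s J. \<Sum>b\<in>par_class n s J. const_mpoly (lookup (subst_sum_sq n s) a * lookup (subst_sum_sq n s) b) *
      (const_mpoly (simplex_L n (mpow (simplex_gen n) (half_exp a + half_exp b + odd_exp a) * h)) *
         mpow (simplex_gen n) (half_exp a + half_exp b + odd_exp a))) = \<sigma> J * (\<Prod>j\<in>J. simplex_gen n j)" ..
  have "kernel_op n (s ^ 2) h = (\<Sum>J\<in>Pow {1..n+1}. \<sigma> J * (\<Prod>j\<in>J. simplex_gen n j))"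
    unfolding kernel_op_def even_kernel_square using \<sigma> by (intro sum.cong) auto
  then show ?thesis unfolding simplex_preorder_def using \<sigma> by blast
qed

lemma preorder_nonneg:
  assumes "p \<in> simplex_preorder n k" and x: "x \<in> std_simplex n"
  shows "eval_mpoly p x \<ge> 0"
proof -
  have sos: "eval_mpoly q x \<ge> 0" if "q \<in> sos n" for q
  proof -
    from that obtain qs where q: "q = (\<Sum>q\<leftarrow>qs. q ^ 2)" by (auto simp: sos_def)
    show ?thesis unfolding q by (induction qs) auto
  qed
  from assms(1) obtain \<sigma> where p: "p = (\<Sum>J\<in>Pow {1..n+1}. \<sigma> J * (\<Prod>j\<in>J. simplex_gen n j))"
    and \<sigma>: "\<forall>J\<in>Pow {1..n+1}. \<sigma> J \<in> sos n" unfolding simplex_preorder_def by blast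
  show ?thesis unfolding p eval_sum eval_mult eval_prod
  proof (intro sum_nonneg mult_nonneg_nonneg prod_nonneg)
    fix J j assume J: "J \<in> Pow {1..n+1}"
    then show "0 \<le> eval_mpoly (\<sigma> J) x" using \<sigma> sos by blast
    assume "j \<in> J"
    with J show "0 \<le> eval_mpoly (simplex_gen n j) x" by (intro eval_simplex_gen_nonneg[OF x]) auto
  qed
qed

section \<open>Sup norms and the constant gamma\<close>

lemma abs_eval_le:
  assumes "n \<ge> 1" "p \<in> polys_upto n d" "x \<in> std_simplex n"
  shows "\<bar>eval_mpoly p x\<bar> \<le> sqrt (even_dim n d * simplex_L n (p * p))"
  using Nikolskii[OF assms] real_le_rsqrt[of "\<bar>eval_mpoly p x\<bar>"] by simp

lemma bdd_abs_eval:
  "n \<ge> 1 \<Longrightarrow> p \<in> polys_upto n d \<Longrightarrow> bdd_above ((\<lambda>x. \<bar>eval_mpoly p x\<bar>) ` std_simplex n)"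
  using abs_eval_le by (intro bdd_aboveI2) blast

lemma eval_le_norm:
  "n \<ge> 1 \<Longrightarrow> p \<in> polys_upto n d \<Longrightarrow> x \<in> std_simplex n \<Longrightarrow> \<bar>eval_mpoly p x\<bar> \<le> simplex_norm n p"
  unfolding simplex_norm_def by (intro cSUP_upper bdd_abs_eval)

lemma simplex_norm_nonneg: "n \<ge> 1 \<Longrightarrow> p \<in> polys_upto n d \<Longrightarrow> simplex_norm n p \<ge> 0"
  using eval_le_norm[OF _ _ vertex_simplex, of n p d] by (meson abs_ge_zero order_trans)

lemma simplex_norm_le:
  "n \<ge> 1 \<Longrightarrow> (\<And>x. x \<in> std_simplex n \<Longrightarrow> \<bar>eval_mpoly p x\<bar> \<le> B) \<Longrightarrow> simplex_norm n p \<le> B"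
  unfolding simplex_norm_def using vertex_simplex by (intro cSUP_least) auto

lemma L_square_le_norm:
  assumes "n \<ge> 1" "p \<in> polys_upto n d"
  shows "simplex_L n (p * p) \<le> (simplex_norm n p)\<^sup>2"
proof -
  have "simplex_L n (p * p) \<le> simplex_L n (const_mpoly ((simplex_norm n p)\<^sup>2))"
  proof (rule L_mono)
    fix x assume "x \<in> std_simplex n"
    then have "\<bar>eval_mpoly p x\<bar> \<le> simplex_norm n p" using assms by (intro eval_le_norm)
    then have "\<bar>eval_mpoly p x\<bar>\<^sup>2 \<le> (simplex_norm n p)\<^sup>2" by (intro power_mono) auto
    then show "eval_mpoly (p * p) x \<le> eval_mpoly (const_mpoly ((simplex_norm n p)\<^sup>2)) x"
      by (simp add: power2_eq_square)
  qed
  then show ?thesis by simp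
qed

lemma simplex_norm_pos:
  assumes "n \<ge> 1" "p \<in> polys_upto n d" "p \<noteq> 0"
  shows "simplex_norm n p > 0"
proof -
  have "simplex_L n (p * p) \<noteq> 0" using L_square_eq_0[OF assms(2)] assms(3) by blast
  moreover have "simplex_L n (p * p) \<ge> 0" by (rule L_nonneg) simp
  ultimately have "(simplex_norm n p)\<^sup>2 > 0" using L_square_le_norm[OF assms(1,2)] by linarith
  then show ?thesis using simplex_norm_nonneg[OF assms(1,2)] by (simp add: less_le)
qed

lemma even_dim_ge_1: "even_dim n d \<ge> 1"
  unfolding even_dim_def by (simp add: Suc_le_eq)

lemma orth_space_pairwise:
  assumes "p \<in> orth_space n i" "q \<in> orth_space n j" "i \<noteq> j"
  shows "simplex_L n (p * q) = 0"
proof -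
  have *: "simplex_L n (p * q) = 0" if "p \<in> orth_space n i" "q \<in> orth_space n j" "j < i" for p q i j
    using orth_space_orth[OF that(1), of q] polys_upto_mono[OF orth_space_polys_upto[OF that(2)], of "i - 1"] that(3) by simp
  show ?thesis
  proof (cases "j < i")
    case True
    then show ?thesis using *[OF assms(1,2)] by simp
  next
    case False
    then have "simplex_L n (q * p) = 0" using *[OF assms(2,1)] assms(3) by simp
    then show ?thesis by (simp only: mult.commute)
  qed
qed

text \<open>Orthogonality gives \<open>L2(c k) \<le> L2(p)\<close>, the sup norm dominates the L2
  norm for \<open>p\<close>, and \<open>Nikolskii\<close> returns to the sup norm for
  \<open>c k\<close>. As \<open>even_dim\<close> is at least 1, it may replace its own square
  root.\<close>

lemma component_norm_le:
  assumes n: "n \<ge> 1" and p: "p \<in> polys_upto n d" and c: "\<forall>j\<le>d. c j \<in> orth_space n j" "p = (\<Sum>j\<le>d. c j)" and k: "k \<le> d"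
  shows "simplex_norm n (c k) \<le> even_dim n d * simplex_norm n p"
proof (rule simplex_norm_le[OF n])
  fix x assume x: "x \<in> std_simplex n"
  have ck: "c k \<in> polys_upto n d"
    using c(1) k polys_upto_mono[OF orth_space_polys_upto] by blast
  have "simplex_L n (c k * c k) = simplex_L n (c k * p)"
    unfolding c(2) sum_distrib_left L_sum
    using orth_space_pairwise[of "c k" n k] c(1) k by (subst sum.remove[of _ k]) (auto intro!: sum.neutral)
  then have "(simplex_L n (c k * c k))\<^sup>2 \<le> simplex_L n (c k * c k) * simplex_L n (p * p)"
    using L_Cauchy_Schwarz[of n "c k" p] by simp
  moreover have "simplex_L n (c k * c k) \<ge> 0" by (rule L_nonneg) simp
  moreover have "simplex_L n (p * p) \<ge> 0" by (rule L_nonneg) simp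
  ultimately have "simplex_L n (c k * c k) \<le> simplex_L n (p * p)"
    by (cases "simplex_L n (c k * c k) = 0") (auto simp: power2_eq_square mult_le_cancel_left)
  then have "simplex_L n (c k * c k) \<le> (simplex_norm n p)\<^sup>2"
    using L_square_le_norm[OF n p] by linarith
  then have "(eval_mpoly (c k) x)\<^sup>2 \<le> even_dim n d * (simplex_norm n p)\<^sup>2"
    using Nikolskii[OF n ck x] even_dim_pos[of n d] by (meson mult_left_mono less_imp_le order_trans)
  also have "\<dots> \<le> (even_dim n d)\<^sup>2 * (simplex_norm n p)\<^sup>2"
    using even_dim_ge_1[of n d] by (intro mult_right_mono) (auto simp: power2_eq_square)
  also have "\<dots> = (even_dim n d * simplex_norm n p)\<^sup>2" by (simp add: power_mult_distrib)
  finally have "\<bar>eval_mpoly (c k) x\<bar> \<le> \<bar>even_dim n d * simplex_norm n p\<bar>"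
    by (simp only: abs_le_square_iff)
  then show "\<bar>eval_mpoly (c k) x\<bar> \<le> even_dim n d * simplex_norm n p"
    using simplex_norm_nonneg[OF n p] even_dim_pos[of n d] by simp
qed

definition gamma_set :: "nat \<Rightarrow> nat \<Rightarrow> real set" where
  "gamma_set n d = {simplex_norm n (c k) / simplex_norm n p | p c k.
            p \<in> polys_upto n d \<and> p \<noteq> 0 \<and>
            (\<forall>j\<le>d. c j \<in> orth_space n j) \<and> p = (\<Sum>j\<le>d. c j) \<and> k \<le> d}"

lemma gamma_set_le: "n \<ge> 1 \<Longrightarrow> t \<in> gamma_set n d \<Longrightarrow> t \<le> even_dim n d"
proof -
  assume n: "n \<ge> 1" and "t \<in> gamma_set n d"
  then obtain p c k where t: "t = simplex_norm n (c k) / simplex_norm n p" and p: "p \<in> polys_upto n d" "p \<noteq> 0"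
    and c: "\<forall>j\<le>d. c j \<in> orth_space n j" "p = (\<Sum>j\<le>d. c j)" "k \<le> d" unfolding gamma_set_def by blast
  show "t \<le> even_dim n d" unfolding t
    using component_norm_le[OF n p(1) c] simplex_norm_pos[OF n p] by (simp add: divide_le_eq)
qed

lemma orth_space_0 [simp]: "0 \<in> orth_space n j"
proof (cases "j = 0")
  case True
  then show ?thesis using const_mpoly_0 by (simp only: orth_space_def) (metis rangeI)
qed (simp add: orth_space_def simplex_inner_eq)

lemma gamma_set_nonneg_elem: "n \<ge> 1 \<Longrightarrow> \<exists>t\<in>gamma_set n d. t \<ge> 0"
proof -
  assume n: "n \<ge> 1"
  let ?c = "\<lambda>j::nat. if j = 0 then 1 else 0 :: mpoly"
  have "simplex_norm n (?c 0) / simplex_norm n 1 \<in> gamma_set n d"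
    unfolding gamma_set_def
  proof (intro CollectI exI conjI)
    show "\<forall>j\<le>d. ?c j \<in> orth_space n j" using orth_space_1 by simp
  qed auto
  moreover have "simplex_norm n (?c 0) / simplex_norm n 1 \<ge> 0"
    using simplex_norm_nonneg[OF n polys_upto_1[of n 0]] by simp
  ultimately show ?thesis by blast
qed

lemma gamma_simplex_eq: "gamma_simplex n d = Sup (gamma_set n d)"
  by (simp only: gamma_simplex_def gamma_set_def)

lemma gamma_simplex_le: "n \<ge> 1 \<Longrightarrow> gamma_simplex n d \<le> even_dim n d"
  proof -
  assume n: "n \<ge> 1"
  from gamma_set_nonneg_elem[OF n] have "gamma_set n d \<noteq> {}" by blast
  then show ?thesis unfolding gamma_simplex_eq by (rule cSup_least) (rule gamma_set_le[OF n])
qed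

lemma gamma_set_le_gamma: "n \<ge> 1 \<Longrightarrow> t \<in> gamma_set n d \<Longrightarrow> t \<le> gamma_simplex n d"
  unfolding gamma_simplex_eq by (rule cSup_upper) (auto simp: bdd_above_def intro!: exI[of _ "even_dim n d"] gamma_set_le)

lemma gamma_simplex_nonneg: "n \<ge> 1 \<Longrightarrow> gamma_simplex n d \<ge> 0"
  by (metis gamma_set_nonneg_elem gamma_set_le_gamma order_trans)

lemma component_norm_le_gamma:
  assumes n: "n \<ge> 1" and p: "p \<in> polys_upto n d" "p \<noteq> 0" and c: "\<forall>j\<le>d. c j \<in> orth_space n j" "p = (\<Sum>j\<le>d. c j)" and k: "k \<le> d"
  shows "simplex_norm n (c k) \<le> gamma_simplex n d * simplex_norm n p"
proof -
  have "simplex_norm n (c k) / simplex_norm n p \<in> gamma_set n d"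
    unfolding gamma_set_def using p c k by blast
  from gamma_set_le_gamma[OF n this] show ?thesis
    using simplex_norm_pos[OF n p] by (simp add: divide_le_eq)
qed

section \<open>Convergence rate\<close>

text \<open>Normalised so that the operator of its square fixes constants, that is, its scalar on
  \<open>H_0\<close> is 1.\<close>

definition jackson :: "nat \<Rightarrow> nat \<Rightarrow> real poly" where
  "jackson n r = (let s = jac_sum n r (jackson_coeff n r) in smult (1 / sqrt (Lam n 0 (s ^ 2))) s)"

lemma degree_jackson: "degree (jackson n r) \<le> r"
  unfolding jackson_def Let_def using degree_jac_sum by (rule order_trans[OF degree_smult_le])

lemma jackson_props:
  assumes n: "n \<ge> 1" and r: "r \<ge> 1"
  shows "Lam n 0 (jackson n r ^ 2) = 1"
    and "Lam n 0 ([:1, -1:] * jackson n r ^ 2) \<le> 5 * real n ^ 2 / (8 * real r ^ 2)"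
proof -
  define s where "s = jac_sum n r (jackson_coeff n r)"
  define A where "A = Lam n 0 (s ^ 2)"
  define H where "H = Lam n 0 ([:1, -1:] * s ^ 2)"
  have phi0: "jackson_coeff n r (Suc r) = 0" by (simp add: jackson_coeff_def algebra_simps)
  have A_sum: "A = (\<Sum>j\<le>r. even_harm_dim n j * jackson_coeff n r j ^ 2)"
    unfolding A_def s_def by (rule Lam_jac_sum_sq[OF n])
  have "A \<ge> even_harm_dim n 0 * jackson_coeff n r 0 ^ 2"
    unfolding A_sum using even_harm_dim_pos[OF n] by (intro member_le_sum) (auto simp: less_imp_le)
  moreover have "jackson_coeff n r 0 > 0" unfolding jackson_coeff_def by (simp add: mult_pos_pos add_pos_nonneg)
  ultimately have A: "A > 0" using even_harm_dim_pos[OF n, of 0] by (meson less_le_trans mult_pos_pos zero_less_power)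
  have sq: "jackson n r ^ 2 = smult (1 / A) (s ^ 2)"
  proof -
    have "jackson n r = smult (1 / sqrt A) s" by (simp only: jackson_def Let_def s_def A_def)
    then show ?thesis using A by (simp add: power2_eq_square)
  qed
  show "Lam n 0 (jackson n r ^ 2) = 1"
    unfolding sq coeff_functional_smult A_def[symmetric] using A by simp
  have "real n * (real n + 4) * A = (4 * (real r + 1) * (2 * real r + real n + 1) + real n * (real n + 1)) * H"
    using sum_even_harm_dim_jackson_coeff[of n r] unfolding A_sum H_def s_def Lam_jac_sum_sq_energy[of n "jackson_coeff n r" r, OF n phi0] .
  moreover have "H \<ge> 0" unfolding H_def
    by (rule Lam_nonneg[OF n]) (simp add: mult_left_le_one_le)
  \<comment> \<open>The fraction 5/8 comes from this bound and
    \<open>n * (n + 4) \<le> 5 * n ^ 2\<close>, which holds for \<open>n \<ge> 1\<close>.\<close>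
  moreover have "8 * real r ^ 2 \<le> 4 * (real r + 1) * (2 * real r + real n + 1) + real n * (real n + 1)"
    by (simp add: algebra_simps power2_eq_square)
  ultimately have "8 * real r ^ 2 * H \<le> real n * (real n + 4) * A"
    by (simp add: mult_right_mono)
  also have "\<dots> \<le> 5 * real n ^ 2 * A"
    using A n by (intro mult_right_mono) (auto simp: power2_eq_square)
  finally have "H / A \<le> 5 * real n ^ 2 / (8 * real r ^ 2)"
    using A r by (simp add: field_simps)
  moreover have "Lam n 0 ([:1, -1:] * jackson n r ^ 2) = H / A"
    unfolding sq H_def mult_smult_right coeff_functional_smult by simp
  ultimately show "Lam n 0 ([:1, -1:] * jackson n r ^ 2) \<le> 5 * real n ^ 2 / (8 * real r ^ 2)" by simp
qed

text \<open>With \<open>z = k^2 * n^2 / r^2\<close> the growth bound gives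
  \<open>1 - l \<le> 5/4 * z\<close>. The condition on \<open>r\<close> gives
  \<open>z \<le> 1/4\<close>, hence \<open>l \<ge> 11/16\<close>; and \<open>5/4\<close> is at most
  \<open>2 * 11/16\<close>, so dividing by \<open>l\<close> leaves at most
  \<open>2 * z\<close>.\<close>

lemma jackson_eigenvalue:
  assumes n: "n \<ge> 1" and d: "d \<ge> 1" and r: "real r \<ge> 2 * real n * real d * sqrt (real d)" and k: "k \<le> d"
  defines "l \<equiv> Lam n k (jackson n r ^ 2)"
  shows "l > 0" "1 / l - 1 \<ge> 0" "1 / l - 1 \<le> 2 * real k ^ 2 * real n ^ 2 / real r ^ 2"
proof -
  have pos: "2 * real n * real d * sqrt (real d) > 0" using n d by simp
  then have r0: "real r > 0" using r by linarith
  then have r1: "r \<ge> 1" by simp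
  have q0: "poly (jackson n r ^ 2) t \<ge> 0" for t by simp
  have q1: "poly ([:1, -1:] * jackson n r ^ 2) t \<ge> 0" if "0 \<le> t" "t \<le> 1" for t
    using that by (simp add: mult_left_le_one_le)
  define H where "H = Lam n 0 ([:1, -1:] * jackson n r ^ 2)"
  have H: "H \<le> 5 * real n ^ 2 / (8 * real r ^ 2)" unfolding H_def by (rule jackson_props(2)[OF n r1])
  have H0: "H \<ge> 0" unfolding H_def by (rule Lam_nonneg[OF n q1])
  have l1: "l \<le> 1"
    unfolding l_def using Lam_le_Lam_0[OF n, of "jackson n r ^ 2" k] q0 jackson_props(1)[OF n r1] by simp
  define z where "z = real k ^ 2 * real n ^ 2 / real r ^ 2"
  have "Lam n 0 (jackson n r ^ 2) - l \<le> real k * (2 * real k + real n - 1) / real n * H"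
    unfolding l_def H_def
  proof (rule growth_bound[OF n])
    show "Lam n j ([:1, -1:] * jackson n r ^ 2) \<le> Lam n 0 ([:1, -1:] * jackson n r ^ 2)" for j
      by (rule Lam_le_Lam_0[OF n q1])
  qed
  also have "real k * (2 * real k + real n - 1) / real n * H \<le> 2 * real k ^ 2 * H"
  proof (rule mult_right_mono[OF _ H0])
    have "real k * (2 * real k + real n - 1) \<le> real k * (2 * real k * real n)"
    proof (cases "k = 0")
      case False
      have "0 \<le> (real n - 1) * (2 * real k - 1)" using n False by (intro mult_nonneg_nonneg) auto
      then have "2 * real k + real n - 1 \<le> 2 * real k * real n" by (simp add: algebra_simps)
      then show ?thesis by (intro mult_left_mono) auto
    qed simp
    then show "real k * (2 * real k + real n - 1) / real n \<le> 2 * real k ^ 2"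
      using n by (simp add: divide_le_eq power2_eq_square mult_ac)
  qed
  also have "\<dots> \<le> 2 * real k ^ 2 * (5 * real n ^ 2 / (8 * real r ^ 2))"
    using H by (intro mult_left_mono) auto
  also have "\<dots> = 5/4 * z" by (simp add: z_def)
  finally have gap: "1 - l \<le> 5/4 * z" unfolding jackson_props(1)[OF n r1] .
  have "z \<le> 1/4"
  proof -
    have "(2 * real n * real d * sqrt (real d)) ^ 2 \<le> real r ^ 2" using r pos by (intro power_mono) auto
    also have "(2 * real n * real d * sqrt (real d)) ^ 2 = 4 * real n ^ 2 * (real d ^ 2 * real d)"
      by (simp add: power_mult_distrib)
    also have "real d ^ 2 * real d = real d ^ 3" by (simp add: power3_eq_cube power2_eq_square)
    finally have "4 * real n ^ 2 * real d ^ 3 \<le> real r ^ 2" .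
    moreover have "real k ^ 2 * real n ^ 2 \<le> real n ^ 2 * real d ^ 3"
    proof -
      have "real k ^ 2 \<le> real d ^ 2" using k by (intro power_mono) auto
      also have "\<dots> \<le> real d ^ 3" using d by (intro power_increasing) auto
      finally have "real k ^ 2 * real n ^ 2 \<le> real d ^ 3 * real n ^ 2" by (rule mult_right_mono) simp
      then show ?thesis by (simp only: mult.commute[of "real n ^ 2"])
    qed
    ultimately have "4 * (real k ^ 2 * real n ^ 2) \<le> real r ^ 2" by linarith
    then show ?thesis using r0 by (simp add: z_def divide_le_eq)
  qed
  then have l2: "l \<ge> 11/16" using gap by linarith
  then show "l > 0" by linarith
  then show "1 / l - 1 \<ge> 0" using l1 by (simp add: le_divide_eq)
  have z0: "z \<ge> 0" by (simp add: z_def)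
  have "1 - l \<le> 2 * z * (11/16)" using gap z0 by linarith
  also have "\<dots> \<le> 2 * z * l" using l2 z0 by (intro mult_left_mono) auto
  finally have "(1 - l) / l \<le> 2 * z" using \<open>l > 0\<close> by (simp add: divide_le_eq)
  moreover have "(1 - l) / l = 1 / l - 1" using \<open>l > 0\<close> by (simp add: diff_divide_distrib)
  moreover have "2 * z = 2 * real k ^ 2 * real n ^ 2 / real r ^ 2" by (simp add: z_def)
  ultimately show "1 / l - 1 \<le> 2 * real k ^ 2 * real n ^ 2 / real r ^ 2" by linarith
qed

lemma sum_squares_le_cube: "(\<Sum>k\<le>d. real k ^ 2) \<le> real d ^ 3"
proof (induction d)
  case (Suc d)
  have "real d ^ 3 + (real d + 1) ^ 2 \<le> (real d + 1) ^ 3"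
    by (simp add: power3_eq_cube power2_eq_square algebra_simps)
  then show ?case using Suc.IH by (simp add: add.commute)
qed simp

lemma simplex_bound:
  assumes n: "n \<ge> 1" and d: "d \<ge> 1" and f: "f \<in> polys n" "tot_deg f = d"
    and r: "real r \<ge> 2 * real n * real d * sqrt (real d)"
  shows "f_min n f - lb_simplex n f r \<le> C_simplex n d / real r ^ 2 * (f_max n f - f_min n f)"
proof -
  define m M where "m = f_min n f" and "M = f_max n f"
  have fd: "f \<in> polys_upto n d" using f by (simp add: polys_upto_def)
  obtain B where B: "\<And>x. x \<in> std_simplex n \<Longrightarrow> \<bar>eval_mpoly f x\<bar> \<le> B"
    using abs_eval_le[OF n fd] by blast
  have m: "m \<le> eval_mpoly f x" if "x \<in> std_simplex n" for x
    unfolding m_def f_min_def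
  proof (rule cINF_lower[OF _ that])
    show "bdd_below (eval_mpoly f ` std_simplex n)"
    proof (rule bdd_belowI2[of _ "- B"])
      fix x assume "x \<in> std_simplex n"
      from B[OF this] show "- B \<le> eval_mpoly f x" by (simp add: abs_le_iff)
    qed
  qed
  have M: "eval_mpoly f x \<le> M" if "x \<in> std_simplex n" for x
    unfolding M_def f_max_def
  proof (rule cSUP_upper[OF that])
    show "bdd_above (eval_mpoly f ` std_simplex n)"
    proof (rule bdd_aboveI2[of _ _ "B"])
      fix x assume "x \<in> std_simplex n"
      from B[OF this] show "eval_mpoly f x \<le> B" by (simp add: abs_le_iff)
    qed
  qed
  define g where "g = f - const_mpoly m"
  have gd: "g \<in> polys_upto n d" unfolding g_def by (intro polys_upto_diff fd polys_upto_const)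
  \<comment> \<open>The supremum in gamma runs over nonzero polynomials; \<open>g = 0\<close> would
    make \<open>f\<close> constant, against \<open>d \<ge> 1\<close>.\<close>
  have g0: "g \<noteq> 0"
  proof
    assume "g = 0"
    then have "f \<in> polys_upto n 0" by (simp add: g_def)
    then show False using f(2) d by (simp add: polys_upto_def)
  qed
  from orth_decomposition[OF gd] obtain c where c: "\<forall>j\<le>d. c j \<in> orth_space n j" "g = (\<Sum>j\<le>d. c j)" by blast
  define G where "G = gamma_simplex n d"
  have G: "G \<ge> 0" unfolding G_def by (rule gamma_simplex_nonneg[OF n])
  have MM: "M - m \<ge> 0" using m[OF vertex_simplex[OF n]] M[OF vertex_simplex[OF n]] by linarith
  have gnorm: "simplex_norm n g \<le> M - m"
  proof (rule simplex_norm_le[OF n])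
    fix x assume x: "x \<in> std_simplex n"
    show "\<bar>eval_mpoly g x\<bar> \<le> M - m" using m[OF x] M[OF x] by (simp add: g_def)
  qed
  have cb: "\<bar>eval_mpoly (c j) x\<bar> \<le> G * (M - m)" if j: "j \<le> d" and x: "x \<in> std_simplex n" for j x
  proof -
    have "\<bar>eval_mpoly (c j) x\<bar> \<le> simplex_norm n (c j)"
      using c(1) j orth_space_polys_upto by (intro eval_le_norm[OF n _ x]) blast
    also have "\<dots> \<le> G * simplex_norm n g" unfolding G_def by (rule component_norm_le_gamma[OF n gd g0 c j])
    also have "\<dots> \<le> G * (M - m)" using gnorm G by (rule mult_left_mono)
    finally show ?thesis .
  qed
  let ?s = "jackson n r"
  define l where "l j = Lam n j (?s ^ 2)" for j
  have l: "l j > 0" "1 / l j - 1 \<ge> 0" "1 / l j - 1 \<le> 2 * real j ^ 2 * real n ^ 2 / real r ^ 2" if "j \<le> d" for j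
    using jackson_eigenvalue[OF n d r that] by (simp_all add: l_def)
  have r1: "r \<ge> 1"
  proof -
    have "2 * real n * real d * sqrt (real d) > 0" using n d by simp
    then show ?thesis using r by (cases r) auto
  qed
  have l0: "l 0 = 1" unfolding l_def by (rule jackson_props(1)[OF n r1])
  \<comment> \<open>The worst total change of \<open>g\<close> when every component is divided by
    its eigenvalue: the sum over \<open>j\<close> of \<open>2 * j^2 * n^2 / r^2\<close> times the
    common bound \<open>G * (M - m)\<close>, with the sum of squares bounded by
    \<open>d ^ 3\<close>.\<close>
  define e where "e = 2 * real n ^ 2 * real d ^ 3 / real r ^ 2 * (G * (M - m))"
  define h where "h = (\<Sum>j\<le>d. const_mpoly (1 / l j) * c j) + const_mpoly e"
  have const0: "const_mpoly e \<in> orth_space n 0" by (simp add: orth_space_def)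
  have "kernel_op n (?s ^ 2) h = g + const_mpoly e"
  proof -
    have "kernel_op n (?s ^ 2) h = (\<Sum>j\<le>d. kernel_op n (?s ^ 2) (const_mpoly (1 / l j) * c j)) + kernel_op n (?s ^ 2) (const_mpoly e)"
      unfolding h_def kernel_op_sum[symmetric] by (simp add: kernel_op_multinomial_op multinomial_op_add distrib_left sum.distrib)
    also have "kernel_op n (?s ^ 2) (const_mpoly e) = const_mpoly e"
      using kernel_op_eigen[OF const0, of "?s ^ 2"] l0 by (simp add: l_def)
    also have "(\<Sum>j\<le>d. kernel_op n (?s ^ 2) (const_mpoly (1 / l j) * c j)) = (\<Sum>j\<le>d. c j)"
    proof (rule sum.cong[OF refl])
      fix j assume j: "j \<in> {..d}"
      have "kernel_op n (?s ^ 2) (const_mpoly (1 / l j) * c j) = const_mpoly (1 / l j) * kernel_op n (?s ^ 2) (c j)"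
        unfolding kernel_op_multinomial_op multinomial_op_smult sum_distrib_left by (intro sum.cong refl) (simp only: mult_ac)
      also have "kernel_op n (?s ^ 2) (c j) = const_mpoly (l j) * c j"
        unfolding l_def by (rule kernel_op_eigen) (use c(1) j in auto)
      also have "const_mpoly (1 / l j) * (const_mpoly (l j) * c j) = c j"
        using l(1)[of j] j by (simp add: mult.assoc[symmetric] const_mpoly_mult[symmetric])
      finally show "kernel_op n (?s ^ 2) (const_mpoly (1 / l j) * c j) = c j" .
    qed
    finally show ?thesis by (simp add: c(2))
  qed
  moreover have "kernel_op n (?s ^ 2) h \<in> simplex_preorder n (2 * r)"
  proof (rule kernel_op_square_preorder[OF degree_jackson])
    fix x assume x: "x \<in> std_simplex n"
    have "(\<Sum>j\<le>d. (1 / l j - 1) * eval_mpoly (c j) x) \<ge> - e"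
    proof -
      have "- (\<Sum>j\<le>d. (1 / l j - 1) * eval_mpoly (c j) x) = (\<Sum>j\<le>d. (1 / l j - 1) * (- eval_mpoly (c j) x))"
        by (simp add: sum_negf)
      also have "\<dots> \<le> (\<Sum>j\<le>d. (2 * real j ^ 2 * real n ^ 2 / real r ^ 2) * (G * (M - m)))"
      proof (rule sum_mono)
        fix j assume j: "j \<in> {..d}"
        have "(1 / l j - 1) * (- eval_mpoly (c j) x) \<le> (1 / l j - 1) * (G * (M - m))"
          using l(2)[of j] j cb[of j x] x by (intro mult_left_mono) (auto simp: abs_le_iff)
        also have "\<dots> \<le> (2 * real j ^ 2 * real n ^ 2 / real r ^ 2) * (G * (M - m))"
          using l(3)[of j] j G MM by (intro mult_right_mono) auto
        finally show "(1 / l j - 1) * (- eval_mpoly (c j) x) \<le> (2 * real j ^ 2 * real n ^ 2 / real r ^ 2) * (G * (M - m))" .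
      qed
      also have "\<dots> = (\<Sum>j\<le>d. real j ^ 2) * (2 * real n ^ 2 / real r ^ 2 * (G * (M - m)))"
        unfolding sum_distrib_right by (intro sum.cong refl) simp
      also have "\<dots> \<le> real d ^ 3 * (2 * real n ^ 2 / real r ^ 2 * (G * (M - m)))"
        using G MM by (intro mult_right_mono sum_squares_le_cube) auto
      also have "\<dots> = e" by (simp add: e_def)
      finally show ?thesis by linarith
    qed
    moreover have "eval_mpoly h x = eval_mpoly g x + (\<Sum>j\<le>d. (1 / l j - 1) * eval_mpoly (c j) x) + e"
      by (simp add: h_def c(2) left_diff_distrib sum_subtractf)
    moreover have "eval_mpoly g x \<ge> 0" using m[OF x] by (simp add: g_def)
    ultimately show "0 \<le> eval_mpoly h x" by linarith
  qed
  moreover have "f - const_mpoly (m - e) = g + const_mpoly e"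
    by (simp add: g_def const_mpoly_diff)
  ultimately have "f - const_mpoly (m - e) \<in> simplex_preorder n (2 * r)" by (simp only:)
  then have "m - e \<le> lb_simplex n f r"
    unfolding lb_simplex_def
  proof (intro cSup_upper)
    \<comment> \<open>Every admissible \<open>l\<close> is below the value of \<open>f\<close> at a
      vertex; without such a bound \<open>Sup\<close> would carry no information.\<close>
    show "bdd_above {l. f - const_mpoly l \<in> simplex_preorder n (2 * r)}"
    proof (rule bdd_aboveI)
      fix t assume "t \<in> {l. f - const_mpoly l \<in> simplex_preorder n (2 * r)}"
      then show "t \<le> eval_mpoly f (vertex n)"
        using preorder_nonneg[OF _ vertex_simplex[OF n], of "f - const_mpoly t"] by simp
    qed
  qed simp
  moreover have "e = C_simplex n d / real r ^ 2 * (M - m)"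
    by (simp add: e_def C_simplex_def G_def)
  ultimately show ?thesis by (simp add: m_def M_def)
qed

lemma C_simplex_le: "n \<ge> 1 \<Longrightarrow> C_simplex n d \<le> 2 * real n ^ 2 * real d ^ 3 * even_dim n d"
  unfolding C_simplex_def by (intro mult_left_mono gamma_simplex_le) auto

text \<open>The two symmetric forms of the binomial coefficient: the exponent \<open>n\<close>
  serves for fixed \<open>n\<close>, the exponent \<open>2 * d\<close> for fixed
  \<open>d\<close>.\<close>

lemma even_dim_le_power: "even_dim n d \<le> real (n + 2 * d) ^ n" "even_dim n d \<le> real (n + 2 * d) ^ (2 * d)"
proof -
  show "even_dim n d \<le> real (n + 2 * d) ^ n"
    unfolding even_dim_def of_nat_power[symmetric] of_nat_le_iff by (rule binomial_le_pow) simp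
  have "(n + 2 * d) choose n = (n + 2 * d) choose (2 * d)"
    using binomial_symmetric[of n "n + 2 * d"] by simp
  then show "even_dim n d \<le> real (n + 2 * d) ^ (2 * d)"
    unfolding even_dim_def of_nat_power[symmetric] of_nat_le_iff using binomial_le_pow[of "2 * d" "n + 2 * d"] by simp
qed

theorem theorem4:
  shows "(\<forall>(n::nat) (d::nat) (f::mpoly) (r::nat).
            n \<ge> 1 \<longrightarrow> d \<ge> 1 \<longrightarrow> f \<in> polys n \<longrightarrow> tot_deg f = d \<longrightarrow>
            real r \<ge> 2 * real n * real d * sqrt (real d) \<longrightarrow>
            f_min n f - lb_simplex n f r \<le> C_simplex n d / real r ^ 2 * (f_max n f - f_min n f))
       \<and> (\<forall>d\<ge>1. \<exists>P :: real poly. \<forall>n\<ge>1. C_simplex n d \<le> poly P (real n))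
       \<and> (\<forall>n\<ge>1. \<exists>P :: real poly. \<forall>d\<ge>1. C_simplex n d \<le> poly P (real d))"
proof (intro conjI allI impI)
  fix n d :: nat and f :: mpoly and r :: nat
  assume "n \<ge> 1" "d \<ge> 1" "f \<in> polys n" "tot_deg f = d" "real r \<ge> 2 * real n * real d * sqrt (real d)"
  then show "f_min n f - lb_simplex n f r \<le> C_simplex n d / real r ^ 2 * (f_max n f - f_min n f)"
    by (rule simplex_bound)
next
  fix d :: nat
  show "\<exists>P :: real poly. \<forall>n\<ge>1. C_simplex n d \<le> poly P (real n)"
  proof (intro exI allI impI)
    fix n :: nat assume n: "n \<ge> 1"
    have "C_simplex n d \<le> 2 * real n ^ 2 * real d ^ 3 * real (n + 2 * d) ^ (2 * d)"
      by (rule order_trans[OF C_simplex_le[OF n]]) (intro mult_left_mono even_dim_le_power, simp)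
    also have "\<dots> = poly (smult (2 * real d ^ 3) ([:0, 1:] ^ 2 * [:2 * real d, 1:] ^ (2 * d))) (real n)"
      by (simp add: add.commute)
    finally show "C_simplex n d \<le> poly (smult (2 * real d ^ 3) ([:0, 1:] ^ 2 * [:2 * real d, 1:] ^ (2 * d))) (real n)" .
  qed
next
  fix n :: nat assume n: "n \<ge> 1"
  show "\<exists>P :: real poly. \<forall>d\<ge>1. C_simplex n d \<le> poly P (real d)"
  proof (intro exI allI impI)
    fix d :: nat
    have "C_simplex n d \<le> 2 * real n ^ 2 * real d ^ 3 * real (n + 2 * d) ^ n"
      by (rule order_trans[OF C_simplex_le[OF n]]) (intro mult_left_mono even_dim_le_power, simp)
    also have "\<dots> = poly (smult (2 * real n ^ 2) ([:0, 1:] ^ 3 * [:real n, 2:] ^ n)) (real d)"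
      by (simp add: mult.commute)
    finally show "C_simplex n d \<le> poly (smult (2 * real n ^ 2) ([:0, 1:] ^ 3 * [:real n, 2:] ^ n)) (real d)" .
  qed
qed

end
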